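(* Let $G$ be a countably infinite amenable group, $\Sigma$ a sofic approximation sequence for $G$, and $\pi:(X,G)\to(Y,G)$ a factor map between $G$-systems. Then $\mathrm{mdim}_\Sigma(X|\pi)=\mathrm{mdim}(X|Y)$.
   Context: For $d\in\mathbb N$ write $[d]=\{1,\dots,d\}$ and $\mathrm{Sym}(d)$ for the permutation group of $[d]$. A sofic approximation sequence for a countable group $G$ is a sequence of maps (not necessarily homomorphisms) $\Sigma=\{\sigma_i:G\to\mathrm{Sym}(d_i)\}_{i\ge1}$ such that $\frac1{d_i}|\{v\in[d_i]:\sigma_i(s)\sigma_i(t)(v)=\sigma_i(st)(v)\}|\to1$ for all $s,t\in G$, $\frac1{d_i}|\{v\in[d_i]:\sigma_i(s)(v)=\sigma_i(t)(v)\}|\to0$ for all distinct $s,t\in G$, and $d_i\to\infty$. A countable group is amenable if it admits a Følner sequence: nonempty finite $F_n\subset G$ with $|F_n\setminus gF_n|/|F_n|\to0$ for every $g\in G$. A $G$-system $(X,G)$ is a compact metric space $X$ with a continuous action of $G$ by homeomorphisms. A factor map $\pi:(X,G)\to(Y,G)$ is a continuous surjection with $\pi(gx)=g\pi(x)$. For a finite open cover $\beta$ of a space $K$, $\mathrm{ord}(\beta)=\max_{x\in K}\sum_{U\in\beta}1_U(x)-1$ (and $-\infty$ if $K=\emptyset$). A family of sets refines a cover $\alpha$ if each of its members is contained in a member of $\alpha$; the join $\vee$ of two families consists of pairwise intersections. Sofic conditional mean dimension. $\mathcal F(G)$ is the collection of nonempty finite subsets of $G$. For a compatible metric $\rho$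 on $X$, $F\in\mathcal F(G)$, $\delta>0$ and $\sigma:G\to\mathrm{Sym}(d)$, $\mathrm{Map}(\rho,F,\delta,\sigma)\subset X^d$ is the set of maps $\xi:[d]\to X$ with $\big(\frac1d\sum_{a\in[d]}\rho(\xi(\sigma(s)(a)),s\,\xi(a))^2\big)^{1/2}\le\delta$ for all $s\in F$. Let $\pi^d:X^d\to Y^d$, $\xi\mapsto\pi\circ\xi$. For a finite open cover $\alpha$ of $X$, $\alpha^d$ is the cover of $X^d$ by the sets $U_1\times\cdots\times U_d$, $U_j\in\alpha$. With $M=\mathrm{Map}(\rho,F,\delta,\sigma)$, $D(\alpha|\pi,\rho,F,\delta,\sigma)$ is the minimum of $\mathrm{ord}(\beta)$ over all finite open covers $\beta$ of $M$ such that $\{(\pi^d|_M)^{-1}(y)\}_{y\in\pi^d(M)}\vee\beta$ refines $\alpha^d|_M$. Let $$\mathrm{mdim}_\Sigma(X|\pi)=\sup_\alpha\inf_{F\in\mathcal F(G)}\inf_{\delta>0}\limsup_{i\to\infty}\frac{D(\alpha|\pi,\rho,F,\delta,\sigma_i)}{d_i},$$ the supremum over finite open covers $\alpha$ of $X$; the limsup is $-\infty$ if $\mathrm{Map}(\rho,F,\delta,\sigma_i)=\emptyset$ for all large $i$. The value does not depend on the compatible metric $\rho$. Conditional mean topological dimension for amenable $G$. For a finite open cover $\alpha$ of $X$, $D(\alpha|\pi)$ is the minimum of $\mathrm{ord}(\beta)$ over finite open covers $\beta$ of $X$ such that $\{\pi^{-1}(y)\}_{y\in Y}\vee\beta$ refines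 $\alpha$; for $F\in\mathcal F(G)$, $\alpha^F=\bigvee_{s\in F}s^{-1}\alpha$. Then $$\mathrm{mdim}(X|Y)=\sup_\alpha\lim_F\frac{D(\alpha^F|\pi)}{|F|},$$ the supremum over finite open covers of $X$, where the limit is taken as $F\in\mathcal F(G)$ becomes more and more invariant (equivalently along any Følner sequence; it exists and is independent of the sequence). *)

theory Defs
  imports
    "HOL-Analysis.Analysis"
    "HOL-Algebra.Group_Action"
    "HOL-Combinatorics.Permutations"
begin

section \<open>Amenable groups and sofic approximations\<close>

definition finite_subsets :: "('g, 'm) monoid_scheme \<Rightarrow> 'g set set" where
  "finite_subsets G = {F. F \<subseteq> carrier G \<and> finite F \<and> F \<noteq> {}}"

definition folner_sequence :: "('g, 'm) monoid_scheme \<Rightarrow> (nat \<Rightarrow> 'g set) \<Rightarrow> bool" where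
  "folner_sequence G F \<longleftrightarrow>
     (\<forall>n. F n \<in> finite_subsets G) \<and>
     (\<forall>g\<in>carrier G.
        (\<lambda>n. real (card (F n - (g <#\<^bsub>G\<^esub> F n))) / real (card (F n))) \<longlonglongrightarrow> 0)"

definition amenable :: "('g, 'm) monoid_scheme \<Rightarrow> bool" where
  "amenable G \<longleftrightarrow> (\<exists>F. folner_sequence G F)"

text \<open>
  The filter expressing that a nonempty finite subset \<open>F\<close> of \<open>G\<close> becomes more and more invariant:
  a property holds eventually iff it holds for all \<open>F\<close> that are invariant enough, up to some
  \<open>\<epsilon> > 0\<close> and with respect to some finite \<open>K\<close>. A sequence of nonempty finite subsets is a Folner
  sequence iff it converges along this filter.
\<close>

definition invariance_filter :: "('g, 'm) monoid_scheme \<Rightarrow> 'g set filter" where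
  "invariance_filter G =
     (INF (K, \<epsilon>) \<in> {K. K \<subseteq> carrier G \<and> finite K} \<times> {0::real<..}.
        principal {F \<in> finite_subsets G.
          \<forall>g\<in>K. real (card (F - (g <#\<^bsub>G\<^esub> F))) \<le> \<epsilon> * real (card F)})"

definition sofic_approximation ::
    "('g, 'm) monoid_scheme \<Rightarrow> (nat \<Rightarrow> nat) \<Rightarrow> (nat \<Rightarrow> 'g \<Rightarrow> nat \<Rightarrow> nat) \<Rightarrow> bool" where
  "sofic_approximation G d \<sigma> \<longleftrightarrow>
     (\<forall>i. \<forall>s\<in>carrier G. \<sigma> i s permutes {1..d i}) \<and>
     (\<forall>s\<in>carrier G. \<forall>t\<in>carrier G.
        (\<lambda>i. real (card {v \<in> {1..d i}. \<sigma> i s (\<sigma> i t v) = \<sigma> i (s \<otimes>\<^bsub>G\<^esub> t) v}) / real (d i))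
          \<longlonglongrightarrow> 1) \<and>
     (\<forall>s\<in>carrier G. \<forall>t\<in>carrier G. s \<noteq> t \<longrightarrow>
        (\<lambda>i. real (card {v \<in> {1..d i}. \<sigma> i s v = \<sigma> i t v}) / real (d i)) \<longlonglongrightarrow> 0) \<and>
     filterlim d at_top sequentially"


section \<open>Systems and factor maps\<close>

definition G_system ::
    "('g, 'm) monoid_scheme \<Rightarrow> 'x topology \<Rightarrow> ('g \<Rightarrow> 'x \<Rightarrow> 'x) \<Rightarrow> bool" where
  "G_system G X \<phi> \<longleftrightarrow>
     compact_space X \<and> metrizable_space X \<and>
     group_action G (topspace X) \<phi> \<and> (\<forall>g\<in>carrier G. continuous_map X X (\<phi> g))"

definition factor_map ::
    "('g, 'm) monoid_scheme \<Rightarrow> 'x topology \<Rightarrow> ('g \<Rightarrow> 'x \<Rightarrow> 'x) \<Rightarrow>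
     'y topology \<Rightarrow> ('g \<Rightarrow> 'y \<Rightarrow> 'y) \<Rightarrow> ('x \<Rightarrow> 'y) \<Rightarrow> bool" where
  "factor_map G X \<phi> Y \<psi> \<pi> \<longleftrightarrow>
     continuous_map X Y \<pi> \<and> \<pi> ` topspace X = topspace Y \<and>
     (\<forall>g\<in>carrier G. \<forall>x\<in>topspace X. \<pi> (\<phi> g x) = \<psi> g (\<pi> x))"

definition compatible_metric :: "'x topology \<Rightarrow> ('x \<Rightarrow> 'x \<Rightarrow> real) \<Rightarrow> bool" where
  "compatible_metric X \<rho> \<longleftrightarrow>
     Metric_space (topspace X) \<rho> \<and> Metric_space.mtopology (topspace X) \<rho> = X"


section \<open>Covers\<close>

definition finite_open_cover :: "'a topology \<Rightarrow> 'a set set \<Rightarrow> bool" where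
  "finite_open_cover T \<beta> \<longleftrightarrow> finite \<beta> \<and> (\<forall>U\<in>\<beta>. openin T U) \<and> \<Union>\<beta> = topspace T"

text \<open>
  For finite \<open>\<beta>\<close> the supremum is a maximum if \<open>K \<noteq> {}\<close>, and it is \<open>-\<infinity>\<close> if \<open>K = {}\<close>.
\<close>

definition cover_ord :: "'a set \<Rightarrow> 'a set set \<Rightarrow> ereal" where
  "cover_ord K \<beta> = (SUP x\<in>K. ereal (real (card {U \<in> \<beta>. x \<in> U}) - 1))"

definition refines :: "'a set set \<Rightarrow> 'a set set \<Rightarrow> bool" where
  "refines \<beta> \<alpha> \<longleftrightarrow> (\<forall>V\<in>\<beta>. \<exists>U\<in>\<alpha>. V \<subseteq> U)"

definition cover_join :: "'a set set \<Rightarrow> 'a set set \<Rightarrow> 'a set set" where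
  "cover_join \<A> \<B> = {A \<inter> B | A B. A \<in> \<A> \<and> B \<in> \<B>}"

definition fibres :: "'a set \<Rightarrow> ('a \<Rightarrow> 'b) \<Rightarrow> 'b set \<Rightarrow> 'a set set" where
  "fibres K f B = (\<lambda>y. {x \<in> K. f x = y}) ` B"

text \<open>
  The orders lie in \<open>{-\<infinity>, 0, 1, 2, \<dots>}\<close>, so the infimum is attained as soon as some \<open>\<beta>\<close> is
  admissible, for instance \<open>\<beta> = \<alpha>\<close> if \<open>\<alpha>\<close> is itself a finite open cover.
\<close>

definition cond_D :: "'a topology \<Rightarrow> ('a \<Rightarrow> 'b) \<Rightarrow> 'b set \<Rightarrow> 'a set set \<Rightarrow> ereal" where
  "cond_D T f B \<alpha> =
     (INF \<beta> \<in> {\<beta>. finite_open_cover T \<beta> \<and>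
                  refines (cover_join (fibres (topspace T) f B) \<beta>) \<alpha>}.
        cover_ord (topspace T) \<beta>)"


section \<open>Sofic conditional mean dimension\<close>

text \<open>
  \<open>X\<^sup>d\<close> is the product of copies of \<open>X\<close> over \<open>{1..d}\<close>; its points are extensional functions.
\<close>

abbreviation power_topology :: "nat \<Rightarrow> 'x topology \<Rightarrow> (nat \<Rightarrow> 'x) topology" where
  "power_topology d X \<equiv> product_topology (\<lambda>_. X) {1..d}"

definition power_map :: "nat \<Rightarrow> ('x \<Rightarrow> 'y) \<Rightarrow> (nat \<Rightarrow> 'x) \<Rightarrow> nat \<Rightarrow> 'y" where
  "power_map d \<pi> \<xi> = (\<lambda>a\<in>{1..d}. \<pi> (\<xi> a))"

definition power_cover :: "nat \<Rightarrow> 'x set set \<Rightarrow> (nat \<Rightarrow> 'x) set set" where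
  "power_cover d \<alpha> = {PiE {1..d} U | U. U \<in> {1..d} \<rightarrow> \<alpha>}"

definition restrict_family :: "'a set set \<Rightarrow> 'a set \<Rightarrow> 'a set set" where
  "restrict_family \<A> M = (\<lambda>A. A \<inter> M) ` \<A>"

definition sofic_Map ::
    "'x topology \<Rightarrow> ('g \<Rightarrow> 'x \<Rightarrow> 'x) \<Rightarrow> ('x \<Rightarrow> 'x \<Rightarrow> real) \<Rightarrow> 'g set \<Rightarrow> real \<Rightarrow>
     nat \<Rightarrow> ('g \<Rightarrow> nat \<Rightarrow> nat) \<Rightarrow> (nat \<Rightarrow> 'x) set" where
  "sofic_Map X \<phi> \<rho> F \<delta> d \<sigma> =
     {\<xi> \<in> topspace (power_topology d X). \<forall>s\<in>F.
        sqrt (1 / real d * (\<Sum>a\<in>{1..d}. (\<rho> (\<xi> (\<sigma> s a)) (\<phi> s (\<xi> a)))\<^sup>2)) \<le> \<delta>}"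

definition sofic_D ::
    "'x topology \<Rightarrow> ('g \<Rightarrow> 'x \<Rightarrow> 'x) \<Rightarrow> 'x set set \<Rightarrow> ('x \<Rightarrow> 'y) \<Rightarrow> ('x \<Rightarrow> 'x \<Rightarrow> real) \<Rightarrow>
     'g set \<Rightarrow> real \<Rightarrow> nat \<Rightarrow> ('g \<Rightarrow> nat \<Rightarrow> nat) \<Rightarrow> ereal" where
  "sofic_D X \<phi> \<alpha> \<pi> \<rho> F \<delta> d \<sigma> =
     (let M = sofic_Map X \<phi> \<rho> F \<delta> d \<sigma> in
      cond_D (subtopology (power_topology d X) M) (power_map d \<pi>) (power_map d \<pi> ` M)
        (restrict_family (power_cover d \<alpha>) M))"

definition sofic_cond_mdim ::
    "('g, 'm) monoid_scheme \<Rightarrow> (nat \<Rightarrow> nat) \<Rightarrow> (nat \<Rightarrow> 'g \<Rightarrow> nat \<Rightarrow> nat) \<Rightarrow>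
     'x topology \<Rightarrow> ('g \<Rightarrow> 'x \<Rightarrow> 'x) \<Rightarrow> ('x \<Rightarrow> 'x \<Rightarrow> real) \<Rightarrow> ('x \<Rightarrow> 'y) \<Rightarrow> ereal" where
  "sofic_cond_mdim G d \<sigma> X \<phi> \<rho> \<pi> =
     (SUP \<alpha> \<in> {\<alpha>. finite_open_cover X \<alpha>}. INF F \<in> finite_subsets G. INF \<delta> \<in> {0<..}.
        limsup (\<lambda>i. sofic_D X \<phi> \<alpha> \<pi> \<rho> F \<delta> (d i) (\<sigma> i) / ereal (real (d i))))"


section \<open>Conditional mean dimension for amenable groups\<close>

definition cover_iterate ::
    "'x topology \<Rightarrow> ('g \<Rightarrow> 'x \<Rightarrow> 'x) \<Rightarrow> 'g set \<Rightarrow> 'x set set \<Rightarrow> 'x set set" where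
  "cover_iterate X \<phi> F \<alpha> = {{x \<in> topspace X. \<forall>s\<in>F. \<phi> s x \<in> U s} | U. U \<in> F \<rightarrow> \<alpha>}"

definition cond_mdim ::
    "('g, 'm) monoid_scheme \<Rightarrow> 'x topology \<Rightarrow> ('g \<Rightarrow> 'x \<Rightarrow> 'x) \<Rightarrow> 'y topology \<Rightarrow>
     ('x \<Rightarrow> 'y) \<Rightarrow> ereal" where
  "cond_mdim G X \<phi> Y \<pi> =
     (SUP \<alpha> \<in> {\<alpha>. finite_open_cover X \<alpha>}.
        Lim (invariance_filter G)
          (\<lambda>F. cond_D X \<pi> (topspace Y) (cover_iterate X \<phi> F \<alpha>) / ereal (real (card F))))"

end

theory Submission
  imports Defs
begin

text \<open>
  Write \<open>h(E)\<close> for the conditional dimension \<open>D(\<alpha>\<^sup>E|\<pi>)\<close> of the cover generated by the coordinates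
  \<open>x \<mapsto> sx\<close>, \<open>s \<in> E\<close>. Both invariants measure the cost per coordinate of resolving \<open>\<alpha>\<close> in many
  coordinates at once: on \<open>X\<close> along the orbit of a point over a Folner set, and on the space of
  microstates along \<open>{1..d}\<close>. Two facts carry the comparison.

  The first one is that open covers merge with additive cost (\<open>merge_covers\<close>): finitely many
  finite open covers have a common finite open refinement whose order at each single point is at
  most the sum of the orders of the given covers at that point. Because the estimate is pointwise,
  a cover that is expensive only where few bad events happen contributes only the number of bad
  events at the point. The merged cover is read off from overlapping intervals on the real line.

  The second one is the Ornstein-Weiss quasi-tiling theorem (\<open>quasi_tiling_exists\<close>) for any finite
  set on which the group almost acts freely, be it a Folner set under translation or \<open>{1..d}\<close> under
  a sofic approximation. It is proved with prescribed numbers of tiles of each shape, and these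
  numbers depend only on the size of the set to be tiled (\<open>tile_counts\<close>).

  Existence of the limit \<open>L(\<alpha>)\<close> of \<open>h(E)/|E|\<close> follows by tiling a very invariant \<open>E\<close> with shapes
  whose ratio \<open>h(F)/|F|\<close> is close to the lower limit and merging translates of optimal covers
  (\<open>orbit_D_limit_exists\<close>).

  Upper bound for the sofic side (\<open>sofic_D_eventually_le\<close>): tile \<open>{1..d}\<close>. On the tile \<open>\<sigma>(F)c\<close> a
  microstate \<open>\<xi>\<close> stays close to the orbit piece \<open>s\<xi>(c)\<close>, \<open>s \<in> F\<close>, except for a small proportion of
  the centres \<open>c\<close>, which depends on \<open>\<xi>\<close>. So an optimal cover of \<open>X\<close> for the shape \<open>F\<close>, applied to the
  coordinate \<open>\<xi>(c)\<close>, resolves the whole tile; near the microstates for which \<open>c\<close> is bad one uses the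
  product of copies of \<open>\<alpha>\<close> instead. After merging, the bad centres cost a constant times their
  small number. Since the orbit is followed only approximately, \<open>\<alpha>\<close> is compared with a cover whose
  members have a neighbourhood of fixed size inside members of \<open>\<alpha>\<close>; this is harmless under the
  supremum over covers.

  Lower bound for the sofic side (\<open>sofic_D_eventually_ge\<close>): dimension is not superadditive on
  products, so it cannot be estimated tile by tile. Instead take a Folner set \<open>E\<close> of almost exactly
  \<open>d\<close> elements, tile both \<open>E\<close> and \<open>{1..d}\<close> with equal numbers of tiles of each shape and match the
  tiles. This yields \<open>\<tau>\<close> from \<open>{1..d}\<close> to the group that is almost equivariant and covers most of \<open>E\<close>
  (\<open>sofic_models_folner_set\<close>). The map \<open>x \<mapsto> (\<tau>(a)x)\<^sub>a\<close> sends \<open>X\<close> into the microstates, respects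
  fibres, and pulls \<open>\<alpha>\<^sup>d\<close> back to a refinement of \<open>\<alpha>\<^sup>E\<close> up to few coordinates. Hence \<open>h(E)\<close> is at most
  the sofic quantity plus an error of small order.
\<close>

section \<open>Merging open covers\<close>

definition multiplicity_at :: "'a set set \<Rightarrow> 'a \<Rightarrow> nat" where
  "multiplicity_at \<beta> x = card {U \<in> \<beta>. x \<in> U}"

text \<open>
  The witness is the distance to the complement; the whole space needs a separate treatment, since
  its complement is empty.
\<close>

lemma metrizable_open_eq_cozero:
  assumes "metrizable_space T" and "openin T U"
  obtains f where "continuous_map T euclideanreal f"
    and "\<And>x. x \<in> topspace T \<Longrightarrow> 0 \<le> f x"
    and "\<And>x. x \<in> topspace T \<Longrightarrow> 0 < f x \<longleftrightarrow> x \<in> U"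
proof (cases "U = topspace T")
  case True
  show ?thesis by (rule that[of "\<lambda>_. 1"]) (use True in auto)
next
  case False
  obtain M d where "Metric_space M d" and T: "T = Metric_space.mtopology M d"
    using assms(1) unfolding metrizable_space_def by blast
  interpret Metric_space M d by fact
  have UM: "U \<subseteq> M" and op: "\<And>x. x \<in> U \<Longrightarrow> \<exists>r>0. mball x r \<subseteq> U"
    using assms(2) unfolding T openin_mtopology by auto
  define C where "C = M - U"
  have C: "C \<noteq> {}" "C \<subseteq> M" using False UM by (auto simp: C_def T)
  define f where "f = (\<lambda>x. INF y\<in>C. d x y)"
  have bdd: "bdd_below (d x ` C)" for x
    by (rule bdd_belowI[of _ 0]) auto
  have f_ge: "0 \<le> f x" for x
    unfolding f_def by (rule cINF_greatest) (use C in auto)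
  have step: "f x \<le> f y + d x y" if "x \<in> M" "y \<in> M" for x y
  proof -
    have "f x - d x y \<le> d y z" if "z \<in> C" for z
    proof -
      have "f x \<le> d x z" unfolding f_def by (rule cINF_lower[OF bdd that])
      also have "\<dots> \<le> d x y + d y z" using triangle \<open>x \<in> M\<close> \<open>y \<in> M\<close> that C by blast
      finally show ?thesis by simp
    qed
    hence "f x - d x y \<le> f y" unfolding f_def[of] by (intro cINF_greatest) (use C in \<open>auto simp: f_def\<close>)
    thus ?thesis by simp
  qed
  have "continuous_map mtopology (Metric_space.mtopology UNIV dist) f"
  proof (subst metric_continuous_map)
    show "Metric_space (UNIV::real set) dist" by (rule Met_TC.Metric_space_axioms)
    show "f ` M \<subseteq> UNIV \<and> (\<forall>a\<in>M. \<forall>\<epsilon>>0. \<exists>\<delta>>0. \<forall>x. x \<in> M \<and> d a x < \<delta> \<longrightarrow> dist (f a) (f x) < \<epsilon>)"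
    proof (intro conjI ballI allI impI)
      fix a and e :: real assume a: "a \<in> M" and e: "0 < e"
      show "\<exists>\<delta>>0. \<forall>x. x \<in> M \<and> d a x < \<delta> \<longrightarrow> dist (f a) (f x) < e"
      proof (intro exI[of _ e] conjI allI impI e)
        fix x assume x: "x \<in> M \<and> d a x < e"
        with step[of a x] step[of x a] a commute[of a x] show "dist (f a) (f x) < e"
          by (auto simp: dist_real_def)
      qed
    qed auto
  qed
  hence cont: "continuous_map T euclideanreal f" by (simp add: T)
  have pos: "0 < f x \<longleftrightarrow> x \<in> U" if "x \<in> M" for x
  proof
    assume "0 < f x"
    show "x \<in> U"
    proof (rule ccontr)
      assume "x \<notin> U"
      hence "x \<in> C" using that by (simp add: C_def)
      hence "f x \<le> d x x" unfolding f_def by (intro cINF_lower[OF bdd])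
      thus False using \<open>0 < f x\<close> that by simp
    qed
  next
    assume "x \<in> U"
    then obtain r where r: "r > 0" "mball x r \<subseteq> U" using op by blast
    have "r \<le> d x y" if "y \<in> C" for y
      using that r \<open>x \<in> M\<close> by (force simp: C_def)
    hence "r \<le> f x" unfolding f_def by (intro cINF_greatest) (use C in auto)
    thus "0 < f x" using r by simp
  qed
  show ?thesis by (rule that[of f]) (use cont f_ge pos in \<open>auto simp: T\<close>)
qed

text \<open>
  An overlapping pair is determined by the left end point of the overlap, since the intervals of
  each family are disjoint. This point is a left end point of one of the two intervals, and the left
  end point \<open>0\<close> occurs in both families, which saves one.
\<close>

lemma card_overlapping_intervals:
  fixes s f :: "'a \<Rightarrow> real" and t g :: "'b \<Rightarrow> real"
  assumes fin: "finite A" "finite B"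
    and dA: "\<And>u u'. u \<in> A \<Longrightarrow> u' \<in> A \<Longrightarrow> u \<noteq> u' \<Longrightarrow> s u + f u \<le> s u' \<or> s u' + f u' \<le> s u"
    and dB: "\<And>v v'. v \<in> B \<Longrightarrow> v' \<in> B \<Longrightarrow> v \<noteq> v' \<Longrightarrow> t v + g v \<le> t v' \<or> t v' + g v' \<le> t v"
    and a: "a \<in> A" "s a = 0" and b: "b \<in> B" "t b = 0"
  shows "card {(u, v) \<in> A \<times> B. max (s u) (t v) < min (s u + f u) (t v + g v)} + 1
           \<le> card A + card B"
proof -
  let ?P = "{(u, v) \<in> A \<times> B. max (s u) (t v) < min (s u + f u) (t v + g v)}"
  let ?e = "\<lambda>(u, v). max (s u) (t v)"
  have inj: "inj_on ?e ?P"
  proof (rule inj_onI, clarsimp, goal_cases)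
    case (1 u v u' v')
    have "u = u'"
    proof (rule ccontr)
      assume "u \<noteq> u'"
      with dA[of u u'] 1 show False by linarith
    qed
    moreover have "v = v'"
    proof (rule ccontr)
      assume "v \<noteq> v'"
      with dB[of v v'] 1 show False by linarith
    qed
    ultimately show ?case by simp
  qed
  have "card ?P = card (?e ` ?P)" using inj by (simp add: card_image)
  also have "\<dots> \<le> card (s ` A \<union> t ` B)"
    by (rule card_mono) (use fin in \<open>auto simp: max_def\<close>)
  finally have 1: "card ?P \<le> card (s ` A \<union> t ` B)" .
  have "0 \<in> s ` A \<inter> t ` B" using a b by force
  hence "card (s ` A \<inter> t ` B) \<ge> 1"
    by (metis One_nat_def Suc_leI card_gt_0_iff emptyE fin(1) finite_Int finite_imageI)
  moreover have "card (s ` A) + card (t ` B) = card (s ` A \<union> t ` B) + card (s ` A \<inter> t ` B)"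
    by (rule card_Un_Int) (use fin in auto)
  ultimately have "card (s ` A \<union> t ` B) + 1 \<le> card (s ` A) + card (t ` B)" by linarith
  also have "\<dots> \<le> card A + card B" by (intro add_mono card_image_le fin)
  finally show ?thesis using 1 by linarith
qed

text \<open>
  At a point \<open>x\<close> the half-open intervals of length \<open>f U x\<close> starting at \<open>s U x\<close> are pairwise disjoint
  and the nondegenerate ones among them are those of the sets \<open>U\<close> that contain \<open>x\<close>. One of
  the latter starts at \<open>0\<close>; the total length varies with \<open>x\<close>.
\<close>

definition interval_system ::
    "'a topology \<Rightarrow> 'a set set \<Rightarrow> ('a set \<Rightarrow> 'a \<Rightarrow> real) \<Rightarrow> ('a set \<Rightarrow> 'a \<Rightarrow> real) \<Rightarrow> bool" where
  "interval_system T \<beta> f s \<longleftrightarrow>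
     (\<forall>U\<in>\<beta>. continuous_map T euclideanreal (f U) \<and> continuous_map T euclideanreal (s U)) \<and>
     (\<forall>x\<in>topspace T.
        (\<forall>U\<in>\<beta>. 0 < f U x \<longleftrightarrow> x \<in> U) \<and>
        (\<forall>U\<in>\<beta>. \<forall>U'\<in>\<beta>. U \<noteq> U' \<longrightarrow> s U x + f U x \<le> s U' x \<or> s U' x + f U' x \<le> s U x) \<and>
        (\<exists>U\<in>\<beta>. x \<in> U \<and> s U x = 0))"

text \<open>
  The starting points are the partial sums of the functions \<open>f U\<close> in a fixed enumeration of the
  cover.
\<close>

lemma interval_system_exists:
  assumes T: "metrizable_space T" and \<beta>: "finite_open_cover T \<beta>"
  obtains f s where "interval_system T \<beta> f s"
proof -
  have fin: "finite \<beta>" and op: "\<And>U. U \<in> \<beta> \<Longrightarrow> openin T U" and cov: "\<Union>\<beta> = topspace T"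
    using \<beta> by (auto simp: finite_open_cover_def)
  have "\<forall>U\<in>\<beta>. \<exists>f. continuous_map T euclideanreal f \<and>
          (\<forall>x\<in>topspace T. 0 \<le> f x \<and> (0 < f x \<longleftrightarrow> x \<in> U))"
  proof
    fix U assume "U \<in> \<beta>"
    from metrizable_open_eq_cozero[OF T op[OF this]]
    show "\<exists>f. continuous_map T euclideanreal f \<and>
          (\<forall>x\<in>topspace T. 0 \<le> f x \<and> (0 < f x \<longleftrightarrow> x \<in> U))" by metis
  qed
  from bchoice[OF this] obtain f where f: "\<And>U. U \<in> \<beta> \<Longrightarrow> continuous_map T euclideanreal (f U)"
      "\<And>U x. U \<in> \<beta> \<Longrightarrow> x \<in> topspace T \<Longrightarrow> 0 \<le> f U x"
      "\<And>U x. U \<in> \<beta> \<Longrightarrow> x \<in> topspace T \<Longrightarrow> 0 < f U x \<longleftrightarrow> x \<in> U"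
    by blast
  obtain e :: "'a set \<Rightarrow> nat" where e: "inj_on e \<beta>"
    using fin finite_imp_inj_to_nat_seg by blast
  define s where "s = (\<lambda>U x. \<Sum>U' | U' \<in> \<beta> \<and> e U' < e U. f U' x)"
  have s_cont: "continuous_map T euclideanreal (s U)" for U
    unfolding s_def by (rule continuous_map_sum) (use fin f(1) in auto)
  have below: "s U x + f U x \<le> s U' x"
    if "U \<in> \<beta>" "U' \<in> \<beta>" "x \<in> topspace T" "e U < e U'" for U U' x
  proof -
    have "s U x + f U x = (\<Sum>V \<in> insert U {V \<in> \<beta>. e V < e U}. f V x)"
      using fin by (simp add: s_def add.commute)
    also have "\<dots> \<le> s U' x"
      unfolding s_def by (rule sum_mono2) (use fin that f(2) in auto)
    finally show ?thesis .
  qed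
  have first: "\<exists>U\<in>\<beta>. x \<in> U \<and> s U x = 0" if x: "x \<in> topspace T" for x
  proof -
    have ne: "e ` {U \<in> \<beta>. x \<in> U} \<noteq> {}" and fi: "finite (e ` {U \<in> \<beta>. x \<in> U})"
      using cov x fin by auto
    obtain U where U: "U \<in> \<beta>" "x \<in> U" "e U = Min (e ` {U \<in> \<beta>. x \<in> U})"
      using Min_in[OF fi ne] by auto
    have "f V x = 0" if "V \<in> \<beta>" "e V < e U" for V
    proof -
      have "x \<notin> V"
      proof
        assume "x \<in> V"
        hence "e U \<le> e V" unfolding U(3) by (intro Min_le) (use fi that in auto)
        thus False using that by simp
      qed
      thus ?thesis using f(2,3)[OF that(1) x] by force
    qed
    hence "s U x = 0" by (simp add: s_def)
    thus ?thesis using U by blast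
  qed
  have "s U x + f U x \<le> s U' x \<or> s U' x + f U' x \<le> s U x"
    if "U \<in> \<beta>" "U' \<in> \<beta>" "x \<in> topspace T" "U \<noteq> U'" for U U' x
  proof -
    have "e U < e U' \<or> e U' < e U" using e that by (metis inj_on_eq_iff linorder_neqE_nat)
    thus ?thesis using below that by blast
  qed
  hence "interval_system T \<beta> f s"
    unfolding interval_system_def by (intro conjI ballI impI) (simp_all add: f(1,3) s_cont first)
  thus ?thesis by (rule that)
qed

text \<open>
  A member of the merged cover belongs to a pair \<open>(U, V)\<close> and consists of the points at which the
  intervals of \<open>U\<close> and of \<open>V\<close> overlap. The first intervals of both systems always overlap, which
  gives the covering property, and the number of overlaps is bounded by
  \<open>card_overlapping_intervals\<close>. The naive join would have multiplicity up to the product of the two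
  multiplicities instead of their sum.
\<close>

lemma merge_two_covers:
  assumes T: "metrizable_space T" and \<beta>: "finite_open_cover T \<beta>" and \<gamma>: "finite_open_cover T \<gamma>"
  obtains \<omega> where "finite_open_cover T \<omega>" "refines \<omega> \<beta>" "refines \<omega> \<gamma>"
    "\<And>x. x \<in> topspace T \<Longrightarrow>
       multiplicity_at \<omega> x + 1 \<le> multiplicity_at \<beta> x + multiplicity_at \<gamma> x"
proof -
  obtain f s where "interval_system T \<beta> f s" using interval_system_exists[OF T \<beta>] .
  hence f: "\<And>U. U \<in> \<beta> \<Longrightarrow> continuous_map T euclideanreal (f U)"
    and s: "\<And>U. U \<in> \<beta> \<Longrightarrow> continuous_map T euclideanreal (s U)"
    and fU: "\<And>U x. U \<in> \<beta> \<Longrightarrow> x \<in> topspace T \<Longrightarrow> 0 < f U x \<longleftrightarrow> x \<in> U"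
    and sd: "\<And>U U' x. U \<in> \<beta> \<Longrightarrow> U' \<in> \<beta> \<Longrightarrow> x \<in> topspace T \<Longrightarrow> U \<noteq> U' \<Longrightarrow>
       s U x + f U x \<le> s U' x \<or> s U' x + f U' x \<le> s U x"
    and s0: "\<And>x. x \<in> topspace T \<Longrightarrow> \<exists>U\<in>\<beta>. x \<in> U \<and> s U x = 0"
    by (simp_all add: interval_system_def)
  obtain g t where "interval_system T \<gamma> g t" using interval_system_exists[OF T \<gamma>] .
  hence g: "\<And>U. U \<in> \<gamma> \<Longrightarrow> continuous_map T euclideanreal (g U)"
    and t: "\<And>U. U \<in> \<gamma> \<Longrightarrow> continuous_map T euclideanreal (t U)"
    and gU: "\<And>U x. U \<in> \<gamma> \<Longrightarrow> x \<in> topspace T \<Longrightarrow> 0 < g U x \<longleftrightarrow> x \<in> U"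
    and td: "\<And>U U' x. U \<in> \<gamma> \<Longrightarrow> U' \<in> \<gamma> \<Longrightarrow> x \<in> topspace T \<Longrightarrow> U \<noteq> U' \<Longrightarrow>
       t U x + g U x \<le> t U' x \<or> t U' x + g U' x \<le> t U x"
    and t0: "\<And>x. x \<in> topspace T \<Longrightarrow> \<exists>U\<in>\<gamma>. x \<in> U \<and> t U x = 0"
    by (simp_all add: interval_system_def)
  have fin: "finite \<beta>" "finite \<gamma>" using \<beta> \<gamma> by (auto simp: finite_open_cover_def)
  define W where "W = (\<lambda>(U, V). {x \<in> topspace T.
      0 < min (s U x + f U x) (t V x + g V x) - max (s U x) (t V x)})"
  have opW: "openin T (W (U, V))" if "U \<in> \<beta>" "V \<in> \<gamma>" for U V
  proof -
    have "continuous_map T euclideanreal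
            (\<lambda>x. min (s U x + f U x) (t V x + g V x) - max (s U x) (t V x))"
      by (intro continuous_intros f s g t that)
    from openin_continuous_map_preimage[OF this, of "{0<..}"] show ?thesis
      by (simp add: W_def)
  qed
  have WU: "W (U, V) \<subseteq> U \<inter> V" if "U \<in> \<beta>" "V \<in> \<gamma>" for U V
  proof
    fix x assume x: "x \<in> W (U, V)"
    hence "x \<in> topspace T" "0 < f U x" "0 < g V x" by (auto simp: W_def)
    thus "x \<in> U \<inter> V" using fU gU that by blast
  qed
  define \<omega> where "\<omega> = W ` (\<beta> \<times> \<gamma>)"
  have cov: "x \<in> \<Union>\<omega>" if x: "x \<in> topspace T" for x
  proof -
    obtain U where U: "U \<in> \<beta>" "x \<in> U" "s U x = 0" using s0[OF x] by blast
    obtain V where V: "V \<in> \<gamma>" "x \<in> V" "t V x = 0" using t0[OF x] by blast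
    have "0 < f U x" "0 < g V x" using fU gU x U V by auto
    hence "x \<in> W (U, V)" using x U V by (simp add: W_def)
    thus ?thesis using U V by (auto simp: \<omega>_def)
  qed
  show ?thesis
  proof
    show "finite_open_cover T \<omega>"
      unfolding finite_open_cover_def
    proof (intro conjI)
      show "finite \<omega>" using fin by (simp add: \<omega>_def)
      show "\<forall>U\<in>\<omega>. openin T U" using opW by (auto simp: \<omega>_def)
      thus "\<Union>\<omega> = topspace T" using cov openin_subset by blast
    qed
    have "\<exists>U\<in>\<beta>. \<exists>V\<in>\<gamma>. Z \<subseteq> U \<inter> V" if Z: "Z \<in> \<omega>" for Z
    proof -
      obtain U V where UV: "U \<in> \<beta>" "V \<in> \<gamma>" "Z = W (U, V)"
        using Z unfolding \<omega>_def by blast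
      with WU[OF UV(1,2)] show ?thesis by blast
    qed
    thus "refines \<omega> \<beta>" "refines \<omega> \<gamma>" unfolding refines_def by (meson le_inf_iff)+
    fix x assume x: "x \<in> topspace T"
    let ?A = "{U \<in> \<beta>. x \<in> U}" and ?B = "{V \<in> \<gamma>. x \<in> V}"
    let ?P = "{(U, V) \<in> ?A \<times> ?B.
      max (s U x) (t V x) < min (s U x + f U x) (t V x + g V x)}"
    obtain U where U: "U \<in> ?A" "s U x = 0" using s0[OF x] by blast
    obtain V where V: "V \<in> ?B" "t V x = 0" using t0[OF x] by blast
    have "card ?P + 1 \<le> card ?A + card ?B"
      by (rule card_overlapping_intervals[where a = U and b = V]) (use U V in \<open>simp_all add: fin sd td x\<close>)
    moreover have "multiplicity_at \<omega> x \<le> card ?P"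
    proof -
      have finP: "finite ?P"
        by (rule finite_subset[of _ "\<beta> \<times> \<gamma>"]) (use fin in auto)
      have "{Z \<in> \<omega>. x \<in> Z} \<subseteq> W ` ?P"
      proof
        fix Z assume Z: "Z \<in> {Z \<in> \<omega>. x \<in> Z}"
        then obtain U V where UV: "U \<in> \<beta>" "V \<in> \<gamma>" "Z = W (U, V)" "x \<in> W (U, V)"
          by (auto simp: \<omega>_def)
        hence "(U, V) \<in> ?P" using WU[OF UV(1,2)] by (auto simp: W_def)
        thus "Z \<in> W ` ?P" using UV by blast
      qed
      hence "multiplicity_at \<omega> x \<le> card (W ` ?P)"
        unfolding multiplicity_at_def by (rule card_mono[rotated]) (use finP in simp)
      also have "\<dots> \<le> card ?P" by (rule card_image_le[OF finP])
      finally show ?thesis .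
    qed
    ultimately show "multiplicity_at \<omega> x + 1 \<le> multiplicity_at \<beta> x + multiplicity_at \<gamma> x"
      by (simp add: multiplicity_at_def)
  qed
qed

lemma refines_trans: "refines \<alpha> \<beta> \<Longrightarrow> refines \<beta> \<gamma> \<Longrightarrow> refines \<alpha> \<gamma>"
  unfolding refines_def by (meson order_trans)

lemma merge_covers:
  assumes T: "metrizable_space T" and "finite I"
    and "\<And>i. i \<in> I \<Longrightarrow> finite_open_cover T (\<beta> i)"
  shows "\<exists>\<omega>. finite_open_cover T \<omega> \<and> (\<forall>i\<in>I. refines \<omega> (\<beta> i)) \<and>
    (\<forall>x\<in>topspace T. real (multiplicity_at \<omega> x) - 1 \<le> (\<Sum>i\<in>I. real (multiplicity_at (\<beta> i) x) - 1))"
  using assms(2,3)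
proof (induction I)
  case empty
  have "real (multiplicity_at {topspace T} x) - 1 \<le> 0" if "x \<in> topspace T" for x
  proof -
    have "{U \<in> {topspace T}. x \<in> U} = {topspace T}" using that by auto
    thus ?thesis by (simp add: multiplicity_at_def)
  qed
  moreover have "finite_open_cover T {topspace T}" by (simp add: finite_open_cover_def)
  ultimately show ?case by (intro exI[of _ "{topspace T}"]) auto
next
  case (insert i I)
  then obtain \<omega> where \<omega>: "finite_open_cover T \<omega>" "\<And>i. i \<in> I \<Longrightarrow> refines \<omega> (\<beta> i)"
    "\<And>x. x \<in> topspace T \<Longrightarrow>
      real (multiplicity_at \<omega> x) - 1 \<le> (\<Sum>i\<in>I. real (multiplicity_at (\<beta> i) x) - 1)"
    by (metis insertCI)
  obtain \<omega>' where \<omega>': "finite_open_cover T \<omega>'" "refines \<omega>' (\<beta> i)" "refines \<omega>' \<omega>"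
    "\<And>x. x \<in> topspace T \<Longrightarrow>
       multiplicity_at \<omega>' x + 1 \<le> multiplicity_at (\<beta> i) x + multiplicity_at \<omega> x"
    using merge_two_covers[OF T insert.prems[of i] \<omega>(1)] by auto
  have "real (multiplicity_at \<omega>' x) - 1 \<le> (\<Sum>i\<in>insert i I. real (multiplicity_at (\<beta> i) x) - 1)"
    if "x \<in> topspace T" for x
    using \<omega>(3)[OF that] \<omega>'(4)[OF that] insert.hyps by simp
  moreover have "\<forall>j\<in>insert i I. refines \<omega>' (\<beta> j)" using \<omega>' \<omega>(2) refines_trans by blast
  ultimately show ?case using \<omega>'(1) by blast
qed

section \<open>Covers that resolve coordinates along fibres\<close>

text \<open>
  The condition in \<open>cond_D\<close> without reference to the set of parameters of the fibres: fibres over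
  points outside the image are empty, and \<open>\<alpha>\<close> is nonempty in all applications.
\<close>

definition fibrewise_refines :: "'a set \<Rightarrow> ('a \<Rightarrow> 'b) \<Rightarrow> 'a set set \<Rightarrow> 'a set set \<Rightarrow> bool" where
  "fibrewise_refines S f \<beta> \<alpha> \<longleftrightarrow> (\<forall>V\<in>\<beta>. \<forall>y. \<exists>U\<in>\<alpha>. {x \<in> S. x \<in> V \<and> f x = y} \<subseteq> U)"

lemma cond_D_le:
  assumes "finite_open_cover T \<beta>" and "fibrewise_refines (topspace T) f \<beta> \<alpha>"
    and "\<And>x. x \<in> topspace T \<Longrightarrow> real (multiplicity_at \<beta> x) - 1 \<le> r"
  shows "cond_D T f B \<alpha> \<le> ereal r"
proof -
  have "refines (cover_join (fibres (topspace T) f B) \<beta>) \<alpha>"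
    unfolding refines_def
  proof
    fix W assume "W \<in> cover_join (fibres (topspace T) f B) \<beta>"
    then obtain y V where V: "V \<in> \<beta>" and W: "W = {x \<in> topspace T. f x = y} \<inter> V"
      unfolding cover_join_def fibres_def by blast
    obtain U where "U \<in> \<alpha>" "{x \<in> topspace T. x \<in> V \<and> f x = y} \<subseteq> U"
      using assms(2) V unfolding fibrewise_refines_def by blast
    thus "\<exists>U\<in>\<alpha>. W \<subseteq> U" unfolding W by blast
  qed
  hence "cond_D T f B \<alpha> \<le> cover_ord (topspace T) \<beta>"
    unfolding cond_D_def using assms(1) by (intro INF_lower) auto
  also have "\<dots> \<le> ereal r"
    unfolding cover_ord_def using assms(3) by (intro SUP_least) (simp add: multiplicity_at_def)
  finally show ?thesis .
qed

lemma cond_D_less_imp_cover: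
  assumes less: "cond_D T f B \<alpha> < ereal r" and B: "f ` topspace T \<subseteq> B" and \<alpha>: "\<alpha> \<noteq> {}"
  obtains \<beta> where "finite_open_cover T \<beta>" "fibrewise_refines (topspace T) f \<beta> \<alpha>"
    "\<And>x. x \<in> topspace T \<Longrightarrow> real (multiplicity_at \<beta> x) - 1 \<le> r"
proof -
  obtain \<beta> where \<beta>: "finite_open_cover T \<beta>"
      "refines (cover_join (fibres (topspace T) f B) \<beta>) \<alpha>"
      "cover_ord (topspace T) \<beta> < ereal r"
    using less unfolding cond_D_def INF_less_iff by blast
  have "fibrewise_refines (topspace T) f \<beta> \<alpha>"
    unfolding fibrewise_refines_def
  proof (intro ballI allI)
    fix V y assume V: "V \<in> \<beta>"
    show "\<exists>U\<in>\<alpha>. {x \<in> topspace T. x \<in> V \<and> f x = y} \<subseteq> U"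
    proof (cases "y \<in> B")
      case True
      hence "{x \<in> topspace T. f x = y} \<inter> V \<in> cover_join (fibres (topspace T) f B) \<beta>"
        using V unfolding cover_join_def fibres_def by blast
      with \<beta>(2) obtain U where "U \<in> \<alpha>" "{x \<in> topspace T. f x = y} \<inter> V \<subseteq> U"
        unfolding refines_def by blast
      thus ?thesis by blast
    qed (use B \<alpha> in blast)
  qed
  moreover have "real (multiplicity_at \<beta> x) - 1 \<le> r" if "x \<in> topspace T" for x
  proof -
    have "ereal (real (multiplicity_at \<beta> x) - 1) \<le> cover_ord (topspace T) \<beta>"
      unfolding cover_ord_def multiplicity_at_def by (rule SUP_upper[OF that])
    also have "\<dots> < ereal r" by (rule \<beta>(3))
    finally show ?thesis by simp
  qed
  ultimately show ?thesis using \<beta>(1) that by blast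
qed

lemma cond_D_empty:
  assumes "topspace T = {}"
  shows "cond_D T f B \<alpha> = -\<infinity>"
proof (rule ereal_bot)
  fix r
  show "cond_D T f B \<alpha> \<le> ereal r"
    by (rule cond_D_le[where \<beta> = "{}"])
      (simp_all add: finite_open_cover_def fibrewise_refines_def assms)
qed

lemma preimage_finite_open_cover:
  assumes "continuous_map S T h" and "finite_open_cover T \<beta>"
  shows "finite_open_cover S ((\<lambda>V. {x \<in> topspace S. h x \<in> V}) ` \<beta>)"
    and "x \<in> topspace S \<Longrightarrow>
      multiplicity_at ((\<lambda>V. {x \<in> topspace S. h x \<in> V}) ` \<beta>) x \<le> multiplicity_at \<beta> (h x)"
proof -
  show "finite_open_cover S ((\<lambda>V. {x \<in> topspace S. h x \<in> V}) ` \<beta>)"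
    using assms openin_continuous_map_preimage[OF assms(1)]
      continuous_map_image_subset_topspace[OF assms(1)]
    unfolding finite_open_cover_def by (auto simp: image_subset_iff)
  assume x: "x \<in> topspace S"
  have "{W \<in> (\<lambda>V. {x \<in> topspace S. h x \<in> V}) ` \<beta>. x \<in> W}
      \<subseteq> (\<lambda>V. {x \<in> topspace S. h x \<in> V}) ` {V \<in> \<beta>. h x \<in> V}"
    by auto
  moreover have "finite {V \<in> \<beta>. h x \<in> V}" using assms(2) by (simp add: finite_open_cover_def)
  ultimately show "multiplicity_at ((\<lambda>V. {x \<in> topspace S. h x \<in> V}) ` \<beta>) x \<le> multiplicity_at \<beta> (h x)"
    unfolding multiplicity_at_def
    by (meson card_image_le card_mono finite_imageI order_trans)
qed

text \<open>
  The common form of the two covers whose dimension is compared. On \<open>X\<close> the coordinates \<open>c i\<close> are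
  the homeomorphisms of the action, indexed by a finite subset of the group; on a space of
  microstates they are the evaluations, indexed by \<open>{1..d}\<close>. In both cases a fibrewise refinement of
  the product of copies of \<open>\<alpha>\<close> is the same as resolving \<open>\<alpha>\<close> in one coordinate at a time, which
  makes the property stable under merging.
\<close>

definition resolves ::
    "'a topology \<Rightarrow> ('a \<Rightarrow> 'b) \<Rightarrow> ('i \<Rightarrow> 'a \<Rightarrow> 'x) \<Rightarrow> 'x set set \<Rightarrow> 'i set \<Rightarrow> 'a set set \<Rightarrow> bool" where
  "resolves T f c \<alpha> D \<beta> \<longleftrightarrow>
     (\<forall>V\<in>\<beta>. \<forall>y. \<forall>i\<in>D. \<exists>U\<in>\<alpha>. \<forall>x\<in>topspace T. x \<in> V \<longrightarrow> f x = y \<longrightarrow> c i x \<in> U)"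

lemma resolves_refined:
  assumes "resolves T f c \<alpha> D \<beta>" "refines \<omega> \<beta>"
  shows "resolves T f c \<alpha> D \<omega>"
  unfolding resolves_def
proof (intro ballI allI)
  fix W y i assume W: "W \<in> \<omega>" and i: "i \<in> D"
  obtain V where V: "V \<in> \<beta>" "W \<subseteq> V" using assms(2) W unfolding refines_def by blast
  then obtain U where "U \<in> \<alpha>" "\<forall>x\<in>topspace T. x \<in> V \<longrightarrow> f x = y \<longrightarrow> c i x \<in> U"
    using assms(1) i unfolding resolves_def by blast
  thus "\<exists>U\<in>\<alpha>. \<forall>x\<in>topspace T. x \<in> W \<longrightarrow> f x = y \<longrightarrow> c i x \<in> U" using V(2) by blast
qed

lemma resolves_preimage:
  assumes res: "resolves T f c \<alpha> D \<beta>" and h: "h ` topspace S \<subseteq> topspace T" and \<alpha>: "\<alpha> \<noteq> {}"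
    and fib: "\<And>x x'. x \<in> topspace S \<Longrightarrow> x' \<in> topspace S \<Longrightarrow> f' x = f' x' \<Longrightarrow> f (h x) = f (h x')"
    and D': "\<And>i. i \<in> D' \<Longrightarrow> \<exists>j\<in>D. \<forall>x\<in>topspace S. c' i x = c j (h x)"
  shows "resolves S f' c' \<alpha> D' ((\<lambda>V. {x \<in> topspace S. h x \<in> V}) ` \<beta>)"
  unfolding resolves_def
proof (intro ballI allI)
  fix W y i assume W: "W \<in> (\<lambda>V. {x \<in> topspace S. h x \<in> V}) ` \<beta>" and i: "i \<in> D'"
  then obtain V where V: "V \<in> \<beta>" "W = {x \<in> topspace S. h x \<in> V}" by blast
  obtain j where j: "j \<in> D" "\<And>x. x \<in> topspace S \<Longrightarrow> c' i x = c j (h x)" using D'[OF i] by blast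
  show "\<exists>U\<in>\<alpha>. \<forall>x\<in>topspace S. x \<in> W \<longrightarrow> f' x = y \<longrightarrow> c' i x \<in> U"
  proof (cases "\<exists>x\<in>topspace S. x \<in> W \<and> f' x = y")
    case True
    then obtain x\<^sub>0 where x\<^sub>0: "x\<^sub>0 \<in> topspace S" "f' x\<^sub>0 = y" by blast
    obtain U where U: "U \<in> \<alpha>" "\<And>x. x \<in> topspace T \<Longrightarrow> x \<in> V \<Longrightarrow> f x = f (h x\<^sub>0) \<Longrightarrow> c j x \<in> U"
      using res V(1) j(1) unfolding resolves_def by meson
    have "c' i x \<in> U" if "x \<in> topspace S" "x \<in> W" "f' x = y" for x
    proof -
      have "h x \<in> topspace T" "h x \<in> V" using that h V(2) by auto
      moreover have "f (h x) = f (h x\<^sub>0)" using fib[OF that(1) x\<^sub>0(1)] that(3) x\<^sub>0(2) by simp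
      ultimately show ?thesis using U(2) j(2)[OF that(1)] by simp
    qed
    thus ?thesis using U(1) by blast
  next
    case False
    obtain U where "U \<in> \<alpha>" using \<alpha> by blast
    thus ?thesis using False by blast
  qed
qed

lemma multiplicity_le_card: "finite \<alpha> \<Longrightarrow> multiplicity_at \<alpha> x \<le> card \<alpha>"
  unfolding multiplicity_at_def by (rule card_mono) auto

text \<open>
  The way in which tilings enter: the coordinates in the blocks \<open>C p\<close> are resolved by given covers,
  the few remaining coordinates \<open>R\<close> by pulling back \<open>\<alpha>\<close> itself.
\<close>

lemma resolving_covers_combine:
  assumes T: "metrizable_space T" and I: "finite I" and R: "finite R"
    and \<alpha>: "finite_open_cover X \<alpha>" and c: "\<And>i. i \<in> R \<Longrightarrow> continuous_map T X (c i)"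
    and \<beta>: "\<And>p. p \<in> I \<Longrightarrow> finite_open_cover T (\<beta> p)" "\<And>p. p \<in> I \<Longrightarrow> resolves T f c \<alpha> (C p) (\<beta> p)"
    and D: "D \<subseteq> R \<union> (\<Union>p\<in>I. C p)"
  shows "\<exists>\<omega>. finite_open_cover T \<omega> \<and> resolves T f c \<alpha> D \<omega> \<and>
    (\<forall>x\<in>topspace T. real (multiplicity_at \<omega> x) - 1 \<le>
       (\<Sum>p\<in>I. real (multiplicity_at (\<beta> p) x) - 1) + real (card R) * real (card \<alpha>))"
proof -
  define \<gamma> where "\<gamma> = case_sum \<beta> (\<lambda>i. (\<lambda>U. {x \<in> topspace T. c i x \<in> U}) ` \<alpha>)"
  have cover: "finite_open_cover T (\<gamma> q)" if "q \<in> I <+> R" for q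
    using that \<beta>(1) preimage_finite_open_cover(1)[OF c \<alpha>] by (auto simp: \<gamma>_def)
  have "\<exists>\<omega>. finite_open_cover T \<omega> \<and> (\<forall>q\<in>I <+> R. refines \<omega> (\<gamma> q)) \<and>
    (\<forall>x\<in>topspace T.
      real (multiplicity_at \<omega> x) - 1 \<le> (\<Sum>q\<in>I <+> R. real (multiplicity_at (\<gamma> q) x) - 1))"
    by (rule merge_covers[OF T finite_Plus[OF I R] cover])
  then obtain \<omega> where \<omega>: "finite_open_cover T \<omega>" "\<forall>q\<in>I <+> R. refines \<omega> (\<gamma> q)"
    "\<forall>x\<in>topspace T.
      real (multiplicity_at \<omega> x) - 1 \<le> (\<Sum>q\<in>I <+> R. real (multiplicity_at (\<gamma> q) x) - 1)"
    by (elim exE conjE)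
  have "resolves T f c \<alpha> D \<omega>"
    unfolding resolves_def
  proof (intro ballI allI)
    fix W y i assume W: "W \<in> \<omega>" and i: "i \<in> D"
    show "\<exists>U\<in>\<alpha>. \<forall>x\<in>topspace T. x \<in> W \<longrightarrow> f x = y \<longrightarrow> c i x \<in> U"
    proof (cases "i \<in> R")
      case True
      hence "refines \<omega> (\<gamma> (Inr i))" by (intro bspec[OF \<omega>(2)] InrI)
      then obtain V where "V \<in> \<gamma> (Inr i)" "W \<subseteq> V" using W unfolding refines_def by blast
      then obtain U where "U \<in> \<alpha>" "W \<subseteq> {x \<in> topspace T. c i x \<in> U}" by (auto simp: \<gamma>_def)
      thus ?thesis by blast
    next
      case False
      then obtain p where p: "p \<in> I" "i \<in> C p" using i D by blast
      hence "refines \<omega> (\<beta> p)" using bspec[OF \<omega>(2) InlI] by (simp add: \<gamma>_def)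
      from resolves_refined[OF \<beta>(2)[OF p(1)] this] show ?thesis
        using W p(2) unfolding resolves_def by blast
    qed
  qed
  moreover have "real (multiplicity_at \<omega> x) - 1 \<le>
       (\<Sum>p\<in>I. real (multiplicity_at (\<beta> p) x) - 1) + real (card R) * real (card \<alpha>)"
    if x: "x \<in> topspace T" for x
  proof -
    have "(\<Sum>q\<in>I <+> R. real (multiplicity_at (\<gamma> q) x) - 1) =
        (\<Sum>p\<in>I. real (multiplicity_at (\<beta> p) x) - 1) + (\<Sum>i\<in>R. real (multiplicity_at (\<gamma> (Inr i)) x) - 1)"
      by (subst sum.Plus[OF I R]) (simp add: \<gamma>_def)
    also have "(\<Sum>i\<in>R. real (multiplicity_at (\<gamma> (Inr i)) x) - 1) \<le> (\<Sum>i\<in>R. real (card \<alpha>))"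
    proof (rule sum_mono)
      fix i assume i: "i \<in> R"
      have "multiplicity_at (\<gamma> (Inr i)) x \<le> multiplicity_at \<alpha> (c i x)"
        using preimage_finite_open_cover(2)[OF c[OF i] \<alpha> x] by (simp add: \<gamma>_def)
      also have "\<dots> \<le> card \<alpha>" using \<alpha> by (intro multiplicity_le_card) (simp add: finite_open_cover_def)
      finally show "real (multiplicity_at (\<gamma> (Inr i)) x) - 1 \<le> real (card \<alpha>)" by simp
    qed
    finally show ?thesis using bspec[OF \<omega>(3) x] by simp
  qed
  ultimately show ?thesis using \<omega>(1) by blast
qed

lemma resolves_iff_iterate:
  "resolves X f \<phi> \<alpha> E \<beta> \<longleftrightarrow> fibrewise_refines (topspace X) f \<beta> (cover_iterate X \<phi> E \<alpha>)"
proof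
  assume L: "resolves X f \<phi> \<alpha> E \<beta>"
  show "fibrewise_refines (topspace X) f \<beta> (cover_iterate X \<phi> E \<alpha>)"
    unfolding fibrewise_refines_def
  proof (intro ballI allI)
    fix V y assume V: "V \<in> \<beta>"
    have "\<forall>s\<in>E. \<exists>U. U \<in> \<alpha> \<and> (\<forall>x\<in>topspace X. x \<in> V \<longrightarrow> f x = y \<longrightarrow> \<phi> s x \<in> U)"
      using L V unfolding resolves_def by blast
    from bchoice[OF this] obtain U where
      U: "\<forall>s\<in>E. U s \<in> \<alpha> \<and> (\<forall>x\<in>topspace X. x \<in> V \<longrightarrow> f x = y \<longrightarrow> \<phi> s x \<in> U s)" ..
    hence "{x \<in> topspace X. \<forall>s\<in>E. \<phi> s x \<in> U s} \<in> cover_iterate X \<phi> E \<alpha>"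
      unfolding cover_iterate_def by blast
    moreover have "{x \<in> topspace X. x \<in> V \<and> f x = y} \<subseteq> {x \<in> topspace X. \<forall>s\<in>E. \<phi> s x \<in> U s}"
      using U by blast
    ultimately show "\<exists>W\<in>cover_iterate X \<phi> E \<alpha>. {x \<in> topspace X. x \<in> V \<and> f x = y} \<subseteq> W" by blast
  qed
next
  assume R: "fibrewise_refines (topspace X) f \<beta> (cover_iterate X \<phi> E \<alpha>)"
  show "resolves X f \<phi> \<alpha> E \<beta>"
    unfolding resolves_def
  proof (intro ballI allI)
    fix V y s assume V: "V \<in> \<beta>" and s: "s \<in> E"
    obtain W where W: "W \<in> cover_iterate X \<phi> E \<alpha>" "{x \<in> topspace X. x \<in> V \<and> f x = y} \<subseteq> W"
      using R V unfolding fibrewise_refines_def by blast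
    then obtain U where U: "U \<in> E \<rightarrow> \<alpha>" "W = {x \<in> topspace X. \<forall>s\<in>E. \<phi> s x \<in> U s}"
      unfolding cover_iterate_def by blast
    have "U s \<in> \<alpha>" using U(1) s by blast
    thus "\<exists>U\<in>\<alpha>. \<forall>x\<in>topspace X. x \<in> V \<longrightarrow> f x = y \<longrightarrow> \<phi> s x \<in> U"
      using W(2) s unfolding U(2) by blast
  qed
qed

lemma resolves_iff_power:
  assumes M: "M \<subseteq> topspace (power_topology d X)"
  shows "resolves (subtopology (power_topology d X) M) f (\<lambda>a \<xi>. \<xi> a) \<alpha> {1..d} \<beta> \<longleftrightarrow>
    fibrewise_refines M f \<beta> (restrict_family (power_cover d \<alpha>) M)"
proof -
  have top: "topspace (subtopology (power_topology d X) M) = M" using M by auto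
  have ext: "\<xi> \<in> extensional {1..d}" if "\<xi> \<in> M" for \<xi> using M that by (auto simp: PiE_def)
  show ?thesis
  proof
    assume L: "resolves (subtopology (power_topology d X) M) f (\<lambda>a \<xi>. \<xi> a) \<alpha> {1..d} \<beta>"
    show "fibrewise_refines M f \<beta> (restrict_family (power_cover d \<alpha>) M)"
      unfolding fibrewise_refines_def
    proof (intro ballI allI)
      fix V y assume V: "V \<in> \<beta>"
      have "\<forall>a\<in>{1..d}. \<exists>U. U \<in> \<alpha> \<and> (\<forall>\<xi>\<in>M. \<xi> \<in> V \<longrightarrow> f \<xi> = y \<longrightarrow> \<xi> a \<in> U)"
        using L V unfolding resolves_def top by blast
      from bchoice[OF this] obtain U where
        U: "\<forall>a\<in>{1..d}. U a \<in> \<alpha> \<and> (\<forall>\<xi>\<in>M. \<xi> \<in> V \<longrightarrow> f \<xi> = y \<longrightarrow> \<xi> a \<in> U a)" ..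
      hence "PiE {1..d} U \<inter> M \<in> restrict_family (power_cover d \<alpha>) M"
        unfolding restrict_family_def power_cover_def by blast
      moreover have "{\<xi> \<in> M. \<xi> \<in> V \<and> f \<xi> = y} \<subseteq> PiE {1..d} U \<inter> M"
        using U ext by (auto simp: PiE_def)
      ultimately show "\<exists>W\<in>restrict_family (power_cover d \<alpha>) M. {\<xi> \<in> M. \<xi> \<in> V \<and> f \<xi> = y} \<subseteq> W"
        by blast
    qed
  next
    assume R: "fibrewise_refines M f \<beta> (restrict_family (power_cover d \<alpha>) M)"
    show "resolves (subtopology (power_topology d X) M) f (\<lambda>a \<xi>. \<xi> a) \<alpha> {1..d} \<beta>"
      unfolding resolves_def top
    proof (intro ballI allI)
      fix V y and a :: nat assume V: "V \<in> \<beta>" and a: "a \<in> {1..d}"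
      obtain W where W: "W \<in> restrict_family (power_cover d \<alpha>) M" "{\<xi> \<in> M. \<xi> \<in> V \<and> f \<xi> = y} \<subseteq> W"
        using R V unfolding fibrewise_refines_def by blast
      then obtain U where U: "U \<in> {1..d} \<rightarrow> \<alpha>" "W = PiE {1..d} U \<inter> M"
        unfolding restrict_family_def power_cover_def by blast
      have "U a \<in> \<alpha>" using U(1) a by blast
      moreover have "\<xi> a \<in> U a" if "\<xi> \<in> M" "\<xi> \<in> V" "f \<xi> = y" for \<xi>
        using W(2) that a unfolding U(2) by blast
      ultimately show "\<exists>U\<in>\<alpha>. \<forall>\<xi>\<in>M. \<xi> \<in> V \<longrightarrow> f \<xi> = y \<longrightarrow> \<xi> a \<in> U" by blast
    qed
  qed
qed

section \<open>Invariant finite sets\<close>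

text \<open>
  The elements counted here are those of \<open>F - g\<^sup>-\<^sup>1F\<close>, so this is the basic set of
  \<open>invariance_filter\<close> for the parameter \<open>K\<^sup>-\<^sup>1\<close>. Counting the points that leave \<open>F\<close> is what all later estimates use.
\<close>

definition almost_invariant :: "('g, 'm) monoid_scheme \<Rightarrow> 'g set \<Rightarrow> real \<Rightarrow> 'g set \<Rightarrow> bool" where
  "almost_invariant G K \<epsilon> F \<longleftrightarrow> F \<in> finite_subsets G \<and>
     (\<forall>g\<in>K. real (card {v \<in> F. g \<otimes>\<^bsub>G\<^esub> v \<notin> F}) \<le> \<epsilon> * real (card F))"

lemma finite_subsetsD:
  assumes "F \<in> finite_subsets G"
  shows "F \<subseteq> carrier G" "finite F" "F \<noteq> {}" "0 < card F"
  using assms by (auto simp: finite_subsets_def card_gt_0_iff)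

lemma (in group) diff_inv_translate:
  assumes "F \<subseteq> carrier G" "g \<in> carrier G"
  shows "F - (inv g <# F) = {v \<in> F. g \<otimes> v \<notin> F}"
proof -
  have "v \<in> inv g <# F \<longleftrightarrow> g \<otimes> v \<in> F" if "v \<in> F" for v
  proof
    assume "v \<in> inv g <# F"
    then obtain h where h: "h \<in> F" "v = inv g \<otimes> h" by (auto simp: l_coset_def)
    hence "g \<otimes> v = h" using assms by (simp add: subset_iff flip: m_assoc)
    thus "g \<otimes> v \<in> F" using h by simp
  next
    assume "g \<otimes> v \<in> F"
    moreover have "v = inv g \<otimes> (g \<otimes> v)" using assms that by (simp add: subset_iff flip: m_assoc)
    ultimately show "v \<in> inv g <# F" unfolding l_coset_def by blast
  qed
  thus ?thesis by blast
qed

lemma (in group) eventually_invariance_filter: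
  "eventually P (invariance_filter G) \<longleftrightarrow>
     (\<exists>K \<epsilon>. K \<subseteq> carrier G \<and> finite K \<and> 0 < \<epsilon> \<and> (\<forall>F. almost_invariant G K \<epsilon> F \<longrightarrow> P F))"
proof -
  define S where "S = (\<lambda>(K, \<epsilon>::real). {F \<in> finite_subsets G.
          \<forall>g\<in>K. real (card (F - (g <# F))) \<le> \<epsilon> * real (card F)})"
  define B where "B = {K. K \<subseteq> carrier G \<and> finite K} \<times> {0::real<..}"
  have filter_eq: "invariance_filter G = (INF b\<in>B. principal (S b))"
    unfolding invariance_filter_def B_def S_def by (rule INF_cong) auto
  have "({}, 1) \<in> B" by (simp add: B_def)
  hence ne: "B \<noteq> {}" by blast
  have directed: "\<exists>x\<in>B. principal (S x) \<le> inf (principal (S a)) (principal (S b))"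
    if ab: "a \<in> B" "b \<in> B" for a b
  proof -
    obtain K \<epsilon> K' \<epsilon>' where [simp]: "a = (K, \<epsilon>)" "b = (K', \<epsilon>')" by (cases a, cases b) auto
    have "S (K \<union> K', min \<epsilon> \<epsilon>') \<subseteq> S a \<inter> S b"
    proof
      fix F assume F: "F \<in> S (K \<union> K', min \<epsilon> \<epsilon>')"
      have "min \<epsilon> \<epsilon>' * real (card F) \<le> \<epsilon> * real (card F)"
        "min \<epsilon> \<epsilon>' * real (card F) \<le> \<epsilon>' * real (card F)"
        by (intro mult_right_mono; simp)+
      hence "r \<le> \<epsilon> * real (card F) \<and> r \<le> \<epsilon>' * real (card F)"
        if "r \<le> min \<epsilon> \<epsilon>' * real (card F)" for r
        using that by linarith
      thus "F \<in> S a \<inter> S b" using F by (simp add: S_def)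
    qed
    moreover have "(K \<union> K', min \<epsilon> \<epsilon>') \<in> B" using ab by (auto simp: B_def)
    ultimately show ?thesis by (metis inf_principal principal_le_iff)
  qed
  have ev: "eventually P (invariance_filter G) \<longleftrightarrow> (\<exists>b\<in>B. \<forall>F\<in>S b. P F)"
    unfolding filter_eq by (subst eventually_INF_base[OF ne directed]) (auto simp: eventually_principal)
  have S_eq: "F \<in> S (m_inv G ` K, \<epsilon>) \<longleftrightarrow> almost_invariant G K \<epsilon> F" if "K \<subseteq> carrier G" for K \<epsilon> F
  proof (cases "F \<in> finite_subsets G")
    case True
    have "F - (inv g <# F) = {v \<in> F. g \<otimes> v \<notin> F}" if "g \<in> K" for g
      using diff_inv_translate finite_subsetsD(1)[OF True] \<open>K \<subseteq> carrier G\<close> that by blast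
    thus ?thesis by (simp add: S_def almost_invariant_def True)
  qed (simp add: S_def almost_invariant_def)
  have inv_inv_image: "m_inv G ` (m_inv G ` K) = K" if "K \<subseteq> carrier G" for K
  proof -
    have "m_inv G ` (m_inv G ` K) = (\<lambda>x. x) ` K"
      unfolding image_image by (rule image_cong) (use that in auto)
    thus ?thesis by simp
  qed
  show ?thesis
  proof
    assume "eventually P (invariance_filter G)"
    then obtain K \<epsilon> where b: "(K, \<epsilon>) \<in> B" "\<forall>F\<in>S (K, \<epsilon>). P F" using ev by auto
    hence K: "K \<subseteq> carrier G" "finite K" "0 < \<epsilon>" by (auto simp: B_def)
    have sub: "m_inv G ` K \<subseteq> carrier G" using K(1) by auto
    have "\<forall>F. almost_invariant G (m_inv G ` K) \<epsilon> F \<longrightarrow> P F"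
      using b(2) S_eq[OF sub] inv_inv_image[OF K(1)] by simp
    thus "\<exists>K \<epsilon>. K \<subseteq> carrier G \<and> finite K \<and> 0 < \<epsilon> \<and> (\<forall>F. almost_invariant G K \<epsilon> F \<longrightarrow> P F)"
      using K sub by blast
  next
    assume "\<exists>K \<epsilon>. K \<subseteq> carrier G \<and> finite K \<and> 0 < \<epsilon> \<and> (\<forall>F. almost_invariant G K \<epsilon> F \<longrightarrow> P F)"
    then obtain K \<epsilon> where K: "K \<subseteq> carrier G" "finite K" "0 < \<epsilon>"
      and P: "\<And>F. almost_invariant G K \<epsilon> F \<Longrightarrow> P F" by blast
    have "(m_inv G ` K, \<epsilon>) \<in> B" using K by (auto simp: B_def)
    moreover have "\<forall>F\<in>S (m_inv G ` K, \<epsilon>). P F" using S_eq[OF K(1)] P by blast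
    ultimately show "eventually P (invariance_filter G)" using ev by blast
  qed
qed

lemma (in group) eventually_almost_invariant:
  assumes "K \<subseteq> carrier G" "finite K" "0 < \<epsilon>"
  shows "eventually (almost_invariant G K \<epsilon>) (invariance_filter G)"
  unfolding eventually_invariance_filter
  by (intro exI[of _ K] exI[of _ \<epsilon>] conjI assms allI impI)

lemma (in group) amenable_imp_invariance_filter_nontrivial:
  assumes "amenable G"
  shows "invariance_filter G \<noteq> bot"
proof
  assume "invariance_filter G = bot"
  hence "eventually (\<lambda>_. False) (invariance_filter G)" by simp
  then obtain K \<epsilon> where K: "K \<subseteq> carrier G" "finite K" "0 < \<epsilon>"
    and none: "\<And>F. \<not> almost_invariant G K \<epsilon> F"
    unfolding eventually_invariance_filter by blast
  obtain F where F: "\<And>n. F n \<in> finite_subsets G"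
    and lim: "\<And>g. g \<in> carrier G \<Longrightarrow>
        (\<lambda>n. real (card (F n - (g <# F n))) / real (card (F n))) \<longlonglongrightarrow> 0"
    using assms unfolding amenable_def folner_sequence_def by blast
  have "\<forall>g\<in>K. eventually (\<lambda>n. real (card {v \<in> F n. g \<otimes> v \<notin> F n}) \<le> \<epsilon> * real (card (F n)))
          sequentially"
  proof
    fix g assume g: "g \<in> K"
    hence "eventually (\<lambda>n. real (card (F n - (inv g <# F n))) / real (card (F n)) < \<epsilon>) sequentially"
      using order_tendstoD(2)[OF lim K(3)] K(1) by blast
    thus "eventually (\<lambda>n. real (card {v \<in> F n. g \<otimes> v \<notin> F n}) \<le> \<epsilon> * real (card (F n))) sequentially"
    proof eventually_elim
      case (elim n)
      have "F n - (inv g <# F n) = {v \<in> F n. g \<otimes> v \<notin> F n}"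
        using diff_inv_translate finite_subsetsD(1)[OF F] K(1) g by blast
      with elim show ?case
        using finite_subsetsD(4)[OF F[of n]] by (simp add: field_simps)
    qed
  qed
  hence "eventually (\<lambda>n. \<forall>g\<in>K. real (card {v \<in> F n. g \<otimes> v \<notin> F n}) \<le> \<epsilon> * real (card (F n)))
      sequentially"
    using K(2) by (simp add: eventually_ball_finite_distrib)
  then obtain n where "\<forall>g\<in>K. real (card {v \<in> F n. g \<otimes> v \<notin> F n}) \<le> \<epsilon> * real (card (F n))"
    using eventually_happens'[OF sequentially_bot] by blast
  thus False using none[of "F n"] F by (simp add: almost_invariant_def)
qed

lemma (in group) eventually_sum_exits_le:
  assumes K: "K \<subseteq> carrier G" "finite K" and \<eta>: "0 < \<eta>"
  shows "eventually (\<lambda>F. F \<in> finite_subsets G \<and>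
    real (\<Sum>g\<in>K. card {v \<in> F. g \<otimes> v \<notin> F}) \<le> \<eta> * real (card F)) (invariance_filter G)"
proof -
  define \<epsilon> where "\<epsilon> = \<eta> / (real (card K) + 1)"
  have \<epsilon>: "0 < \<epsilon>" "real (card K) * \<epsilon> \<le> \<eta>" using \<eta> by (auto simp: \<epsilon>_def field_simps)
  show ?thesis using eventually_almost_invariant[OF K \<epsilon>(1)]
  proof eventually_elim
    case (elim F)
    have "real (\<Sum>g\<in>K. card {v \<in> F. g \<otimes> v \<notin> F}) = (\<Sum>g\<in>K. real (card {v \<in> F. g \<otimes> v \<notin> F}))"
      by simp
    also have "\<dots> \<le> (\<Sum>g\<in>K. \<epsilon> * real (card F))"
      by (intro sum_mono) (use elim in \<open>auto simp: almost_invariant_def\<close>)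
    also have "\<dots> = (real (card K) * \<epsilon>) * real (card F)" by simp
    also have "\<dots> \<le> \<eta> * real (card F)" by (intro mult_right_mono \<epsilon>) simp
    finally show ?case using elim by (simp add: almost_invariant_def)
  qed
qed

lemma (in group) eventually_card_set_mult_le:
  assumes K: "K \<subseteq> carrier G" "finite K" and \<eta>: "0 < \<eta>"
  shows "eventually (\<lambda>F. real (card (K <#> F)) \<le> (1 + \<eta>) * real (card F)) (invariance_filter G)"
  using eventually_sum_exits_le[OF K \<eta>]
proof eventually_elim
  case (elim F)
  hence F: "finite F" using finite_subsetsD(2) by blast
  let ?exit = "\<lambda>g. {v \<in> F. g \<otimes> v \<notin> F}"
  have "K <#> F \<subseteq> F \<union> (\<Union>g\<in>K. (\<lambda>v. g \<otimes> v) ` ?exit g)"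
    by (auto simp: set_mult_def)
  hence "card (K <#> F) \<le> card (F \<union> (\<Union>g\<in>K. (\<lambda>v. g \<otimes> v) ` ?exit g))"
    by (rule card_mono[rotated]) (use F K in auto)
  also have "\<dots> \<le> card F + (\<Sum>g\<in>K. card ((\<lambda>v. g \<otimes> v) ` ?exit g))"
    by (intro card_Un_le[THEN order_trans] add_left_mono card_UN_le K)
  also have "\<dots> \<le> card F + (\<Sum>g\<in>K. card (?exit g))"
    by (intro add_left_mono sum_mono card_image_le) (use F in auto)
  finally have "real (card (K <#> F)) \<le> real (card F + (\<Sum>g\<in>K. card (?exit g)))"
    by (simp only: of_nat_le_iff)
  with elim show ?case by (simp add: algebra_simps)
qed

lemma (in group) eventually_card_core_ge:
  assumes K: "K \<subseteq> carrier G" "finite K" and \<eta>: "0 < \<eta>"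
  shows "eventually (\<lambda>E. (1 - \<eta>) * real (card E) \<le> real (card {v \<in> E. \<forall>s\<in>K. s \<otimes> v \<in> E}))
           (invariance_filter G)"
  using eventually_sum_exits_le[OF K \<eta>]
proof eventually_elim
  case (elim E)
  hence E: "finite E" using finite_subsetsD(2) by blast
  let ?core = "{v \<in> E. \<forall>s\<in>K. s \<otimes> v \<in> E}" and ?exit = "\<lambda>g. {v \<in> E. g \<otimes> v \<notin> E}"
  have "card E \<le> card (?core \<union> (\<Union>g\<in>K. ?exit g))"
    by (rule card_mono) (use E K in auto)
  also have "\<dots> \<le> card ?core + card (\<Union>g\<in>K. ?exit g)"
    by (rule card_Un_le)
  also have "\<dots> \<le> card ?core + (\<Sum>g\<in>K. card (?exit g))"
    by (intro add_left_mono card_UN_le K)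
  finally have "real (card E) \<le> real (card ?core + (\<Sum>g\<in>K. card (?exit g)))"
    by (simp only: of_nat_le_iff)
  with elim show ?case by (simp add: algebra_simps)
qed

lemma (in group) eventually_card_ge:
  assumes "infinite (carrier G)"
  shows "eventually (\<lambda>E. N \<le> card E) (invariance_filter G)"
proof -
  obtain K where K: "K \<subseteq> carrier G" "finite K" "card K = N"
    using infinite_arbitrarily_large[OF assms, of N] by blast
  have half: "(0::real) < 1/2" by simp
  show ?thesis
    using eventually_card_core_ge[OF K(1,2) half] eventually_almost_invariant[OF K(1,2) half]
  proof eventually_elim
    case (elim E)
    hence E: "E \<in> finite_subsets G" by (simp add: almost_invariant_def)
    have "0 < (1 - 1 / 2) * real (card E)" using finite_subsetsD(4)[OF E] by simp
    also note elim(1)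
    finally have "0 < card {v \<in> E. \<forall>s\<in>K. s \<otimes> v \<in> E}" by simp
    then obtain v where v: "v \<in> E" "\<forall>s\<in>K. s \<otimes> v \<in> E" by (auto simp: card_gt_0_iff)
    have "inj_on (\<lambda>s. s \<otimes> v) K"
      using v(1) K(1) finite_subsetsD(1)[OF E] by (intro inj_onI) (metis right_cancel subsetD)
    hence "card K \<le> card E"
      by (rule card_inj_on_le) (use v finite_subsetsD(2)[OF E] in auto)
    thus ?case using K by simp
  qed
qed

text \<open>
  Right translation preserves the left invariance condition, and in an infinite group a finite set
  has a right translate that is disjoint from any other finite set. So invariant sets of almost
  every large size exist.
\<close>

lemma (in group) almost_invariant_copies:
  assumes inf: "infinite (carrier G)" and E\<^sub>0: "almost_invariant G K \<epsilon> E\<^sub>0" and "K \<subseteq> carrier G"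
  shows "\<exists>E. almost_invariant G K \<epsilon> E \<and> card E = Suc m * card E\<^sub>0"
proof (induction m)
  case 0
  show ?case by (rule exI[of _ E\<^sub>0]) (simp add: E\<^sub>0)
next
  case (Suc m)
  then obtain E where E: "almost_invariant G K \<epsilon> E" "card E = Suc m * card E\<^sub>0" by blast
  have "E \<in> finite_subsets G" "E\<^sub>0 \<in> finite_subsets G"
    using E(1) E\<^sub>0 by (simp_all add: almost_invariant_def)
  hence EF: "E \<subseteq> carrier G" "finite E" "E\<^sub>0 \<subseteq> carrier G" "finite E\<^sub>0" "E \<noteq> {}"
    by (simp_all add: finite_subsetsD)
  \<comment> \<open>Only finitely many \<open>c\<close> make the translate meet the set built so far.\<close>
  have "finite (\<Union>a\<in>E\<^sub>0. \<Union>b\<in>E. {inv a \<otimes> b})" using EF by blast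
  then obtain c where c: "c \<in> carrier G" "c \<notin> (\<Union>a\<in>E\<^sub>0. \<Union>b\<in>E. {inv a \<otimes> b})"
    using inf by (meson finite_subset subsetI)
  have disj: "a \<otimes> c \<notin> E" if "a \<in> E\<^sub>0" for a
  proof
    assume *: "a \<otimes> c \<in> E"
    have "c = inv a \<otimes> (a \<otimes> c)" using that EF c(1) by (simp add: subset_iff flip: m_assoc)
    thus False using c(2) that * by blast
  qed
  let ?t = "\<lambda>a. a \<otimes> c"
  have inj: "inj_on ?t E\<^sub>0" using c(1) EF by (intro inj_onI) (metis right_cancel subsetD)
  have card: "card (E \<union> ?t ` E\<^sub>0) = card E + card E\<^sub>0"
    using inj EF disj by (subst card_Un_disjoint) (auto simp: card_image)
  have inv: "real (card {v \<in> E \<union> ?t ` E\<^sub>0. g \<otimes> v \<notin> E \<union> ?t ` E\<^sub>0}) \<le> \<epsilon> * real (card (E \<union> ?t ` E\<^sub>0))"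
    if g: "g \<in> K" for g
  proof -
    have "{v \<in> E \<union> ?t ` E\<^sub>0. g \<otimes> v \<notin> E \<union> ?t ` E\<^sub>0}
        \<subseteq> {v \<in> E. g \<otimes> v \<notin> E} \<union> ?t ` {v \<in> E\<^sub>0. g \<otimes> v \<notin> E\<^sub>0}"
    proof
      fix v assume v: "v \<in> {v \<in> E \<union> ?t ` E\<^sub>0. g \<otimes> v \<notin> E \<union> ?t ` E\<^sub>0}"
      show "v \<in> {v \<in> E. g \<otimes> v \<notin> E} \<union> ?t ` {v \<in> E\<^sub>0. g \<otimes> v \<notin> E\<^sub>0}"
      proof (cases "v \<in> E")
        case False
        then obtain a where a: "a \<in> E\<^sub>0" "v = a \<otimes> c" using v by blast
        hence "g \<otimes> v = g \<otimes> a \<otimes> c" using g c(1) EF assms(3) by (simp add: m_assoc subset_iff)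
        hence "g \<otimes> a \<notin> E\<^sub>0" using v by auto
        thus ?thesis using a by blast
      qed (use v in blast)
    qed
    hence "card {v \<in> E \<union> ?t ` E\<^sub>0. g \<otimes> v \<notin> E \<union> ?t ` E\<^sub>0}
        \<le> card ({v \<in> E. g \<otimes> v \<notin> E} \<union> ?t ` {v \<in> E\<^sub>0. g \<otimes> v \<notin> E\<^sub>0})"
      by (rule card_mono[rotated]) (use EF in auto)
    also have "\<dots> \<le> card {v \<in> E. g \<otimes> v \<notin> E} + card (?t ` {v \<in> E\<^sub>0. g \<otimes> v \<notin> E\<^sub>0})"
      by (rule card_Un_le)
    also have "\<dots> \<le> card {v \<in> E. g \<otimes> v \<notin> E} + card {v \<in> E\<^sub>0. g \<otimes> v \<notin> E\<^sub>0}"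
      by (intro add_left_mono card_image_le) (use EF in auto)
    finally have "real (card {v \<in> E \<union> ?t ` E\<^sub>0. g \<otimes> v \<notin> E \<union> ?t ` E\<^sub>0})
        \<le> real (card {v \<in> E. g \<otimes> v \<notin> E} + card {v \<in> E\<^sub>0. g \<otimes> v \<notin> E\<^sub>0})"
      by (simp only: of_nat_le_iff)
    also have "\<dots> = real (card {v \<in> E. g \<otimes> v \<notin> E}) + real (card {v \<in> E\<^sub>0. g \<otimes> v \<notin> E\<^sub>0})" by simp
    also have "\<dots> \<le> \<epsilon> * real (card E) + \<epsilon> * real (card E\<^sub>0)"
      using E(1) E\<^sub>0 g unfolding almost_invariant_def by (intro add_mono) auto
    finally show ?thesis unfolding card by (simp add: algebra_simps)
  qed
  have "E \<union> ?t ` E\<^sub>0 \<in> finite_subsets G" using EF c(1) by (auto simp: finite_subsets_def)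
  hence "almost_invariant G K \<epsilon> (E \<union> ?t ` E\<^sub>0)" using inv by (simp add: almost_invariant_def)
  moreover have "card (E \<union> ?t ` E\<^sub>0) = Suc (Suc m) * card E\<^sub>0" using card E(2) by simp
  ultimately show ?case by blast
qed

section \<open>Quasi-tilings\<close>

text \<open>
  The maps \<open>\<sigma> s\<close> need not form an action. Near the points of \<open>V\<close>, as far as the finite set \<open>K\<close> can
  tell, they behave like a free one. The set \<open>A\<close> is where they have to be
  injective: \<open>{1..d}\<close> for permutations, the whole group for translations.
\<close>

definition acts_freely_at ::
    "('g, 'm) monoid_scheme \<Rightarrow> ('g \<Rightarrow> 'v \<Rightarrow> 'v) \<Rightarrow> 'g set \<Rightarrow> 'v set \<Rightarrow> 'v set \<Rightarrow> bool" where
  "acts_freely_at G \<sigma> K A V \<longleftrightarrow> V \<subseteq> A \<and> (\<forall>s\<in>K. inj_on (\<sigma> s) A) \<and>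
     (\<forall>v\<in>V. inj_on (\<lambda>s. \<sigma> s v) K \<and>
        (\<forall>t\<in>K. \<sigma> t v \<in> A \<and> (\<forall>s\<in>K. \<sigma> s (\<sigma> t v) = \<sigma> (s \<otimes>\<^bsub>G\<^esub> t) v)))"

text \<open>
  A tile is indexed by its shape and its centre. Its full image may overlap other tiles; \<open>T p\<close> is the
  part of the shape that is kept in order to make the images disjoint.
\<close>

definition quasi_tiling ::
    "('g \<Rightarrow> 'v \<Rightarrow> 'v) \<Rightarrow> 'v set \<Rightarrow> (nat \<Rightarrow> 'g set) \<Rightarrow> real \<Rightarrow> (nat \<times> 'v) set \<Rightarrow> (nat \<times> 'v \<Rightarrow> 'g set) \<Rightarrow> bool"
  where
  "quasi_tiling \<sigma> V F \<eta> I T \<longleftrightarrow>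
     (\<forall>p\<in>I. snd p \<in> V \<and> T p \<subseteq> F (fst p) \<and>
        (1 - \<eta>) * real (card (F (fst p))) \<le> real (card (T p))) \<and>
     disjoint_family_on (\<lambda>p. (\<lambda>s. \<sigma> s (snd p)) ` T p) I"

lemma sum_over_centres:
  fixes a l :: nat and g :: "nat \<Rightarrow> real"
  assumes "finite V" "I \<subseteq> {a..<l} \<times> V" and "\<And>k. k \<in> {a..<l} \<Longrightarrow> card {c. (k, c) \<in> I} = n k"
  shows "(\<Sum>p\<in>I. g (fst p)) = (\<Sum>k\<in>{a..<l}. real (n k) * g k)"
proof -
  have I: "I = (SIGMA k:{a..<l}. {c. (k, c) \<in> I})" using assms(2) by auto
  have fin: "finite {c. (k, c) \<in> I}" for k
    by (rule finite_subset[OF _ assms(1)]) (use assms(2) in auto)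
  have "(\<Sum>p\<in>I. g (fst p)) = (\<Sum>p\<in>(SIGMA k:{a..<l}. {c. (k, c) \<in> I}). g (fst p))"
    by (rule sum.cong[OF I refl])
  also have "\<dots> = (\<Sum>k\<in>{a..<l}. \<Sum>c\<in>{c. (k, c) \<in> I}. g k)"
    by (subst sum.Sigma) (simp_all add: fin case_prod_unfold)
  finally show ?thesis using assms(3) by simp
qed

text \<open>
  The greedy step. Let \<open>W\<close> be the region covered so far by full tiles. If every point were a centre
  at which a new tile of shape \<open>F k\<close> meets \<open>W\<close> in more than the proportion \<open>\<eta>\<close>, then, away from the
  few centres \<open>D\<close> at which it meets a tile of another shape, double counting of the incidences would
  show that the tiles of shape \<open>F k\<close> already occupy the proportion \<open>\<eta>\<close> of \<open>V - D\<close>, more than their number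
  allows. The set \<open>D\<close> is contained in the images of the sets \<open>F k\<^sup>-\<^sup>1 F j\<close>, which are hardly larger than \<open>F j\<close> when \<open>F j\<close> is
  invariant; this is how the large shapes are prevented from blocking the small ones.
\<close>

lemma (in group) tile_centre_exists:
  fixes \<sigma> :: "'a \<Rightarrow> 'v \<Rightarrow> 'v"
  assumes F: "\<And>j. j < l \<Longrightarrow> F j \<in> finite_subsets G" and V: "finite V"
    and free: "acts_freely_at G \<sigma> K A V"
    and FK: "\<And>j. j < l \<Longrightarrow> F j \<subseteq> K"
    and invFK: "\<And>i j. i < l \<Longrightarrow> j < l \<Longrightarrow> (m_inv G ` F i) <#> F j \<subseteq> K"
    and k: "k < l" and I: "I \<subseteq> {k..<l} \<times> V"
    and counts: "\<And>j. j \<in> {Suc k..<l} \<Longrightarrow> card {c. (j, c) \<in> I} = n j"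
    and few: "card {c. (k, c) \<in> I} < n k"
    and \<eta>: "0 < \<eta>"
    and room: "real (n k) * real (card (F k)) \<le>
       \<eta> * (real (card V) - (\<Sum>j\<in>{Suc k..<l}. real (n j) * real (card ((m_inv G ` F k) <#> F j))))"
  shows "\<exists>v\<in>V. real (card {s \<in> F k. \<sigma> s v \<in> (\<Union>p\<in>I. (\<lambda>s. \<sigma> s (snd p)) ` F (fst p))}) \<le> \<eta> * real (card (F k))"
proof (rule ccontr)
  define W where "W = (\<Union>p\<in>I. (\<lambda>s. \<sigma> s (snd p)) ` F (fst p))"
  define I' where "I' = {p \<in> I. fst p \<noteq> k}"
  define Wn where "Wn = (\<Union>c\<in>{c. (k, c) \<in> I}. (\<lambda>s. \<sigma> s c) ` F k)"
  define D where "D = (\<Union>p\<in>I'. (\<lambda>g. \<sigma> g (snd p)) ` ((m_inv G ` F k) <#> F (fst p)))"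
  assume "\<not> ?thesis"
  hence dense: "\<eta> * real (card (F k)) < real (card {s \<in> F k. \<sigma> s v \<in> W})" if "v \<in> V" for v
    using that by (force simp: W_def)
  have finI: "finite I" using I V by (meson finite_SigmaI finite_atLeastLessThan finite_subset)
  have Fk: "finite (F k)" "F k \<subseteq> carrier G" "0 < card (F k)" using finite_subsetsD[OF F[OF k]] by auto
  have finc: "finite {c. (k, c) \<in> I}" by (rule finite_subset[OF _ V]) (use I in auto)
  have fin_prod: "finite ((m_inv G ` F k) <#> F j)" if "j < l" for j
    using Fk finite_subsetsD[OF F[OF that]] by (auto simp: set_mult_def)
  have I': "I' \<subseteq> {Suc k..<l} \<times> V" "finite I'"
    using I finI by (auto simp: I'_def)
  have "card D \<le> (\<Sum>p\<in>I'. card ((\<lambda>g. \<sigma> g (snd p)) ` ((m_inv G ` F k) <#> F (fst p))))"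
    unfolding D_def by (rule card_UN_le[OF I'(2)])
  also have "\<dots> \<le> (\<Sum>p\<in>I'. card ((m_inv G ` F k) <#> F (fst p)))"
    by (intro sum_mono card_image_le fin_prod) (use I' in auto)
  finally have "real (card D) \<le> real (\<Sum>p\<in>I'. card ((m_inv G ` F k) <#> F (fst p)))"
    by (simp only: of_nat_le_iff)
  also have "\<dots> = (\<Sum>p\<in>I'. real (card ((m_inv G ` F k) <#> F (fst p))))" by simp
  also have "\<dots> = (\<Sum>j\<in>{Suc k..<l}. real (n j) * real (card ((m_inv G ` F k) <#> F j)))"
  proof (rule sum_over_centres[OF V I'(1)])
    fix j assume j: "j \<in> {Suc k..<l}"
    hence "{c. (j, c) \<in> I'} = {c. (j, c) \<in> I}" by (auto simp: I'_def)
    thus "card {c. (j, c) \<in> I'} = n j" using counts[OF j] by simp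
  qed
  finally have cardD: "real (card D) \<le> \<dots>" .
  have finD: "finite D" unfolding D_def using I' fin_prod by (intro finite_UN_I) auto
  have "real (card (V - D)) \<ge> real (card V) - real (card D)"
    using diff_card_le_card_Diff[OF finD, of V] by linarith
  hence "\<eta> * (real (card V) - (\<Sum>j\<in>{Suc k..<l}. real (n j) * real (card ((m_inv G ` F k) <#> F j))))
      \<le> \<eta> * real (card (V - D))"
    using cardD \<eta> by (intro mult_left_mono) auto
  with room have lower: "real (n k) * real (card (F k)) \<le> \<eta> * real (card (V - D))" by linarith
  \<comment> \<open>Away from \<open>D\<close> a tile can only overlap tiles of its own shape.\<close>
  have in_Wn: "\<sigma> s v \<in> Wn" if v: "v \<in> V - D" and s: "s \<in> F k" and W: "\<sigma> s v \<in> W" for s v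
  proof (rule ccontr)
    assume notin: "\<sigma> s v \<notin> Wn"
    obtain j c t where jct: "(j, c) \<in> I" "t \<in> F j" "\<sigma> s v = \<sigma> t c" using W by (force simp: W_def)
    have jk: "j \<noteq> k" using notin jct by (auto simp: Wn_def)
    have jl: "j < l" and cV: "c \<in> V" using jct(1) I by auto
    have tG: "t \<in> carrier G" using jct(2) finite_subsetsD(1)[OF F[OF jl]] by auto
    have sG: "s \<in> carrier G" using s Fk by auto
    have mem: "inv s \<otimes> t \<in> (m_inv G ` F k) <#> F j" using s jct(2) by (auto simp: set_mult_def)
    hence memK: "inv s \<otimes> t \<in> K" using invFK[OF k jl] by blast
    have sK: "s \<in> K" using FK[OF k] s by blast
    have "\<sigma> s (\<sigma> (inv s \<otimes> t) c) = \<sigma> (s \<otimes> (inv s \<otimes> t)) c"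
      using free cV memK sK unfolding acts_freely_at_def by blast
    also have "s \<otimes> (inv s \<otimes> t) = t" using sG tG by (simp flip: m_assoc)
    finally have eq: "\<sigma> s (\<sigma> (inv s \<otimes> t) c) = \<sigma> s v" using jct(3) by simp
    have "\<sigma> (inv s \<otimes> t) c \<in> A" "v \<in> A" "inj_on (\<sigma> s) A"
      using free cV memK sK v unfolding acts_freely_at_def by blast+
    hence "v = \<sigma> (inv s \<otimes> t) c" using eq by (metis inj_onD)
    hence "v \<in> D" using mem jct(1) jk unfolding D_def I'_def by force
    thus False using v by blast
  qed
  have finWn: "finite Wn" unfolding Wn_def using finc Fk by blast
  have "card Wn \<le> (\<Sum>c\<in>{c. (k, c) \<in> I}. card ((\<lambda>s. \<sigma> s c) ` F k))"
    unfolding Wn_def by (rule card_UN_le[OF finc])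
  also have "\<dots> \<le> (\<Sum>c\<in>{c. (k, c) \<in> I}. card (F k))" by (intro sum_mono card_image_le Fk)
  finally have cardWn: "card Wn \<le> card {c. (k, c) \<in> I} * card (F k)" by simp
  have finVD: "finite (V - D)" using V by blast
  have "(\<Sum>v\<in>V - D. card {s \<in> F k. \<sigma> s v \<in> W}) \<le> (\<Sum>v\<in>V - D. card {s \<in> F k. \<sigma> s v \<in> Wn})"
    by (intro sum_mono card_mono) (use Fk in_Wn in auto)
  also have "\<dots> = (\<Sum>s\<in>F k. card {v \<in> V - D. \<sigma> s v \<in> Wn})"
    using sum_multicount_gen[OF finVD Fk(1), of "\<lambda>v s. \<sigma> s v \<in> Wn"] by simp
  also have "\<dots> \<le> (\<Sum>s\<in>F k. card Wn)"
  proof (rule sum_mono)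
    fix s assume s: "s \<in> F k"
    hence "inj_on (\<sigma> s) A" "V \<subseteq> A" using free FK[OF k] unfolding acts_freely_at_def by blast+
    hence "inj_on (\<sigma> s) {v \<in> V - D. \<sigma> s v \<in> Wn}" 
      by (elim inj_on_subset) auto
    thus "card {v \<in> V - D. \<sigma> s v \<in> Wn} \<le> card Wn"
      by (rule card_inj_on_le) (use finWn in auto)
  qed
  also have "\<dots> \<le> card (F k) * (card {c. (k, c) \<in> I} * card (F k))" using cardWn by simp
  finally have upper: "real (\<Sum>v\<in>V - D. card {s \<in> F k. \<sigma> s v \<in> W})
      \<le> real (card (F k) * (card {c. (k, c) \<in> I} * card (F k)))"
    by (simp only: of_nat_le_iff)
  have "real (card (V - D)) * (\<eta> * real (card (F k))) \<le> (\<Sum>v\<in>V - D. real (card {s \<in> F k. \<sigma> s v \<in> W}))"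
    using sum_bounded_below[of "V - D" "\<eta> * real (card (F k))" "\<lambda>v. real (card {s \<in> F k. \<sigma> s v \<in> W})"]
      dense by (simp add: less_imp_le)
  with upper have "real (card (F k)) * (\<eta> * real (card (V - D)))
      \<le> real (card (F k)) * (real (card {c. (k, c) \<in> I}) * real (card (F k)))"
    by (simp add: mult_ac)
  hence "\<eta> * real (card (V - D)) \<le> real (card {c. (k, c) \<in> I}) * real (card (F k))"
    using Fk(3) by (subst (asm) mult_le_cancel_left_pos) auto
  with lower have "real (n k) * real (card (F k)) \<le> real (card {c. (k, c) \<in> I}) * real (card (F k))"
    by linarith
  hence "n k \<le> card {c. (k, c) \<in> I}" using Fk(3) by simp
  thus False using few by simp
qed

text \<open>
  Shapes are used in the order of decreasing index, which puts the most invariant shape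
  first when each shape is invariant relative to those of smaller index.
\<close>

lemma (in group) quasi_tiling_exists:
  fixes \<sigma> :: "'a \<Rightarrow> 'v \<Rightarrow> 'v"
  assumes F: "\<And>j. j < l \<Longrightarrow> F j \<in> finite_subsets G" and V: "finite V"
    and free: "acts_freely_at G \<sigma> K A V"
    and FK: "\<And>j. j < l \<Longrightarrow> F j \<subseteq> K"
    and invFK: "\<And>i j. i < l \<Longrightarrow> j < l \<Longrightarrow> (m_inv G ` F i) <#> F j \<subseteq> K"
    and \<eta>: "0 < \<eta>" "\<eta> < 1"
    and room: "\<And>k. k < l \<Longrightarrow> real (n k) * real (card (F k)) \<le>
       \<eta> * (real (card V) - (\<Sum>j\<in>{Suc k..<l}. real (n j) * real (card ((m_inv G ` F k) <#> F j))))"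
  shows "\<exists>I T. quasi_tiling \<sigma> V F \<eta> I T \<and> I \<subseteq> {..<l} \<times> V \<and> (\<forall>k<l. card {c. (k, c) \<in> I} = n k)"
proof -
  define P where "P = (\<lambda>a I T. quasi_tiling \<sigma> V F \<eta> I T \<and> I \<subseteq> {a..<l} \<times> V \<and>
      (\<forall>k\<in>{a..<l}. card {c. (k, c) \<in> I} = n k))"
  have add_shape: "\<exists>I T. P k I T" if k: "k < l" and IH: "\<exists>I T. P (Suc k) I T" for k
  proof -
    define Q where "Q = (\<lambda>m I T. quasi_tiling \<sigma> V F \<eta> I T \<and> I \<subseteq> {k..<l} \<times> V \<and>
      (\<forall>j\<in>{Suc k..<l}. card {c. (j, c) \<in> I} = n j) \<and> card {c. (k, c) \<in> I} = m)"
    have "\<exists>I T. Q m I T" if "m \<le> n k" for m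
      using that
    proof (induction m)
      case 0
      obtain I T where IT: "P (Suc k) I T" using IH by blast
      hence none: "{c. (k, c) \<in> I} = {}" and sub: "I \<subseteq> {k..<l} \<times> V"
        by (auto simp: P_def)
      have "Q 0 I T" unfolding Q_def none using IT sub by (simp add: P_def)
      thus ?case by blast
    next
      case (Suc m)
      then obtain I T where Q: "Q m I T" by auto
      hence tiling: "quasi_tiling \<sigma> V F \<eta> I T" and I: "I \<subseteq> {k..<l} \<times> V"
        and counts: "\<And>j. j \<in> {Suc k..<l} \<Longrightarrow> card {c. (j, c) \<in> I} = n j"
        and m: "card {c. (k, c) \<in> I} = m" by (auto simp: Q_def)
      define W where "W = (\<Union>p\<in>I. (\<lambda>s. \<sigma> s (snd p)) ` F (fst p))"
      have few: "card {c. (k, c) \<in> I} < n k" using m Suc.prems by simp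
      obtain v where v: "v \<in> V"
        and sparse: "real (card {s \<in> F k. \<sigma> s v \<in> W}) \<le> \<eta> * real (card (F k))"
        using tile_centre_exists[OF F V free FK invFK k I counts few \<eta>(1) room[OF k]]
        unfolding W_def by blast
      have Fk: "finite (F k)" "0 < card (F k)" using finite_subsetsD[OF F[OF k]] by auto
      have new: "(k, v) \<notin> I"
      proof
        assume "(k, v) \<in> I"
        hence "{s \<in> F k. \<sigma> s v \<in> W} = F k" by (force simp: W_def)
        hence "real (card (F k)) \<le> \<eta> * real (card (F k))" using sparse by simp
        thus False using Fk(2) \<eta>(2) by simp
      qed
      define T' where "T' = T((k, v) := {s \<in> F k. \<sigma> s v \<notin> W})"
      have T'_old: "T' p = T p" if "p \<in> I" for p using that new by (auto simp: T'_def)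
      have old_sub: "(\<lambda>s. \<sigma> s (snd p)) ` T p \<subseteq> W" if "p \<in> I" for p
        using tiling that unfolding quasi_tiling_def W_def by fastforce
      have "card (F k) \<le> card ({s \<in> F k. \<sigma> s v \<in> W} \<union> {s \<in> F k. \<sigma> s v \<notin> W})"
        by (rule card_mono) (use Fk in auto)
      also have "\<dots> \<le> card {s \<in> F k. \<sigma> s v \<in> W} + card {s \<in> F k. \<sigma> s v \<notin> W}"
        by (rule card_Un_le)
      finally have large: "(1 - \<eta>) * real (card (F k)) \<le> real (card {s \<in> F k. \<sigma> s v \<notin> W})"
        using sparse by (simp add: algebra_simps)
      have "quasi_tiling \<sigma> V F \<eta> (insert (k, v) I) T'"
        unfolding quasi_tiling_def
      proof
        show "\<forall>p\<in>insert (k, v) I. snd p \<in> V \<and> T' p \<subseteq> F (fst p) \<and>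
            (1 - \<eta>) * real (card (F (fst p))) \<le> real (card (T' p))"
        proof
          fix p assume "p \<in> insert (k, v) I"
          thus "snd p \<in> V \<and> T' p \<subseteq> F (fst p) \<and> (1 - \<eta>) * real (card (F (fst p))) \<le> real (card (T' p))"
          proof
            assume "p = (k, v)"
            thus ?thesis using v large by (auto simp: T'_def)
          next
            assume "p \<in> I"
            thus ?thesis using tiling T'_old by (simp add: quasi_tiling_def)
          qed
        qed
        have "disjoint_family_on (\<lambda>p. (\<lambda>s. \<sigma> s (snd p)) ` T' p) I"
          using tiling T'_old by (simp add: quasi_tiling_def disjoint_family_on_def)
        moreover have "(\<lambda>s. \<sigma> s v) ` T' (k, v) \<inter> W = {}" by (auto simp: T'_def)
        moreover have "(\<Union>p\<in>I. (\<lambda>s. \<sigma> s (snd p)) ` T' p) \<subseteq> W"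
          using old_sub T'_old by (simp add: UN_subset_iff)
        ultimately show "disjoint_family_on (\<lambda>p. (\<lambda>s. \<sigma> s (snd p)) ` T' p) (insert (k, v) I)"
          using new by (subst disjoint_family_on_insert) auto
      qed
      moreover have "insert (k, v) I \<subseteq> {k..<l} \<times> V" using I k v by auto
      moreover have "card {c. (j, c) \<in> insert (k, v) I} = n j" if j: "j \<in> {Suc k..<l}" for j
      proof -
        have "{c. (j, c) \<in> insert (k, v) I} = {c. (j, c) \<in> I}" using j by auto
        thus ?thesis using counts[OF j] by simp
      qed
      moreover have "card {c. (k, c) \<in> insert (k, v) I} = Suc m"
      proof -
        have "{c. (k, c) \<in> insert (k, v) I} = insert v {c. (k, c) \<in> I}" by auto
        moreover have "finite {c. (k, c) \<in> I}" by (rule finite_subset[OF _ V]) (use I in auto)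
        ultimately show ?thesis using new m by simp
      qed
      ultimately have "Q (Suc m) (insert (k, v) I) T'" by (simp add: Q_def)
      thus ?case by blast
    qed
    then obtain I T where IT: "Q (n k) I T" by blast
    have "card {c. (j, c) \<in> I} = n j" if "j \<in> {k..<l}" for j
    proof (cases "j = k")
      case False
      hence "j \<in> {Suc k..<l}" using that by auto
      thus ?thesis using IT by (simp add: Q_def)
    qed (use IT in \<open>simp add: Q_def\<close>)
    hence "P k I T" using IT by (simp add: P_def Q_def)
    thus ?thesis by blast
  qed
  have "\<exists>I T. P 0 I T"
  proof (rule inc_induct[of 0 l "\<lambda>a. \<exists>I T. P a I T"])
    have "P l {} (\<lambda>_. {})" by (simp add: P_def quasi_tiling_def disjoint_family_on_def)
    thus "\<exists>I T. P l I T" by blast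
  qed (use add_shape in auto)
  then obtain I T where "P 0 I T" by blast
  hence "quasi_tiling \<sigma> V F \<eta> I T \<and> I \<subseteq> {..<l} \<times> V \<and> (\<forall>k<l. card {c. (k, c) \<in> I} = n k)"
    by (auto simp: P_def atLeast0LessThan)
  thus ?thesis by blast
qed

section \<open>Tile counts depending only on the size\<close>

text \<open>
  Numbers of tiles for a set with \<open>N\<close> elements: small enough for the greedy construction to reach
  them, large enough for the tiles to exhaust all but the proportion \<open>4\<eta>\<close>. Nothing here depends on
  the set except for its size, so two sets of the same size can be tiled in the same way.
\<close>

definition tile_counts ::
    "('g, 'm) monoid_scheme \<Rightarrow> real \<Rightarrow> nat \<Rightarrow> (nat \<Rightarrow> 'g set) \<Rightarrow> real \<Rightarrow> (nat \<Rightarrow> nat) \<Rightarrow> bool" where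
  "tile_counts G \<eta> l F N n \<longleftrightarrow>
     (\<forall>k<l. real (n k) * real (card (F k)) \<le>
        \<eta> * ((1 - \<eta>) * N -
          (\<Sum>j\<in>{Suc k..<l}. real (n j) * real (card ((m_inv G ` F k) <#>\<^bsub>G\<^esub> F j))))) \<and>
     (1 - 4 * \<eta>) * N \<le> (\<Sum>k<l. real (n k) * real (card (F k))) \<and>
     (\<Sum>k<l. real (n k) * real (card (F k))) \<le> N"

text \<open>
  Each shape takes as many tiles as permitted, that is about the proportion \<open>\<eta>\<close> of the remaining
  room, so the room shrinks by the factor \<open>1 - \<eta>\<close> per shape, up to rounding. The factor \<open>1 + \<eta>\<close>
  pays for the growth of the sets \<open>F k\<^sup>-\<^sup>1 F j\<close>.
\<close>

lemma greedy_counts_exist: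
  fixes f :: "nat \<Rightarrow> real"
  assumes \<eta>: "0 < \<eta>" "\<eta> \<le> 1 / 2" and f: "\<forall>k<l. 0 < f k" and M: "0 \<le> M"
  shows "\<exists>n :: nat \<Rightarrow> nat.
    (\<forall>k<l. n k * f k \<le> \<eta> * (M - (1 + \<eta>) * (\<Sum>j\<in>{Suc k..<l}. n j * f j))) \<and>
    0 \<le> M - (1 + \<eta>) * (\<Sum>k<l. n k * f k) \<and>
    M - (1 + \<eta>) * (\<Sum>k<l. n k * f k) \<le> (1 - \<eta>) ^ l * M + 2 * (\<Sum>k<l. f k)"
proof -
  define r where "r = (\<lambda>a (n :: nat \<Rightarrow> nat). M - (1 + \<eta>) * (\<Sum>j\<in>{a..<l}. n j * f j))"
  define R where "R = (\<lambda>a (n :: nat \<Rightarrow> nat). (\<forall>k\<in>{a..<l}. n k * f k \<le> \<eta> * r (Suc k) n) \<and>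
      0 \<le> r a n \<and> r a n \<le> (1 - \<eta>) ^ (l - a) * M + 2 * (\<Sum>k\<in>{a..<l}. f k))"
  have step: "\<exists>n. R k n" if k: "k < l" and IH: "\<exists>n. R (Suc k) n" for k
  proof -
    obtain n where n: "R (Suc k) n" using IH by blast
    define q where "q = r (Suc k) n"
    have q: "0 \<le> q" "q \<le> (1 - \<eta>) ^ (l - Suc k) * M + 2 * (\<Sum>k\<in>{Suc k..<l}. f k)"
      using n by (auto simp: R_def q_def)
    define m where "m = nat \<lfloor>\<eta> * q / f k\<rfloor>"
    have fk: "0 < f k" using f k by simp
    have "0 \<le> \<eta> * q / f k" using q \<eta> fk by simp
    hence "real m \<le> \<eta> * q / f k" "\<eta> * q / f k < real m + 1"
      unfolding m_def by linarith+
    hence m: "m * f k \<le> \<eta> * q" "\<eta> * q - f k \<le> m * f k"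
      using fk by (simp_all add: field_simps)
    define n' where "n' = n(k := m)"
    have same: "r (Suc j) n' = r (Suc j) n" if "j \<ge> k" for j
      unfolding r_def n'_def using that by (auto intro!: sum.cong)
    have split: "{k..<l} = insert k {Suc k..<l}" using k by auto
    have "r k n' = r (Suc k) n' - (1 + \<eta>) * (m * f k)"
      unfolding r_def split by (simp add: n'_def algebra_simps)
    hence rk: "r k n' = q - (1 + \<eta>) * (m * f k)" using same[of k] by (simp add: q_def)
    have "(1 + \<eta>) * (m * f k) \<le> (1 + \<eta>) * (\<eta> * q)"
      using m(1) \<eta> by (intro mult_left_mono) auto
    also have "\<dots> = ((1 + \<eta>) * \<eta>) * q" by simp
    also have "\<dots> \<le> 1 * q"
    proof (rule mult_right_mono[OF _ q(1)])
      have "(1 + \<eta>) * \<eta> \<le> (1 + 1 / 2) * (1 / 2)" using \<eta> by (intro mult_mono) auto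
      thus "(1 + \<eta>) * \<eta> \<le> 1" by simp
    qed
    finally have nonneg: "0 \<le> r k n'" unfolding rk by simp
    have "(1 + \<eta>) * (\<eta> * q - f k) \<le> (1 + \<eta>) * (m * f k)"
      using m(2) \<eta> by (intro mult_left_mono) auto
    moreover have "\<eta> * q - 2 * f k \<le> (1 + \<eta>) * (\<eta> * q - f k)"
    proof -
      have "0 \<le> \<eta> * (\<eta> * q)" "0 \<le> (1 - \<eta>) * f k" using \<eta> q fk by auto
      thus ?thesis by (simp add: algebra_simps)
    qed
    ultimately have "r k n' \<le> (1 - \<eta>) * q + 2 * f k" unfolding rk by (simp add: algebra_simps)
    also have "(1 - \<eta>) * q \<le> (1 - \<eta>) * ((1 - \<eta>) ^ (l - Suc k) * M + 2 * (\<Sum>k\<in>{Suc k..<l}. f k))"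
      using q \<eta> by (intro mult_left_mono) auto
    also have "\<dots> = (1 - \<eta>) ^ (l - k) * M + (1 - \<eta>) * (2 * (\<Sum>k\<in>{Suc k..<l}. f k))"
    proof -
      have "l - k = Suc (l - Suc k)" using k by simp
      hence "(1 - \<eta>) ^ (l - k) = (1 - \<eta>) * (1 - \<eta>) ^ (l - Suc k)" by simp
      thus ?thesis by (simp only: distrib_left mult.assoc)
    qed
    also have "(1 - \<eta>) * (2 * (\<Sum>k\<in>{Suc k..<l}. f k)) \<le> 2 * (\<Sum>k\<in>{Suc k..<l}. f k)"
    proof -
      have "0 \<le> (\<Sum>k\<in>{Suc k..<l}. f k)" by (rule sum_nonneg) (use f in \<open>auto intro: less_imp_le\<close>)
      thus ?thesis using \<eta> by (intro mult_left_le_one_le) auto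
    qed
    finally have upper: "r k n' \<le> (1 - \<eta>) ^ (l - k) * M + 2 * (\<Sum>k\<in>{k..<l}. f k)"
      unfolding split by simp
    have "n' j * f j \<le> \<eta> * r (Suc j) n'" if j: "j \<in> {k..<l}" for j
    proof (cases "j = k")
      case True
      thus ?thesis using m(1) same[of k] by (simp add: n'_def q_def)
    next
      case False
      thus ?thesis using n j same[of j] by (auto simp: R_def n'_def)
    qed
    hence "R k n'" using nonneg upper by (simp add: R_def)
    thus ?thesis by blast
  qed
  have "\<exists>n. R 0 n"
  proof (rule inc_induct[of 0 l "\<lambda>a. \<exists>n. R a n"])
    show "\<exists>n. R l n" by (rule exI[of _ "\<lambda>_. 0"]) (simp add: R_def r_def M)
  qed (use step in auto)
  then obtain n where n: "R 0 n" by blast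
  show ?thesis
    by (rule exI[of _ n]) (use n in \<open>auto simp: R_def r_def atLeast0LessThan\<close>)
qed

lemma tile_counts_exist:
  assumes \<eta>: "0 < \<eta>" "\<eta> \<le> 1 / 2" and l: "(1 - \<eta>) ^ l \<le> \<eta>"
    and F: "\<And>k. k < l \<Longrightarrow> 0 < card (F k)"
    and growth: "\<And>k j. k < j \<Longrightarrow> j < l \<Longrightarrow>
      real (card ((m_inv G ` F k) <#>\<^bsub>G\<^esub> F j)) \<le> (1 + \<eta>) * real (card (F j))"
    and N: "2 * (\<Sum>k<l. real (card (F k))) \<le> \<eta> * N" "0 \<le> N"
  shows "\<exists>n. tile_counts G \<eta> l F N n"
proof -
  define f where "f = (\<lambda>k. real (card (F k)))"
  have f: "\<forall>k<l. 0 < f k" using F by (simp add: f_def)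
  have M: "0 \<le> (1 - \<eta>) * N" using \<eta> N by simp
  obtain n :: "nat \<Rightarrow> nat" where
    n: "\<forall>k<l. n k * f k \<le> \<eta> * ((1 - \<eta>) * N - (1 + \<eta>) * (\<Sum>j\<in>{Suc k..<l}. n j * f j))"
    and n0: "0 \<le> (1 - \<eta>) * N - (1 + \<eta>) * (\<Sum>k<l. n k * f k)"
    and n1: "(1 - \<eta>) * N - (1 + \<eta>) * (\<Sum>k<l. n k * f k)
       \<le> (1 - \<eta>) ^ l * ((1 - \<eta>) * N) + 2 * (\<Sum>k<l. f k)"
    using greedy_counts_exist[OF \<eta> f M] by (elim exE conjE)
  define S where "S = (\<Sum>k<l. n k * f k)"
  have S: "0 \<le> S" unfolding S_def by (intro sum_nonneg) (simp add: f_def)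
  have "(\<Sum>j\<in>{Suc k..<l}. real (n j) * real (card ((m_inv G ` F k) <#>\<^bsub>G\<^esub> F j)))
      \<le> (1 + \<eta>) * (\<Sum>j\<in>{Suc k..<l}. n j * f j)" for k
    unfolding sum_distrib_left
  proof (rule sum_mono)
    fix j assume "j \<in> {Suc k..<l}"
    hence "real (card ((m_inv G ` F k) <#>\<^bsub>G\<^esub> F j)) \<le> (1 + \<eta>) * f j"
      unfolding f_def by (intro growth) auto
    from mult_left_mono[OF this, of "real (n j)"]
    show "real (n j) * real (card ((m_inv G ` F k) <#>\<^bsub>G\<^esub> F j)) \<le> (1 + \<eta>) * (n j * f j)"
      by (simp add: mult_ac)
  qed
  hence "\<eta> * ((1 - \<eta>) * N - (1 + \<eta>) * (\<Sum>j\<in>{Suc k..<l}. n j * f j)) \<le>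
        \<eta> * ((1 - \<eta>) * N -
          (\<Sum>j\<in>{Suc k..<l}. real (n j) * real (card ((m_inv G ` F k) <#>\<^bsub>G\<^esub> F j))))" for k
    using \<eta> by (intro mult_left_mono diff_left_mono) auto
  hence 1: "\<forall>k<l. real (n k) * real (card (F k)) \<le>
        \<eta> * ((1 - \<eta>) * N -
          (\<Sum>j\<in>{Suc k..<l}. real (n j) * real (card ((m_inv G ` F k) <#>\<^bsub>G\<^esub> F j))))"
    using n unfolding f_def by (meson order_trans)
  have "(1 - \<eta>) ^ l * ((1 - \<eta>) * N) \<le> \<eta> * ((1 - \<eta>) * N)"
    by (rule mult_right_mono[OF l M])
  also have "\<dots> \<le> \<eta> * N" using \<eta> N by (intro mult_left_mono mult_left_le_one_le) auto
  finally have "(1 - \<eta>) * N - (1 + \<eta>) * S \<le> 2 * (\<eta> * N)"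
    using n1 N(1) unfolding S_def f_def by linarith
  hence "(1 - 3 * \<eta>) * N \<le> (1 + \<eta>) * S" by (simp add: algebra_simps)
  moreover have "(1 + \<eta>) * ((1 - 4 * \<eta>) * N) \<le> (1 - 3 * \<eta>) * N"
  proof -
    have "0 \<le> \<eta> * (\<eta> * N)" using \<eta> N by simp
    thus ?thesis by (simp add: algebra_simps)
  qed
  ultimately have "(1 + \<eta>) * ((1 - 4 * \<eta>) * N) \<le> (1 + \<eta>) * S" by linarith
  hence 2: "(1 - 4 * \<eta>) * N \<le> S" using \<eta> by simp
  have "S \<le> (1 + \<eta>) * S" "(1 - \<eta>) * N \<le> N" using S N \<eta> by (simp_all add: algebra_simps)
  hence 3: "S \<le> N" using n0 unfolding S_def by linarith
  from 1 2 3 have "tile_counts G \<eta> l F N n" by (simp add: tile_counts_def S_def f_def)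
  thus ?thesis by blast
qed

lemma (in group) finite_inv_set_mult:
  assumes "A \<subseteq> carrier G" "finite A" "B \<subseteq> carrier G" "finite B"
  shows "finite ((m_inv G ` A) <#> B)" "(m_inv G ` A) <#> B \<subseteq> carrier G"
  using assms by (auto simp: set_mult_def)

text \<open>
  Invariance relative to the earlier shapes holds eventually, so it can be combined with any property
  that holds frequently, such as having a ratio \<open>h(F)/|F|\<close> close to the lower limit.
\<close>

lemma (in group) tile_shapes_exist:
  fixes l :: nat
  assumes Q: "frequently Q (invariance_filter G)" and \<eta>: "0 < \<eta>"
  shows "\<exists>F. \<forall>j<l. F j \<in> finite_subsets G \<and> Q (F j) \<and>
     (\<forall>k<j. real (card ((m_inv G ` F k) <#> F j)) \<le> (1 + \<eta>) * real (card (F j)))"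
proof (induction l)
  case (Suc l)
  then obtain F where F: "\<forall>j<l. F j \<in> finite_subsets G \<and> Q (F j) \<and>
     (\<forall>k<j. real (card ((m_inv G ` F k) <#> F j)) \<le> (1 + \<eta>) * real (card (F j)))" by blast
  have "\<forall>k\<in>{..<l}. eventually (\<lambda>E. real (card ((m_inv G ` F k) <#> E)) \<le> (1 + \<eta>) * real (card E))
      (invariance_filter G)"
  proof
    fix k assume "k \<in> {..<l}"
    hence "F k \<in> finite_subsets G" using F by simp
    from finite_subsetsD[OF this]
    have "m_inv G ` F k \<subseteq> carrier G" "finite (m_inv G ` F k)" by auto
    thus "eventually (\<lambda>E. real (card ((m_inv G ` F k) <#> E)) \<le> (1 + \<eta>) * real (card E))
        (invariance_filter G)" by (rule eventually_card_set_mult_le) (rule \<eta>)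
  qed
  hence "eventually (\<lambda>E. \<forall>k\<in>{..<l}. real (card ((m_inv G ` F k) <#> E)) \<le> (1 + \<eta>) * real (card E))
      (invariance_filter G)" by (simp add: eventually_ball_finite_distrib)
  moreover have "eventually (almost_invariant G {} 1) (invariance_filter G)"
    by (rule eventually_almost_invariant) auto
  ultimately have "eventually (\<lambda>E. E \<in> finite_subsets G \<and>
      (\<forall>k<l. real (card ((m_inv G ` F k) <#> E)) \<le> (1 + \<eta>) * real (card E))) (invariance_filter G)"
    by eventually_elim (simp add: almost_invariant_def)
  from frequently_eventually_conj[OF Q this]
  obtain E where "Q E" "E \<in> finite_subsets G"
      "\<forall>k<l. real (card ((m_inv G ` F k) <#> E)) \<le> (1 + \<eta>) * real (card E)"
    by (auto dest!: frequently_ex)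
  hence "\<forall>j<Suc l. (F(l := E)) j \<in> finite_subsets G \<and> Q ((F(l := E)) j) \<and>
     (\<forall>k<j. real (card ((m_inv G ` (F(l := E)) k) <#> (F(l := E)) j)) \<le> (1 + \<eta>) * real (card ((F(l := E)) j)))"
    using F by (simp add: less_Suc_eq)
  thus ?case by blast
qed simp

text \<open>
  The number of shapes is chosen with \<open>(1 - \<eta>)\<^sup>l \<le> \<eta>\<close>. The set \<open>K\<close> collects the group elements whose
  behaviour the greedy construction has to control.
\<close>

lemma (in group) tile_system_exists:
  assumes Q: "frequently Q (invariance_filter G)" and \<eta>: "0 < \<eta>" "\<eta> \<le> 1 / 2"
  obtains l F K N\<^sub>0 where
    "\<And>j. j < l \<Longrightarrow> F j \<in> finite_subsets G" "\<And>j. j < l \<Longrightarrow> Q (F j)"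
    "K \<subseteq> carrier G" "finite K" "\<And>j. j < l \<Longrightarrow> F j \<subseteq> K"
    "\<And>i j. i < l \<Longrightarrow> j < l \<Longrightarrow> (m_inv G ` F i) <#> F j \<subseteq> K"
    "\<And>N. N\<^sub>0 \<le> N \<Longrightarrow> \<exists>n. tile_counts G \<eta> l F (real N) n"
proof -
  obtain l where l: "(1 - \<eta>) ^ l < \<eta>" using real_arch_pow_inv[of \<eta> "1 - \<eta>"] \<eta> by auto
  obtain F where F: "\<And>j. j < l \<Longrightarrow> F j \<in> finite_subsets G" "\<And>j. j < l \<Longrightarrow> Q (F j)"
    and growth: "\<And>k j. k < j \<Longrightarrow> j < l \<Longrightarrow>
      real (card ((m_inv G ` F k) <#> F j)) \<le> (1 + \<eta>) * real (card (F j))"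
    using tile_shapes_exist[OF Q \<eta>(1), of l] by blast
  define K where "K = (\<Union>j<l. F j) \<union> (\<Union>i<l. \<Union>j<l. (m_inv G ` F i) <#> F j)"
  have fin: "finite (F j)" "F j \<subseteq> carrier G" "0 < card (F j)" if "j < l" for j
    using finite_subsetsD[OF F(1)[OF that]] by auto
  have prod: "finite ((m_inv G ` F i) <#> F j)" "(m_inv G ` F i) <#> F j \<subseteq> carrier G"
    if "i < l" "j < l" for i j
    using finite_inv_set_mult[OF fin(2,1) fin(2,1)] that by blast+
  obtain N\<^sub>0 :: nat where N\<^sub>0: "2 * (\<Sum>k<l. real (card (F k))) / \<eta> \<le> real N\<^sub>0"
    using real_arch_simple by blast
  show ?thesis
  proof (rule that[of l F K N\<^sub>0])
    show "K \<subseteq> carrier G"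
      unfolding K_def by (intro Un_least UN_least fin(2) prod(2)) auto
    show "finite K" using fin prod by (auto simp: K_def)
    fix N assume "N\<^sub>0 \<le> N"
    hence "2 * (\<Sum>k<l. real (card (F k))) / \<eta> \<le> real N" using N\<^sub>0 by linarith
    hence "2 * (\<Sum>k<l. real (card (F k))) \<le> \<eta> * real N" using \<eta> by (simp add: field_simps)
    thus "\<exists>n. tile_counts G \<eta> l F (real N) n"
      by (intro tile_counts_exist \<eta> less_imp_le[OF l] fin(3) growth) auto
  qed (use F in \<open>auto simp: K_def\<close>)
qed

lemma (in group) quasi_tiling_of_size:
  fixes \<sigma> :: "'a \<Rightarrow> 'v \<Rightarrow> 'v"
  assumes F: "\<And>j. j < l \<Longrightarrow> F j \<in> finite_subsets G"
    and FK: "\<And>j. j < l \<Longrightarrow> F j \<subseteq> K"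
    and invFK: "\<And>i j. i < l \<Longrightarrow> j < l \<Longrightarrow> (m_inv G ` F i) <#> F j \<subseteq> K"
    and n: "tile_counts G \<eta> l F N n" and \<eta>: "0 < \<eta>" "\<eta> \<le> 1 / 2"
    and V: "finite V" "acts_freely_at G \<sigma> K A V" "(1 - \<eta>) * N \<le> real (card V)"
  obtains I T where "quasi_tiling \<sigma> V F \<eta> I T" "I \<subseteq> {..<l} \<times> V" "\<And>k. k < l \<Longrightarrow> card {c. (k, c) \<in> I} = n k"
proof -
  have "\<exists>I T. quasi_tiling \<sigma> V F \<eta> I T \<and> I \<subseteq> {..<l} \<times> V \<and> (\<forall>k<l. card {c. (k, c) \<in> I} = n k)"
  proof (rule quasi_tiling_exists[OF F V(1,2) FK invFK \<eta>(1)])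
    show "\<eta> < 1" using \<eta> by simp
    fix k assume "k < l"
    hence "real (n k) * real (card (F k)) \<le> \<eta> * ((1 - \<eta>) * N -
          (\<Sum>j\<in>{Suc k..<l}. real (n j) * real (card ((m_inv G ` F k) <#> F j))))"
      using n by (simp add: tile_counts_def)
    also have "\<dots> \<le> \<eta> * (real (card V) -
          (\<Sum>j\<in>{Suc k..<l}. real (n j) * real (card ((m_inv G ` F k) <#> F j))))"
      using V(3) \<eta> by (intro mult_left_mono) auto
    finally show "real (n k) * real (card (F k)) \<le> \<dots>" .
  qed
  thus ?thesis using that by blast
qed

lemma quasi_tiling_inj_on:
  assumes tiling: "quasi_tiling \<sigma> V F \<eta> I T" and "I \<subseteq> {..<l} \<times> V"
    and FK: "\<And>j. j < l \<Longrightarrow> F j \<subseteq> K" and free: "acts_freely_at G \<sigma> K A V"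
  shows "inj_on (\<lambda>(p, s). \<sigma> s (snd p)) (SIGMA p:I. T p)"
proof (rule inj_onI)
  fix z z' assume z: "z \<in> (SIGMA p:I. T p)" "z' \<in> (SIGMA p:I. T p)"
    and eq: "(case z of (p, s) \<Rightarrow> \<sigma> s (snd p)) = (case z' of (p, s) \<Rightarrow> \<sigma> s (snd p))"
  obtain p s p' s' where [simp]: "z = (p, s)" "z' = (p', s')" by (cases z, cases z') auto
  have p: "p \<in> I" "s \<in> T p" "p' \<in> I" "s' \<in> T p'" "\<sigma> s (snd p) = \<sigma> s' (snd p')"
    using z eq by auto
  have pp: "p = p'"
  proof (rule ccontr)
    assume "p \<noteq> p'"
    hence "(\<lambda>s. \<sigma> s (snd p)) ` T p \<inter> (\<lambda>s. \<sigma> s (snd p')) ` T p' = {}"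
      using tiling p unfolding quasi_tiling_def disjoint_family_on_def by simp
    thus False using p by blast
  qed
  have "T p \<subseteq> F (fst p)" "snd p \<in> V" using tiling p(1) by (simp_all add: quasi_tiling_def)
  moreover have "F (fst p) \<subseteq> K" using assms(2) p(1) by (intro FK) auto
  ultimately have "s \<in> K" "s' \<in> K" "inj_on (\<lambda>s. \<sigma> s (snd p)) K"
    using p pp free unfolding acts_freely_at_def by blast+
  hence "s = s'" using p(5) pp by (metis (no_types, lifting) inj_onD)
  thus "z = z'" using pp by simp
qed

text \<open>
  The number \<open>\<theta>\<close> bounds the proportion of each tile that is discarded. Disjoint tiles cover as many points
  as there are pairs of a tile and an element of its kept part.
\<close>

lemma card_tiles_ge:
  assumes "finite V" "I \<subseteq> {..<l} \<times> V" and "\<And>k. k < l \<Longrightarrow> card {c. (k, c) \<in> I} = n k"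
    and n: "tile_counts G \<eta> l F N n" and S: "\<And>p. p \<in> I \<Longrightarrow> finite (S p)"
    and large: "\<And>p. p \<in> I \<Longrightarrow> (1 - \<theta>) * real (card (F (fst p))) \<le> real (card (S p))"
    and \<theta>: "0 \<le> \<theta>" "\<theta> \<le> 1" and N: "0 \<le> N" and \<eta>: "0 \<le> \<eta>"
  shows "(1 - \<theta> - 4 * \<eta>) * N \<le> real (card (SIGMA p:I. S p))"
proof -
  have finI: "finite I" using assms(1,2) by (meson finite_SigmaI finite_lessThan finite_subset)
  have "(1 - \<theta> - 4 * \<eta>) * N \<le> (1 - \<theta>) * ((1 - 4 * \<eta>) * N)"
  proof -
    have "0 \<le> 4 * (\<theta> * (\<eta> * N))" using \<theta> \<eta> N by simp
    thus ?thesis by (simp add: algebra_simps)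
  qed
  also have "\<dots> \<le> (1 - \<theta>) * (\<Sum>k<l. real (n k) * real (card (F k)))"
    using n \<theta> by (intro mult_left_mono) (auto simp: tile_counts_def)
  also have "(\<Sum>k<l. real (n k) * real (card (F k))) = (\<Sum>p\<in>I. real (card (F (fst p))))"
    using sum_over_centres[of V I 0 l n "\<lambda>k. real (card (F k))"] assms(1-3)
    by (simp add: atLeast0LessThan)
  also have "(1 - \<theta>) * (\<Sum>p\<in>I. real (card (F (fst p)))) \<le> (\<Sum>p\<in>I. real (card (S p)))"
    unfolding sum_distrib_left by (intro sum_mono large)
  also have "\<dots> = real (card (SIGMA p:I. S p))"
    using finI S by simp
  finally show ?thesis .
qed

lemma card_split_subset:
  assumes "finite B" "A \<subseteq> B"
  shows "card B = card A + card (B - A)"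
  using card_mono[OF assms] card_Diff_subset[OF finite_subset[OF assms(2,1)] assms(2)] by simp

lemma quasi_tilingD:
  assumes "quasi_tiling \<sigma> V F \<eta> I T" "I \<subseteq> {..<l} \<times> V" "p \<in> I"
  shows "fst p < l" "snd p \<in> V" "T p \<subseteq> F (fst p)"
    "(1 - \<eta>) * real (card (F (fst p))) \<le> real (card (T p))"
  using assms by (auto simp: quasi_tiling_def)

lemma card_uncovered_le:
  assumes V: "finite V" and IT: "quasi_tiling \<sigma> V F \<eta> I T" "I \<subseteq> {..<l} \<times> V"
      "\<And>k. k < l \<Longrightarrow> card {c. (k, c) \<in> I} = n k"
    and n: "tile_counts G \<eta> l F (real (card E)) n" and \<eta>: "0 \<le> \<eta>" "\<eta> \<le> 1"
    and F: "\<And>j. j < l \<Longrightarrow> finite (F j)" "\<And>j. j < l \<Longrightarrow> F j \<subseteq> K" and free: "acts_freely_at G \<sigma> K A V"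
    and E: "finite E" "\<And>s c. s \<in> K \<Longrightarrow> c \<in> V \<Longrightarrow> \<sigma> s c \<in> E"
  shows "real (card (E - (\<Union>p\<in>I. (\<lambda>s. \<sigma> s (snd p)) ` T p))) \<le> 5 * \<eta> * real (card E)"
proof -
  let ?e = "\<lambda>(p, s). \<sigma> s (snd p)" and ?Z = "SIGMA p:I. T p"
  note Ip = quasi_tilingD[OF IT(1,2)]
  have im: "(\<Union>p\<in>I. (\<lambda>s. \<sigma> s (snd p)) ` T p) = ?e ` ?Z" by force
  have sub: "?e ` ?Z \<subseteq> E"
  proof
    fix v assume "v \<in> ?e ` ?Z"
    then obtain p s where p: "p \<in> I" "s \<in> T p" "v = \<sigma> s (snd p)" by auto
    hence "s \<in> K" using Ip(1,3)[OF p(1)] F(2) by blast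
    thus "v \<in> E" using E(2) Ip(2)[OF p(1)] p(3) by blast
  qed
  have "finite (T p)" if "p \<in> I" for p
    using Ip(3)[OF that] F(1)[OF Ip(1)[OF that]] by (rule finite_subset)
  hence "(1 - \<eta> - 4 * \<eta>) * real (card E) \<le> real (card ?Z)"
    by (intro card_tiles_ge[OF V IT(2,3) n]) (use Ip \<eta> in auto)
  moreover have "card (?e ` ?Z) = card ?Z"
    by (rule card_image[OF quasi_tiling_inj_on[OF IT(1,2) F(2) free]])
  moreover have "card E = card (?e ` ?Z) + card (E - ?e ` ?Z)"
    by (rule card_split_subset[OF E(1) sub])
  ultimately show ?thesis unfolding im by (simp add: algebra_simps)
qed

lemma sofic_eventually_large:
  assumes "sofic_approximation G d \<sigma>"
  shows "eventually (\<lambda>i. N \<le> d i) sequentially"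
proof -
  have "filterlim d at_top sequentially" using assms by (simp add: sofic_approximation_def)
  thus ?thesis unfolding filterlim_at_top by blast
qed

section \<open>Sofic approximations and Folner sets\<close>

text \<open>
  Each pair of elements of \<open>K\<close> excludes two sets of points of small density.
\<close>

lemma sofic_eventually_free:
  assumes sofic: "sofic_approximation G d \<sigma>" and K: "K \<subseteq> carrier G" "finite K" and \<eta>: "0 < \<eta>"
  shows "eventually (\<lambda>i. \<exists>V. acts_freely_at G (\<sigma> i) K {1..d i} V \<and>
           (1 - \<eta>) * real (d i) \<le> real (card V)) sequentially"
proof -
  define b1 where "b1 = (\<lambda>i s t. {v \<in> {1..d i}. \<sigma> i s (\<sigma> i t v) \<noteq> \<sigma> i (s \<otimes>\<^bsub>G\<^esub> t) v})"
  define b2 where "b2 = (\<lambda>i s t. {v \<in> {1..d i}. s \<noteq> t \<and> \<sigma> i s v = \<sigma> i t v})"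
  define \<epsilon> where "\<epsilon> = \<eta> / (2 * real (card (K \<times> K)) + 1)"
  have \<epsilon>: "0 < \<epsilon>" "2 * real (card (K \<times> K)) * \<epsilon> \<le> \<eta>" using \<eta> by (auto simp: \<epsilon>_def field_simps)
  have perm: "\<sigma> i s permutes {1..d i}" if "s \<in> K" for i s
    using sofic that K unfolding sofic_approximation_def by blast
  have d: "eventually (\<lambda>i. 0 < d i) sequentially"
    using sofic_eventually_large[OF sofic, of 1] by eventually_elim simp
  have ev1: "eventually (\<lambda>i. real (card (b1 i s t)) \<le> \<epsilon> * real (d i)) sequentially"
    if st: "s \<in> K" "t \<in> K" for s t
  proof -
    have "(\<lambda>i. real (card {v \<in> {1..d i}. \<sigma> i s (\<sigma> i t v) = \<sigma> i (s \<otimes>\<^bsub>G\<^esub> t) v}) / real (d i))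
          \<longlonglongrightarrow> 1"
      using sofic st K unfolding sofic_approximation_def by blast
    hence "eventually (\<lambda>i. 1 - \<epsilon> < real (card {v \<in> {1..d i}. \<sigma> i s (\<sigma> i t v) = \<sigma> i (s \<otimes>\<^bsub>G\<^esub> t) v})
          / real (d i)) sequentially"
      by (rule order_tendstoD) (use \<epsilon> in simp)
    with d show ?thesis
    proof eventually_elim
      case (elim i)
      let ?A = "{v \<in> {1..d i}. \<sigma> i s (\<sigma> i t v) = \<sigma> i (s \<otimes>\<^bsub>G\<^esub> t) v}"
      have "b1 i s t = {1..d i} - ?A" unfolding b1_def by blast
      also have "card \<dots> = card {1..d i} - card ?A" by (rule card_Diff_subset) auto
      finally have "card (b1 i s t) = d i - card ?A" by simp
      moreover have "card ?A \<le> card {1..d i}" by (rule card_mono) auto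
      ultimately show ?case using elim by (simp add: field_simps of_nat_diff)
    qed
  qed
  have ev2: "eventually (\<lambda>i. real (card (b2 i s t)) \<le> \<epsilon> * real (d i)) sequentially"
    if st: "s \<in> K" "t \<in> K" for s t
  proof (cases "s = t")
    case True
    thus ?thesis using \<epsilon> by (simp add: b2_def)
  next
    case False
    hence "(\<lambda>i. real (card {v \<in> {1..d i}. \<sigma> i s v = \<sigma> i t v}) / real (d i)) \<longlonglongrightarrow> 0"
      using sofic st K unfolding sofic_approximation_def by blast
    hence "eventually (\<lambda>i. real (card {v \<in> {1..d i}. \<sigma> i s v = \<sigma> i t v}) / real (d i) < \<epsilon>) sequentially"
      by (rule order_tendstoD) (use \<epsilon> in simp)
    with d show ?thesis
      by eventually_elim (use False in \<open>simp add: b2_def field_simps\<close>)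
  qed
  have "eventually (\<lambda>i. \<forall>p\<in>K \<times> K. real (card (b1 i (fst p) (snd p))) \<le> \<epsilon> * real (d i) \<and>
      real (card (b2 i (fst p) (snd p))) \<le> \<epsilon> * real (d i)) sequentially"
  proof (rule eventually_ball_finite)
    show "finite (K \<times> K)" using K by simp
    show "\<forall>p\<in>K \<times> K. eventually (\<lambda>i. real (card (b1 i (fst p) (snd p))) \<le> \<epsilon> * real (d i) \<and>
      real (card (b2 i (fst p) (snd p))) \<le> \<epsilon> * real (d i)) sequentially"
      using ev1 ev2 by (auto intro!: eventually_conj)
  qed
  thus ?thesis
  proof eventually_elim
    case (elim i)
    define B where "B = (\<Union>p\<in>K \<times> K. b1 i (fst p) (snd p) \<union> b2 i (fst p) (snd p))"
    define V where "V = {1..d i} - B"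
    have finB: "finite B" unfolding B_def using K by (auto simp: b1_def b2_def)
    have "card B \<le> (\<Sum>p\<in>K \<times> K. card (b1 i (fst p) (snd p) \<union> b2 i (fst p) (snd p)))"
      unfolding B_def by (rule card_UN_le) (use K in simp)
    also have "\<dots> \<le> (\<Sum>p\<in>K \<times> K. card (b1 i (fst p) (snd p)) + card (b2 i (fst p) (snd p)))"
      by (intro sum_mono card_Un_le)
    finally have "real (card B)
        \<le> real (\<Sum>p\<in>K \<times> K. card (b1 i (fst p) (snd p)) + card (b2 i (fst p) (snd p)))"
      by (simp only: of_nat_le_iff)
    also have "\<dots> = (\<Sum>p\<in>K \<times> K. real (card (b1 i (fst p) (snd p))) + real (card (b2 i (fst p) (snd p))))"
      by simp
    also have "\<dots> \<le> (\<Sum>p\<in>K \<times> K. \<epsilon> * real (d i) + \<epsilon> * real (d i))"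
      by (intro sum_mono add_mono) (use elim in auto)
    also have "\<dots> = (2 * real (card (K \<times> K)) * \<epsilon>) * real (d i)" by simp
    also have "\<dots> \<le> \<eta> * real (d i)" by (intro mult_right_mono \<epsilon>) simp
    finally have cardB: "real (card B) \<le> \<eta> * real (d i)" .
    have "card {1..d i} - card B \<le> card V" unfolding V_def by (rule diff_card_le_card_Diff[OF finB])
    hence "real (d i) \<le> real (card V) + real (card B)" by simp
    hence 1: "(1 - \<eta>) * real (d i) \<le> real (card V)" using cardB by (simp add: algebra_simps)
    have inj: "inj_on (\<sigma> i s) {1..d i}" if "s \<in> K" for s
      using permutes_inj[OF perm[OF that]] by (rule inj_on_subset) simp
    have image: "\<sigma> i s v \<in> {1..d i}" if "s \<in> K" "v \<in> {1..d i}" for s v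
      using permutes_in_image[OF perm[OF that(1)]] that(2) by blast
    have sep: "\<sigma> i s v \<noteq> \<sigma> i t v" if "v \<in> V" "s \<in> K" "t \<in> K" "s \<noteq> t" for s t v
    proof
      assume "\<sigma> i s v = \<sigma> i t v"
      hence "v \<in> b2 i s t" using that by (simp add: b2_def V_def)
      hence "v \<in> B" unfolding B_def using that by force
      thus False using that by (simp add: V_def)
    qed
    have mult: "\<sigma> i s (\<sigma> i t v) = \<sigma> i (s \<otimes>\<^bsub>G\<^esub> t) v" if "v \<in> V" "s \<in> K" "t \<in> K" for s t v
    proof (rule ccontr)
      assume "\<not> ?thesis"
      hence "v \<in> b1 i s t" using that by (simp add: b1_def V_def)
      hence "v \<in> B" unfolding B_def using that by force
      thus False using that by (simp add: V_def)
    qed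
    have V: "V \<subseteq> {1..d i}" by (auto simp: V_def)
    have "acts_freely_at G (\<sigma> i) K {1..d i} V"
      unfolding acts_freely_at_def
    proof (intro conjI ballI V inj)
      fix v assume v: "v \<in> V"
      show "inj_on (\<lambda>s. \<sigma> i s v) K" using sep[OF v] by (meson inj_onI)
      fix t assume t: "t \<in> K"
      show "\<sigma> i t v \<in> {1..d i}" using image t v V by blast
      fix s assume "s \<in> K"
      thus "\<sigma> i s (\<sigma> i t v) = \<sigma> i (s \<otimes>\<^bsub>G\<^esub> t) v" using mult v t by blast
    qed
    with 1 show ?case by blast
  qed
qed

lemma (in group) translation_acts_freely:
  assumes "K \<subseteq> carrier G" "E \<subseteq> carrier G"
  shows "acts_freely_at G (\<lambda>s v. s \<otimes> v) K (carrier G) {v \<in> E. \<forall>s\<in>K. s \<otimes> v \<in> E}"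
  unfolding acts_freely_at_def
proof (intro conjI ballI)
  fix s assume s: "s \<in> K"
  show "inj_on (\<lambda>v. s \<otimes> v) (carrier G)" using s assms by (intro inj_onI) auto
next
  fix v assume v: "v \<in> {v \<in> E. \<forall>s\<in>K. s \<otimes> v \<in> E}"
  show "inj_on (\<lambda>s. s \<otimes> v) K" using v assms by (intro inj_onI) (metis (no_types, lifting) mem_Collect_eq right_cancel subsetD)
  fix t assume t: "t \<in> K"
  show "t \<otimes> v \<in> carrier G" using t v assms by blast
  fix s assume s: "s \<in> K"
  show "s \<otimes> (t \<otimes> v) = s \<otimes> t \<otimes> v" using s t v assms by (subst m_assoc) auto
qed (use assms in auto)

text \<open>
  Pair the tiles of \<open>{1..D}\<close> with the tiles of \<open>E\<close> of the same shape, keep the common part \<open>S p\<close> of the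
  two kept parts, and let \<open>\<tau>\<close> send the point at position \<open>s\<close> of a tile to the element at position
  \<open>s\<close> of its partner. Equivariance under \<open>g\<close> can fail only off the kept parts and at
  positions \<open>s\<close> for which \<open>gs\<close> is not kept. Off the kept parts \<open>\<tau>\<close> is set to the unit element.
\<close>

lemma (in group) tilings_match:
  fixes \<sigma> :: "'a \<Rightarrow> nat \<Rightarrow> nat"
  assumes F: "\<And>j. j < l \<Longrightarrow> F j \<in> finite_subsets G"
    and FK: "\<And>j. j < l \<Longrightarrow> F j \<subseteq> K" and K: "K \<subseteq> carrier G" and gsK: "gs \<subseteq> K"
    and gsF: "\<And>j. j < l \<Longrightarrow> almost_invariant G gs \<eta> (F j)"
    and n: "tile_counts G \<eta> l F (real (card E)) n" and \<eta>: "0 < \<eta>" "\<eta> \<le> 1 / 2"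
    and V: "finite V" and freeV: "acts_freely_at G \<sigma> K {1..D} V"
    and tV: "quasi_tiling \<sigma> V F \<eta> I T" "I \<subseteq> {..<l} \<times> V" "\<And>k. k < l \<Longrightarrow> card {c. (k, c) \<in> I} = n k"
    and E: "E \<in> finite_subsets G" and E': "E' = {v \<in> E. \<forall>s\<in>K. s \<otimes> v \<in> E}"
    and tE: "quasi_tiling (\<lambda>s v. s \<otimes> v) E' F \<eta> J U" "J \<subseteq> {..<l} \<times> E'" "\<And>k. k < l \<Longrightarrow> card {c. (k, c) \<in> J} = n k"
  shows "\<exists>\<tau>. (\<forall>a. \<tau> a \<in> carrier G) \<and>
    real (card (E - \<tau> ` {1..D})) \<le> 6 * \<eta> * real (card E) \<and>
    (\<forall>g\<in>gs. real (card {a \<in> {1..D}. \<tau> (\<sigma> g a) \<noteq> g \<otimes> \<tau> a})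
        \<le> real D - (1 - 9 * \<eta>) * real (card E))"
proof -
  have EF: "E \<subseteq> carrier G" "finite E" using finite_subsetsD[OF E] by auto
  have Fin: "finite (F j)" "F j \<subseteq> carrier G" if "j < l" for j
    using finite_subsetsD[OF F[OF that]] by auto
  have finE': "finite E'" "E' \<subseteq> E" using EF by (auto simp: E')
  have freeE: "acts_freely_at G (\<lambda>s v. s \<otimes> v) K (carrier G) E'"
    unfolding E' by (rule translation_acts_freely[OF K EF(1)])
  \<comment> \<open>Tiles of equal shape are paired off, which is possible as their numbers agree.\<close>
  have "\<exists>h. bij_betw h {c. (k, c) \<in> I} {c. (k, c) \<in> J}" if "k < l" for k
  proof (rule finite_same_card_bij)
    show "finite {c. (k, c) \<in> I}" by (rule finite_subset[OF _ V]) (use tV(2) in auto)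
    show "finite {c. (k, c) \<in> J}" by (rule finite_subset[OF _ finE'(1)]) (use tE(2) in auto)
  qed (use tV(3) tE(3) that in simp)
  then obtain h where h: "\<And>k. k < l \<Longrightarrow> bij_betw (h k) {c. (k, c) \<in> I} {c. (k, c) \<in> J}" by metis
  define b where "b = (\<lambda>p. (fst p, h (fst p) (snd p)))"
  have b_mem: "b p \<in> J" if "p \<in> I" for p
  proof -
    have "fst p < l" "snd p \<in> {c. (fst p, c) \<in> I}" using that tV(2) by auto
    from bij_betwE[OF h[OF this(1)]] this(2) show ?thesis by (auto simp: b_def)
  qed
  have b_inj: "p = q" if "p \<in> I" "q \<in> I" "b p = b q" for p q
  proof -
    have *: "fst p < l" "snd p \<in> {c. (fst p, c) \<in> I}" "snd q \<in> {c. (fst p, c) \<in> I}"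
      using that tV(2) by (auto simp: b_def)
    have "h (fst p) (snd p) = h (fst p) (snd q)" using that by (auto simp: b_def)
    hence "snd p = snd q" using bij_betw_imp_inj_on[OF h[OF *(1)]] * by (meson inj_onD)
    thus ?thesis using that by (simp add: b_def prod_eq_iff)
  qed
  define S where "S = (\<lambda>p. T p \<inter> U (b p))"
  have Tp: "T p \<subseteq> F (fst p)" "U (b p) \<subseteq> F (fst p)" "fst p < l" "snd p \<in> V" "snd (b p) \<in> E'"
      "(1 - \<eta>) * real (card (F (fst p))) \<le> real (card (T p))"
      "(1 - \<eta>) * real (card (F (fst p))) \<le> real (card (U (b p)))"
    if "p \<in> I" for p
  proof -
    show "T p \<subseteq> F (fst p)" "snd p \<in> V" "(1 - \<eta>) * real (card (F (fst p))) \<le> real (card (T p))"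
      using tV that by (simp_all add: quasi_tiling_def)
    have "fst (b p) = fst p" by (simp add: b_def)
    thus "U (b p) \<subseteq> F (fst p)" "snd (b p) \<in> E'" "(1 - \<eta>) * real (card (F (fst p))) \<le> real (card (U (b p)))"
      using tE(1) b_mem[OF that] unfolding quasi_tiling_def by metis+
    show "fst p < l" using tV(2) that by auto
  qed
  have FT: "real (card (F (fst p) - T p)) \<le> \<eta> * real (card (F (fst p)))"
    and FU: "real (card (F (fst p) - U (b p))) \<le> \<eta> * real (card (F (fst p)))" if "p \<in> I" for p
  proof -
    have "card (F (fst p)) = card (T p) + card (F (fst p) - T p)"
      "card (F (fst p)) = card (U (b p)) + card (F (fst p) - U (b p))"
      using Tp(1,2)[OF that] Fin(1)[OF Tp(3)[OF that]] by (intro card_split_subset; simp)+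
    thus "real (card (F (fst p) - T p)) \<le> \<eta> * real (card (F (fst p)))"
      "real (card (F (fst p) - U (b p))) \<le> \<eta> * real (card (F (fst p)))"
      using Tp(6,7)[OF that] by (simp_all add: algebra_simps)
  qed
  have finS: "finite (S p)" "S p \<subseteq> F (fst p)" if "p \<in> I" for p
    using Tp[OF that] Fin(1)[OF Tp(3)[OF that]] by (auto simp: S_def intro: finite_subset)
  define e :: "(nat \<times> nat) \<times> 'a \<Rightarrow> nat" where "e = (\<lambda>(p, s). \<sigma> s (snd p))"
  define e' :: "(nat \<times> nat) \<times> 'a \<Rightarrow> 'a" where "e' = (\<lambda>(p, s). s \<otimes> snd (b p))"
  define Z where "Z = (SIGMA p:I. S p)"
  have finZ: "finite Z"
  proof -
    have "finite I" using V tV(2) by (meson finite_SigmaI finite_lessThan finite_subset)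
    thus ?thesis unfolding Z_def using finS(1) by (rule finite_SigmaI)
  qed
  have e_inj: "inj_on e Z"
    unfolding e_def Z_def
    by (rule inj_on_subset[OF quasi_tiling_inj_on[OF tV(1,2) FK freeV]]) (auto simp: S_def)
  have e'_inj: "inj_on e' Z"
  proof (rule inj_onI)
    fix z z' assume z: "z \<in> Z" "z' \<in> Z" "e' z = e' z'"
    obtain p s p' s' where [simp]: "z = (p, s)" "z' = (p', s')" by (cases z, cases z') auto
    have ps: "p \<in> I" "s \<in> U (b p)" "p' \<in> I" "s' \<in> U (b p')" using z by (auto simp: Z_def S_def)
    have inj: "inj_on (\<lambda>(p, s). s \<otimes> snd p) (SIGMA p:J. U p)"
      by (rule quasi_tiling_inj_on[OF tE(1,2) FK freeE])
    have "(b p, s) = (b p', s')"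
    proof (rule inj_onD[OF inj])
      show "(case (b p, s) of (p, s) \<Rightarrow> s \<otimes> snd p) = (case (b p', s') of (p, s) \<Rightarrow> s \<otimes> snd p)"
        using z by (simp add: e'_def)
    qed (use ps b_mem in auto)
    thus "z = z'" using b_inj[of p p'] ps by simp
  qed
  have e_mem: "e z \<in> {1..D}" if "z \<in> Z" for z
  proof -
    obtain p s where [simp]: "z = (p, s)" by (cases z)
    have p: "p \<in> I" "s \<in> S p" using that by (auto simp: Z_def)
    have "s \<in> K" using finS(2)[OF p(1)] FK[OF Tp(3)[OF p(1)]] p(2) by blast
    thus ?thesis using freeV Tp(4)[OF p(1)] unfolding e_def acts_freely_at_def by auto
  qed
  have e'_mem: "e' z \<in> E" if "z \<in> Z" for z
  proof -
    obtain p s where [simp]: "z = (p, s)" by (cases z)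
    have p: "p \<in> I" "s \<in> S p" using that by (auto simp: Z_def)
    have "s \<in> K" using finS(2)[OF p(1)] FK[OF Tp(3)[OF p(1)]] p(2) by blast
    thus ?thesis using Tp(5)[OF p(1)] unfolding e'_def E' by auto
  qed
  define \<tau> where "\<tau> = (\<lambda>a. if a \<in> e ` Z then e' (inv_into Z e a) else \<one>)"
  have \<tau>_e: "\<tau> (e z) = e' z" if "z \<in> Z" for z
    using that e_inj by (simp add: \<tau>_def inv_into_f_f)
  have \<tau>_carrier: "\<tau> a \<in> carrier G" for a
  proof (cases "a \<in> e ` Z")
    case True
    then obtain z where "z \<in> Z" "a = e z" by blast
    thus ?thesis using \<tau>_e[of z] e'_mem[of z] EF by auto
  qed (simp add: \<tau>_def)
  have tiles: "(1 - \<theta> - 4 * \<eta>) * real (card E) \<le> real (card (SIGMA p:I. R p))"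
    if "\<And>p. p \<in> I \<Longrightarrow> R p \<subseteq> F (fst p)" "\<And>p. p \<in> I \<Longrightarrow> real (card (F (fst p) - R p)) \<le> \<theta> * real (card (F (fst p)))"
      "0 \<le> \<theta>" "\<theta> \<le> 1" for R \<theta>
  proof (rule card_tiles_ge[OF V tV(2,3) n])
    fix p assume p: "p \<in> I"
    show fR: "finite (R p)" using that(1)[OF p] Fin(1)[OF Tp(3)[OF p]] by (rule finite_subset)
    have "card (F (fst p)) = card (R p) + card (F (fst p) - R p)"
      using that(1)[OF p] Fin(1)[OF Tp(3)[OF p]] by (rule card_split_subset[rotated])
    thus "(1 - \<theta>) * real (card (F (fst p))) \<le> real (card (R p))"
      using that(2)[OF p] by (simp add: algebra_simps)
  qed (use that \<eta> in auto)
  have missing_S: "real (card (F (fst p) - S p)) \<le> 2 * \<eta> * real (card (F (fst p)))" if p: "p \<in> I" for p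
  proof -
    have "F (fst p) - S p = (F (fst p) - T p) \<union> (F (fst p) - U (b p))" by (auto simp: S_def)
    hence "card (F (fst p) - S p) \<le> card (F (fst p) - T p) + card (F (fst p) - U (b p))"
      by (simp add: card_Un_le)
    thus ?thesis using FT[OF p] FU[OF p] by linarith
  qed
  show ?thesis
  proof (intro exI[of _ \<tau>] conjI allI ballI)
    fix a show "\<tau> a \<in> carrier G" by (rule \<tau>_carrier)
  next
    have cardZ: "(1 - 2 * \<eta> - 4 * \<eta>) * real (card E) \<le> real (card Z)"
      unfolding Z_def by (rule tiles) (use finS(2) missing_S \<eta> in auto)
    have "e' ` Z \<subseteq> \<tau> ` {1..D}"
    proof
      fix y assume "y \<in> e' ` Z"
      then obtain z where "z \<in> Z" "y = e' z" by blast
      thus "y \<in> \<tau> ` {1..D}" using \<tau>_e[of z] e_mem[of z] by (metis image_eqI)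
    qed
    hence "E - \<tau> ` {1..D} \<subseteq> E - e' ` Z" by blast
    hence "card (E - \<tau> ` {1..D}) \<le> card (E - e' ` Z)" by (rule card_mono[rotated]) (use EF in simp)
    also have "card (E - e' ` Z) = card E - card Z"
      using e'_mem finZ e'_inj by (subst card_Diff_subset) (auto simp: card_image)
    finally have "card (E - \<tau> ` {1..D}) \<le> card E - card Z" .
    moreover have "card Z \<le> card E"
      by (rule card_inj_on_le[OF e'_inj]) (use e'_mem EF in auto)
    ultimately have "real (card (E - \<tau> ` {1..D})) \<le> real (card E) - real (card Z)" by linarith
    thus "real (card (E - \<tau> ` {1..D})) \<le> 6 * \<eta> * real (card E)" using cardZ by (simp add: algebra_simps)
  next
    fix g assume g: "g \<in> gs"
    define R where "R = (\<lambda>p. {s \<in> S p. g \<otimes> s \<in> S p})"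
    have gK: "g \<in> K" "g \<in> carrier G" using g gsK K by auto
    have missing_R: "real (card (F (fst p) - R p)) \<le> 5 * \<eta> * real (card (F (fst p)))" if p: "p \<in> I" for p
    proof -
      let ?F = "F (fst p)"
      have Fp: "finite ?F" "?F \<subseteq> carrier G" using Fin[OF Tp(3)[OF p]] by auto
      have "?F - R p \<subseteq> (?F - S p) \<union> {s \<in> ?F. g \<otimes> s \<notin> ?F} \<union> {s \<in> ?F. g \<otimes> s \<in> ?F - S p}"
        by (auto simp: R_def)
      hence "card (?F - R p) \<le> card ((?F - S p) \<union> {s \<in> ?F. g \<otimes> s \<notin> ?F} \<union> {s \<in> ?F. g \<otimes> s \<in> ?F - S p})"
        by (rule card_mono[rotated]) (use Fp in auto)
      also have "\<dots> \<le> card (?F - S p) + card {s \<in> ?F. g \<otimes> s \<notin> ?F} + card {s \<in> ?F. g \<otimes> s \<in> ?F - S p}"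
        by (meson add_right_mono card_Un_le order_trans)
      also have "card {s \<in> ?F. g \<otimes> s \<in> ?F - S p} \<le> card (?F - S p)"
      proof (rule card_inj_on_le)
        have "inj_on (\<lambda>s. g \<otimes> s) (carrier G)" using gK by (intro inj_onI) auto
        thus "inj_on (\<lambda>s. g \<otimes> s) {s \<in> ?F. g \<otimes> s \<in> ?F - S p}"
          by (rule inj_on_subset) (use Fp in auto)
      qed (use Fp in auto)
      finally have "real (card (?F - R p)) \<le> real (card (?F - S p) + card {s \<in> ?F. g \<otimes> s \<notin> ?F} + card (?F - S p))"
        by linarith
      moreover have "real (card {s \<in> ?F. g \<otimes> s \<notin> ?F}) \<le> \<eta> * real (card ?F)"
        using gsF[OF Tp(3)[OF p]] g by (simp add: almost_invariant_def)
      ultimately show ?thesis using missing_S[OF p] by simp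
    qed
    have cardR: "(1 - 9 * \<eta>) * real (card E) \<le> real (card (SIGMA p:I. R p))"
    proof (cases "5 * \<eta> \<le> 1")
      case True
      have "(1 - 5 * \<eta> - 4 * \<eta>) * real (card E) \<le> real (card (SIGMA p:I. R p))"
        by (rule tiles) (use finS(2) missing_R True \<eta> in \<open>auto simp: R_def\<close>)
      thus ?thesis by simp
    next
      case False
      hence "(1 - 9 * \<eta>) * real (card E) \<le> 0" by (intro mult_nonpos_nonneg) auto
      thus ?thesis by linarith
    qed
    have sub: "(SIGMA p:I. R p) \<subseteq> Z" by (auto simp: Z_def R_def)
    have good: "\<tau> (\<sigma> g (e z)) = g \<otimes> \<tau> (e z)" if "z \<in> (SIGMA p:I. R p)" for z
    proof -
      obtain p s where z: "z = (p, s)" by (cases z)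
      have p: "p \<in> I" "s \<in> S p" "g \<otimes> s \<in> S p" using that by (auto simp: z R_def)
      have "s \<in> F (fst p)" using finS(2)[OF p(1)] p(2) by blast
      hence sK: "s \<in> K" "s \<in> carrier G" using FK[OF Tp(3)[OF p(1)]] K by auto
      have "\<sigma> g (e z) = \<sigma> (g \<otimes> s) (snd p)"
        using freeV Tp(4)[OF p(1)] sK(1) gK(1) unfolding acts_freely_at_def z e_def by simp
      also have "\<dots> = e (p, g \<otimes> s)" by (simp add: e_def)
      finally have "\<tau> (\<sigma> g (e z)) = g \<otimes> s \<otimes> snd (b p)"
        using \<tau>_e[of "(p, g \<otimes> s)"] p by (simp add: Z_def e'_def)
      also have "\<dots> = g \<otimes> (s \<otimes> snd (b p))"
        using gK sK Tp(5)[OF p(1)] finE'(2) EF(1) by (intro m_assoc) auto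
      also have "s \<otimes> snd (b p) = \<tau> (e z)" using \<tau>_e[of z] p by (simp add: Z_def e'_def z)
      finally show ?thesis .
    qed
    have finR: "finite (SIGMA p:I. R p)" using sub finZ by (rule finite_subset)
    have cardeR: "card (e ` (SIGMA p:I. R p)) = card (SIGMA p:I. R p)"
      by (rule card_image[OF inj_on_subset[OF e_inj sub]])
    have eR: "e ` (SIGMA p:I. R p) \<subseteq> {1..D}" using e_mem sub by blast
    have "{a \<in> {1..D}. \<tau> (\<sigma> g a) \<noteq> g \<otimes> \<tau> a} \<subseteq> {1..D} - e ` (SIGMA p:I. R p)" using good by blast
    hence "card {a \<in> {1..D}. \<tau> (\<sigma> g a) \<noteq> g \<otimes> \<tau> a} \<le> card ({1..D} - e ` (SIGMA p:I. R p))"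
      by (rule card_mono[rotated]) simp
    also have "\<dots> = card {1..D} - card (e ` (SIGMA p:I. R p))"
      by (rule card_Diff_subset[OF _ eR]) (use finR in simp)
    finally have "card {a \<in> {1..D}. \<tau> (\<sigma> g a) \<noteq> g \<otimes> \<tau> a} \<le> D - card (SIGMA p:I. R p)"
      using cardeR by simp
    moreover have "card (SIGMA p:I. R p) \<le> D" using card_mono[OF _ eR] cardeR by simp
    ultimately have "real (card {a \<in> {1..D}. \<tau> (\<sigma> g a) \<noteq> g \<otimes> \<tau> a}) \<le> real D - real (card (SIGMA p:I. R p))"
      by linarith
    thus "real (card {a \<in> {1..D}. \<tau> (\<sigma> g a) \<noteq> g \<otimes> \<tau> a}) \<le> real D - (1 - 9 * \<eta>) * real (card E)"
      using cardR by linarith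
  qed
qed

text \<open>
  Up to proportion \<open>\<epsilon>\<close>, the map \<open>\<tau>\<close> carries \<open>{1..D}\<close> onto \<open>E\<close> and turns \<open>\<sigma> g\<close> into the left
  translation by \<open>g\<close>.
\<close>

definition models_subset ::
    "('g, 'm) monoid_scheme \<Rightarrow> 'g set \<Rightarrow> real \<Rightarrow> nat \<Rightarrow> ('g \<Rightarrow> nat \<Rightarrow> nat) \<Rightarrow> 'g set \<Rightarrow> (nat \<Rightarrow> 'g) \<Rightarrow> bool"
  where
  "models_subset G gs \<epsilon> D \<sigma> E \<tau> \<longleftrightarrow> (\<forall>a. \<tau> a \<in> carrier G) \<and>
     (1 - \<epsilon>) * real D \<le> real (card E) \<and> real (card (E - \<tau> ` {1..D})) \<le> \<epsilon> * real D \<and>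
     (\<forall>g\<in>gs. real (card {a \<in> {1..D}. \<tau> (\<sigma> g a) \<noteq> g \<otimes>\<^bsub>G\<^esub> \<tau> a}) \<le> \<epsilon> * real D)"

text \<open>
  The set \<open>E\<close> has at most \<open>d i\<close> elements, so the tile counts for the size of \<open>E\<close> also fit into the good
  points of \<open>{1..d i}\<close>, and it has almost \<open>d i\<close> elements, so these tiles cover most of \<open>{1..d i}\<close>.
\<close>

lemma (in group) sofic_models_folner_set:
  assumes amen: "amenable G" and inf: "infinite (carrier G)" and sofic: "sofic_approximation G d \<sigma>"
    and gs: "gs \<subseteq> carrier G" "finite gs" and \<epsilon>: "0 < \<epsilon>" and P: "eventually P (invariance_filter G)"
  shows "eventually (\<lambda>i. \<exists>E \<tau>. P E \<and> E \<in> finite_subsets G \<and> models_subset G gs \<epsilon> (d i) (\<sigma> i) E \<tau>) sequentially"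
proof -
  define \<eta> where "\<eta> = min (1 / 2) (\<epsilon> / 10)"
  have \<eta>: "0 < \<eta>" "\<eta> \<le> 1 / 2" "10 * \<eta> \<le> \<epsilon>" using \<epsilon> by (auto simp: \<eta>_def min_def)
  have nb: "invariance_filter G \<noteq> bot" by (rule amenable_imp_invariance_filter_nontrivial[OF amen])
  have "frequently (almost_invariant G gs \<eta>) (invariance_filter G)"
    by (rule eventually_frequently[OF nb eventually_almost_invariant[OF gs \<eta>(1)]])
  then obtain l F K\<^sub>0 N\<^sub>0 where F: "\<And>j. j < l \<Longrightarrow> F j \<in> finite_subsets G"
    and Finv: "\<And>j. j < l \<Longrightarrow> almost_invariant G gs \<eta> (F j)"
    and K\<^sub>0: "K\<^sub>0 \<subseteq> carrier G" "finite K\<^sub>0" "\<And>j. j < l \<Longrightarrow> F j \<subseteq> K\<^sub>0"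
      "\<And>i j. i < l \<Longrightarrow> j < l \<Longrightarrow> (m_inv G ` F i) <#> F j \<subseteq> K\<^sub>0"
    and counts: "\<And>N. N\<^sub>0 \<le> N \<Longrightarrow> \<exists>n. tile_counts G \<eta> l F (real N) n"
    using tile_system_exists[OF _ \<eta>(1,2)] by metis
  define K where "K = K\<^sub>0 \<union> gs"
  have K: "K \<subseteq> carrier G" "finite K" "gs \<subseteq> K" using K\<^sub>0 gs by (auto simp: K_def)
  have FK: "F j \<subseteq> K" if "j < l" for j using K\<^sub>0(3)[OF that] by (auto simp: K_def)
  have invFK: "(m_inv G ` F i) <#> F j \<subseteq> K" if "i < l" "j < l" for i j
    using K\<^sub>0(4)[OF that] by (auto simp: K_def)
  define Q where "Q = (\<lambda>E. P E \<and> N\<^sub>0 \<le> card E \<and>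
      (1 - \<eta>) * real (card E) \<le> real (card {v \<in> E. \<forall>s\<in>K. s \<otimes> v \<in> E}))"
  have "eventually Q (invariance_filter G)"
    unfolding Q_def
    by (intro eventually_conj P eventually_card_ge[OF inf] eventually_card_core_ge[OF K(1,2) \<eta>(1)])
  then obtain K\<^sub>1 \<epsilon>\<^sub>1 where K\<^sub>1: "K\<^sub>1 \<subseteq> carrier G" "finite K\<^sub>1" "0 < \<epsilon>\<^sub>1"
    and Q: "\<And>E. almost_invariant G K\<^sub>1 \<epsilon>\<^sub>1 E \<Longrightarrow> Q E"
    unfolding eventually_invariance_filter by blast
  obtain E\<^sub>0 where E\<^sub>0: "almost_invariant G K\<^sub>1 \<epsilon>\<^sub>1 E\<^sub>0"
    using eventually_happens'[OF nb eventually_almost_invariant[OF K\<^sub>1]] by blast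
  define u where "u = card E\<^sub>0"
  have u: "0 < u" using E\<^sub>0 finite_subsetsD(4) unfolding u_def almost_invariant_def by blast
  obtain M :: nat where M: "real u / \<eta> \<le> real M" using real_arch_simple by blast
  have big: "eventually (\<lambda>i. max u M \<le> d i) sequentially" by (rule sofic_eventually_large[OF sofic])
  show ?thesis
    using big sofic_eventually_free[OF sofic K(1,2) \<eta>(1)]
  proof eventually_elim
    case (elim i)
    \<comment> \<open>Disjoint translates of one invariant set realise any size up to an additive constant.\<close>
    define m where "m = d i div u - 1"
    have "0 < d i div u" using elim(1) u by (simp add: div_greater_zero_iff)
    hence m: "Suc m = d i div u" by (simp add: m_def)
    obtain E where E: "almost_invariant G K\<^sub>1 \<epsilon>\<^sub>1 E" "card E = Suc m * u"
      using almost_invariant_copies[OF inf E\<^sub>0 K\<^sub>1(1)] unfolding u_def by blast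
    have EfF: "E \<in> finite_subsets G" using E(1) by (simp add: almost_invariant_def)
    have le: "card E \<le> d i" using E(2) m by simp
    have "d i < card E + u" using E(2) m u by (metis dividend_less_div_times add.commute)
    hence "real (d i) \<le> real (card E) + real u" by simp
    moreover have "real u \<le> \<eta> * real (d i)"
    proof -
      have "real u / \<eta> \<le> real (d i)" using M elim(1) by (meson le_trans max.cobounded2 of_nat_mono order_trans)
      thus ?thesis using \<eta> by (simp add: field_simps)
    qed
    ultimately have ge: "(1 - \<eta>) * real (d i) \<le> real (card E)" by (simp add: algebra_simps)
    have QE: "P E" "N\<^sub>0 \<le> card E" "(1 - \<eta>) * real (card E) \<le> real (card {v \<in> E. \<forall>s\<in>K. s \<otimes> v \<in> E})"
      using Q[OF E(1)] by (auto simp: Q_def)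
    obtain n where n: "tile_counts G \<eta> l F (real (card E)) n" using counts[OF QE(2)] by blast
    obtain V where V: "acts_freely_at G (\<sigma> i) K {1..d i} V" "(1 - \<eta>) * real (d i) \<le> real (card V)"
      using elim(2) by blast
    have Vs: "V \<subseteq> {1..d i}" using V(1) by (simp add: acts_freely_at_def)
    hence finV: "finite V" by (rule finite_subset) simp
    have "(1 - \<eta>) * real (card E) \<le> (1 - \<eta>) * real (d i)" using le \<eta> by (intro mult_left_mono) auto
    hence cardV: "(1 - \<eta>) * real (card E) \<le> real (card V)" using V(2) by linarith
    obtain I T where tV: "quasi_tiling (\<sigma> i) V F \<eta> I T" "I \<subseteq> {..<l} \<times> V"
        "\<And>k. k < l \<Longrightarrow> card {c. (k, c) \<in> I} = n k"
      using quasi_tiling_of_size[OF F FK invFK n \<eta>(1,2) finV V(1) cardV] by blast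
    define E' where "E' = {v \<in> E. \<forall>s\<in>K. s \<otimes> v \<in> E}"
    have E': "finite E'" "(1 - \<eta>) * real (card E) \<le> real (card E')"
      using finite_subsetsD[OF EfF] QE(3) by (auto simp: E'_def)
    have freeE: "acts_freely_at G (\<lambda>s v. s \<otimes> v) K (carrier G) E'"
      unfolding E'_def by (rule translation_acts_freely[OF K(1) finite_subsetsD(1)[OF EfF]])
    obtain J U where tE: "quasi_tiling (\<lambda>s v. s \<otimes> v) E' F \<eta> J U" "J \<subseteq> {..<l} \<times> E'"
        "\<And>k. k < l \<Longrightarrow> card {c. (k, c) \<in> J} = n k"
      using quasi_tiling_of_size[OF F FK invFK n \<eta>(1,2) E'(1) freeE E'(2)] by blast
    have "\<exists>\<tau>. (\<forall>a. \<tau> a \<in> carrier G) \<and>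
        real (card (E - \<tau> ` {1..d i})) \<le> 6 * \<eta> * real (card E) \<and>
        (\<forall>g\<in>gs. real (card {a \<in> {1..d i}. \<tau> (\<sigma> i g a) \<noteq> g \<otimes> \<tau> a})
          \<le> real (d i) - (1 - 9 * \<eta>) * real (card E))"
      by (rule tilings_match[OF F FK K(1,3) Finv n \<eta>(1,2) finV V(1) tV EfF E'_def tE])
    then obtain \<tau> where \<tau>: "\<forall>a. \<tau> a \<in> carrier G"
      "real (card (E - \<tau> ` {1..d i})) \<le> 6 * \<eta> * real (card E)"
      "\<forall>g\<in>gs. real (card {a \<in> {1..d i}. \<tau> (\<sigma> i g a) \<noteq> g \<otimes> \<tau> a})
        \<le> real (d i) - (1 - 9 * \<eta>) * real (card E)"
      by (elim exE conjE)
    have "models_subset G gs \<epsilon> (d i) (\<sigma> i) E \<tau>"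
      unfolding models_subset_def
    proof (intro conjI ballI \<tau>(1))
      have "\<eta> * real (d i) \<le> \<epsilon> * real (d i)" using \<eta> by (intro mult_right_mono) auto
      thus "(1 - \<epsilon>) * real (d i) \<le> real (card E)" using ge by (simp add: algebra_simps)
      have "6 * \<eta> * real (card E) \<le> \<epsilon> * real (d i)" using \<eta> le by (intro mult_mono) auto
      thus "real (card (E - \<tau> ` {1..d i})) \<le> \<epsilon> * real (d i)" using \<tau>(2) by linarith
      fix g assume "g \<in> gs"
      note bspec[OF \<tau>(3) this]
      also have "real (d i) - (1 - 9 * \<eta>) * real (card E) \<le> 10 * \<eta> * real (d i)"
      proof -
        have "9 * \<eta> * real (card E) \<le> 9 * \<eta> * real (d i)" using \<eta> le by (intro mult_left_mono) auto
        thus ?thesis using ge by (simp add: algebra_simps)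
      qed
      also have "\<dots> \<le> \<epsilon> * real (d i)" using \<eta> by (intro mult_right_mono) auto
      finally show "real (card {a \<in> {1..d i}. \<tau> (\<sigma> i g a) \<noteq> g \<otimes> \<tau> a}) \<le> \<epsilon> * real (d i)" .
    qed
    thus ?case using QE(1) EfF by blast
  qed
qed

section \<open>Factors of systems and the limit along invariant sets\<close>

lemma ereal_div_less_iff:
  assumes "0 < (n :: real)"
  shows "z / ereal n < ereal t \<longleftrightarrow> z < ereal (t * n)" "z / ereal n \<le> ereal t \<longleftrightarrow> z \<le> ereal (t * n)"
    "ereal t \<le> z / ereal n \<longleftrightarrow> ereal (t * n) \<le> z" "ereal t < z / ereal n \<longleftrightarrow> ereal (t * n) < z"
  using assms by (cases z; simp add: field_simps)+

lemma openin_finite_ball: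
  assumes "finite S" and "\<And>s. s \<in> S \<Longrightarrow> openin T {x \<in> topspace T. P s x}"
  shows "openin T {x \<in> topspace T. \<forall>s\<in>S. P s x}"
  using assms
proof (induction S)
  case (insert a S)
  have "{x \<in> topspace T. \<forall>s\<in>insert a S. P s x}
      = {x \<in> topspace T. P a x} \<inter> {x \<in> topspace T. \<forall>s\<in>S. P s x}" by auto
  thus ?case using insert by auto
qed auto

lemma openin_bex:
  assumes "\<And>s. s \<in> S \<Longrightarrow> openin T {x \<in> topspace T. P s x}"
  shows "openin T {x \<in> topspace T. \<exists>s\<in>S. P s x}"
proof -
  have "{x \<in> topspace T. \<exists>s\<in>S. P s x} = (\<Union>s\<in>S. {x \<in> topspace T. P s x})" by auto
  thus ?thesis using assms by auto
qed

text \<open>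
  The empty space is excluded, since there the dimensions are \<open>-\<infinity>\<close> and all estimates by real numbers
  would break down. The factor map enters through its fibres, which the action permutes.
\<close>

locale factor_system =
  fixes G :: "('g, 'm) monoid_scheme" (structure)
    and X :: "'x topology" and \<phi> :: "'g \<Rightarrow> 'x \<Rightarrow> 'x" and \<rho> :: "'x \<Rightarrow> 'x \<Rightarrow> real"
    and Y :: "'y topology" and \<psi> :: "'g \<Rightarrow> 'y \<Rightarrow> 'y" and \<pi> :: "'x \<Rightarrow> 'y"
  assumes group_G: "group G" and infinite_G: "infinite (carrier G)" and amenable_G: "amenable G"
    and system: "G_system G X \<phi>" and factor: "factor_map G X \<phi> Y \<psi> \<pi>"
    and metric: "compatible_metric X \<rho>" and nonempty: "topspace X \<noteq> {}"

sublocale factor_system \<subseteq> group G by (rule group_G)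

sublocale factor_system \<subseteq> group_action G "topspace X" \<phi>
  using system by (simp add: G_system_def)

sublocale factor_system \<subseteq> Metric_space "topspace X" \<rho>
  using metric by (simp add: compatible_metric_def)

context factor_system
begin

lemma mtopology_eq: "mtopology = X"
  using metric by (simp add: compatible_metric_def)

lemma metrizable_X: "metrizable_space X"
  using system by (simp add: G_system_def)

lemma act_continuous: "g \<in> carrier G \<Longrightarrow> continuous_map X X (\<phi> g)"
  using system by (simp add: G_system_def)

lemma act_closed: "g \<in> carrier G \<Longrightarrow> x \<in> topspace X \<Longrightarrow> \<phi> g x \<in> topspace X"
  using element_image by blast

lemma act_fibre:
  assumes "g \<in> carrier G" "x \<in> topspace X" "x' \<in> topspace X" "\<pi> x = \<pi> x'"
  shows "\<pi> (\<phi> g x) = \<pi> (\<phi> g x')"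
  using factor assms by (simp add: factor_map_def)

lemma filter_nontrivial: "invariance_filter G \<noteq> bot"
  by (rule amenable_imp_invariance_filter_nontrivial[OF amenable_G])

lemma cover_nonempty: "finite_open_cover X \<alpha> \<Longrightarrow> \<alpha> \<noteq> {}"
  using nonempty unfolding finite_open_cover_def by (metis Union_empty)

definition orbit_D :: "'x set set \<Rightarrow> 'g set \<Rightarrow> ereal" where
  "orbit_D \<alpha> E = cond_D X \<pi> (topspace Y) (cover_iterate X \<phi> E \<alpha>)"

lemma orbit_D_le:
  assumes "finite_open_cover X \<beta>" "resolves X \<pi> \<phi> \<alpha> E \<beta>"
    "\<And>x. x \<in> topspace X \<Longrightarrow> real (multiplicity_at \<beta> x) - 1 \<le> r"
  shows "orbit_D \<alpha> E \<le> ereal r"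
  unfolding orbit_D_def
  by (rule cond_D_le[OF assms(1) iffD1[OF resolves_iff_iterate assms(2)] assms(3)])

lemma orbit_D_less:
  assumes "orbit_D \<alpha> E < ereal r" "finite_open_cover X \<alpha>"
  shows "\<exists>\<beta>. finite_open_cover X \<beta> \<and> resolves X \<pi> \<phi> \<alpha> E \<beta> \<and>
    (\<forall>x\<in>topspace X. real (multiplicity_at \<beta> x) - 1 \<le> r)"
proof -
  have "\<pi> ` topspace X \<subseteq> topspace Y" using factor by (auto simp: factor_map_def)
  moreover have "cover_iterate X \<phi> E \<alpha> \<noteq> {}"
  proof -
    obtain U where "U \<in> \<alpha>" using cover_nonempty[OF assms(2)] by blast
    hence "(\<lambda>_. U) \<in> E \<rightarrow> \<alpha>" by blast
    thus ?thesis unfolding cover_iterate_def by blast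
  qed
  ultimately obtain \<beta> where "finite_open_cover X \<beta>"
      "fibrewise_refines (topspace X) \<pi> \<beta> (cover_iterate X \<phi> E \<alpha>)"
      "\<And>x. x \<in> topspace X \<Longrightarrow> real (multiplicity_at \<beta> x) - 1 \<le> r"
    using cond_D_less_imp_cover[OF assms(1)[unfolded orbit_D_def]] by blast
  thus ?thesis using resolves_iff_iterate by blast
qed

lemma orbit_D_nonneg: "0 \<le> orbit_D \<alpha> E"
  unfolding orbit_D_def cond_D_def
proof (rule INF_greatest)
  fix \<beta> assume "\<beta> \<in> {\<beta>. finite_open_cover X \<beta> \<and>
      refines (cover_join (fibres (topspace X) \<pi> (topspace Y)) \<beta>) (cover_iterate X \<phi> E \<alpha>)}"
  hence \<beta>: "finite_open_cover X \<beta>" by blast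
  obtain x where x: "x \<in> topspace X" using nonempty by blast
  hence "{U \<in> \<beta>. x \<in> U} \<noteq> {}" "finite {U \<in> \<beta>. x \<in> U}" using \<beta> by (auto simp: finite_open_cover_def)
  hence "1 \<le> card {U \<in> \<beta>. x \<in> U}" by (simp add: card_gt_0_iff Suc_leI)
  hence "0 \<le> ereal (real (card {U \<in> \<beta>. x \<in> U}) - 1)" by simp
  also have "\<dots> \<le> cover_ord (topspace X) \<beta>" unfolding cover_ord_def by (rule SUP_upper[OF x])
  finally show "0 \<le> cover_ord (topspace X) \<beta>" .
qed

lemma orbit_D_le_tiles:
  assumes \<alpha>: "finite_open_cover X \<alpha>" and I: "finite I" and E: "E \<subseteq> carrier G" and R: "finite R" "R \<subseteq> carrier G"
    and \<beta>: "\<And>p. p \<in> I \<Longrightarrow> finite_open_cover X (\<beta> p)" "\<And>p. p \<in> I \<Longrightarrow> resolves X \<pi> \<phi> \<alpha> (C p) (\<beta> p)"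
      "\<And>p x. p \<in> I \<Longrightarrow> x \<in> topspace X \<Longrightarrow> real (multiplicity_at (\<beta> p) x) - 1 \<le> r p"
    and cov: "E \<subseteq> R \<union> (\<Union>p\<in>I. C p)"
  shows "orbit_D \<alpha> E \<le> ereal ((\<Sum>p\<in>I. r p) + real (card R) * real (card \<alpha>))"
proof -
  have cont: "continuous_map X X (\<phi> i)" if "i \<in> R" for i using that R act_continuous by blast
  have "\<exists>\<omega>. finite_open_cover X \<omega> \<and> resolves X \<pi> \<phi> \<alpha> E \<omega> \<and>
    (\<forall>x\<in>topspace X. real (multiplicity_at \<omega> x) - 1 \<le>
       (\<Sum>p\<in>I. real (multiplicity_at (\<beta> p) x) - 1) + real (card R) * real (card \<alpha>))"
    by (rule resolving_covers_combine[OF metrizable_X I R(1) \<alpha> cont \<beta>(1,2) cov])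
  then obtain \<omega> where \<omega>: "finite_open_cover X \<omega>" "resolves X \<pi> \<phi> \<alpha> E \<omega>"
    "\<forall>x\<in>topspace X. real (multiplicity_at \<omega> x) - 1 \<le>
       (\<Sum>p\<in>I. real (multiplicity_at (\<beta> p) x) - 1) + real (card R) * real (card \<alpha>)"
    by (elim exE conjE)
  show ?thesis
  proof (rule orbit_D_le[OF \<omega>(1,2)])
    fix x assume x: "x \<in> topspace X"
    have "(\<Sum>p\<in>I. real (multiplicity_at (\<beta> p) x) - 1) \<le> (\<Sum>p\<in>I. r p)"
      by (intro sum_mono \<beta>(3) x)
    with bspec[OF \<omega>(3) x]
    show "real (multiplicity_at \<omega> x) - 1 \<le> (\<Sum>p\<in>I. r p) + real (card R) * real (card \<alpha>)" by linarith
  qed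
qed

lemma orbit_D_le_card:
  assumes "finite_open_cover X \<alpha>" "E \<in> finite_subsets G"
  shows "orbit_D \<alpha> E \<le> ereal (real (card \<alpha>) * real (card E))"
proof -
  note E = finite_subsetsD[OF assms(2)]
  have "orbit_D \<alpha> E \<le> ereal ((\<Sum>p\<in>({} :: nat set). 0) + real (card E) * real (card \<alpha>))"
    by (rule orbit_D_le_tiles[OF assms(1) _ E(1) E(2,1), where \<beta> = "\<lambda>_. {}" and C = "\<lambda>_. {}"]) auto
  thus ?thesis by (simp add: mult.commute)
qed

text \<open>
  The Ornstein-Weiss argument: a tile \<open>Fc\<close> of \<open>E\<close> is resolved by the pullback under \<open>c\<close> of an optimal
  cover for \<open>F\<close>, because \<open>\<phi> (sc) x = \<phi> s (\<phi> c x)\<close> and \<open>c\<close> maps fibres to fibres.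
\<close>

lemma orbit_D_eventually_le:
  assumes \<alpha>: "finite_open_cover X \<alpha>" and \<epsilon>: "0 < \<epsilon>"
    and freq: "frequently (\<lambda>F. orbit_D \<alpha> F < ereal (t * real (card F))) (invariance_filter G)"
    and t: "0 \<le> t"
  shows "eventually (\<lambda>E. orbit_D \<alpha> E \<le> ereal ((t + \<epsilon>) * real (card E))) (invariance_filter G)"
proof -
  define \<eta> where "\<eta> = min (1 / 2) (\<epsilon> / (5 * (real (card \<alpha>) + 1)))"
  have \<eta>: "0 < \<eta>" using \<epsilon> by (simp add: \<eta>_def)
  have \<eta>2: "\<eta> \<le> 1 / 2" unfolding \<eta>_def by (rule min.cobounded1)
  have "\<eta> \<le> \<epsilon> / (5 * (real (card \<alpha>) + 1))" by (simp add: \<eta>_def)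
  hence \<eta>\<alpha>: "5 * \<eta> * real (card \<alpha>) \<le> \<epsilon>" using \<eta> by (simp add: field_simps)
  obtain l F K N\<^sub>0 where F: "\<And>j. j < l \<Longrightarrow> F j \<in> finite_subsets G"
    and FD: "\<And>j. j < l \<Longrightarrow> orbit_D \<alpha> (F j) < ereal (t * real (card (F j)))"
    and K: "K \<subseteq> carrier G" "finite K" and FK: "\<And>j. j < l \<Longrightarrow> F j \<subseteq> K"
    and invFK: "\<And>i j. i < l \<Longrightarrow> j < l \<Longrightarrow> (m_inv G ` F i) <#> F j \<subseteq> K"
    and counts: "\<And>N. N\<^sub>0 \<le> N \<Longrightarrow> \<exists>n. tile_counts G \<eta> l F (real N) n"
    using tile_system_exists[OF freq \<eta> \<eta>2] by metis
  have "\<forall>j\<in>{..<l}. \<exists>\<beta>. finite_open_cover X \<beta> \<and> resolves X \<pi> \<phi> \<alpha> (F j) \<beta> \<and>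
      (\<forall>x\<in>topspace X. real (multiplicity_at \<beta> x) - 1 \<le> t * real (card (F j)))"
    using orbit_D_less[OF FD \<alpha>] by blast
  from bchoice[OF this] obtain \<beta> where \<beta>: "\<forall>j\<in>{..<l}. finite_open_cover X (\<beta> j) \<and>
      resolves X \<pi> \<phi> \<alpha> (F j) (\<beta> j) \<and>
      (\<forall>x\<in>topspace X. real (multiplicity_at (\<beta> j) x) - 1 \<le> t * real (card (F j)))" ..
  show ?thesis
    using eventually_card_core_ge[OF K \<eta>] eventually_card_ge[OF infinite_G, of N\<^sub>0]
      eventually_almost_invariant[OF K \<eta>]
  proof eventually_elim
    case (elim E)
    have EF: "E \<in> finite_subsets G" using elim(3) by (simp add: almost_invariant_def)
    note E = finite_subsetsD[OF EF]
    define E' where "E' = {v \<in> E. \<forall>s\<in>K. s \<otimes> v \<in> E}"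
    have E': "finite E'" "E' \<subseteq> carrier G" "(1 - \<eta>) * real (card E) \<le> real (card E')"
      using E elim(1) by (auto simp: E'_def)
    have free: "acts_freely_at G (\<lambda>s v. s \<otimes> v) K (carrier G) E'"
      unfolding E'_def by (rule translation_acts_freely[OF K(1) E(1)])
    obtain n where n: "tile_counts G \<eta> l F (real (card E)) n" using counts[OF elim(2)] by blast
    obtain I T where IT: "quasi_tiling (\<lambda>s v. s \<otimes> v) E' F \<eta> I T" "I \<subseteq> {..<l} \<times> E'"
        "\<And>k. k < l \<Longrightarrow> card {c. (k, c) \<in> I} = n k"
      using quasi_tiling_of_size[OF F FK invFK n \<eta> \<eta>2 E'(1) free E'(3)] by blast
    have finI: "finite I" using IT(2) E'(1) by (meson finite_SigmaI finite_lessThan finite_subset)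
    note Ip = quasi_tilingD[OF IT(1,2)]
    define C where "C = (\<lambda>p. (\<lambda>s. s \<otimes> snd p) ` T p)"
    define R where "R = E - (\<Union>p\<in>I. C p)"
    have cardR: "real (card R) \<le> 5 * \<eta> * real (card E)"
      unfolding R_def C_def
      by (rule card_uncovered_le[OF E'(1) IT n _ _ finite_subsetsD(2)[OF F] FK free E(2)])
        (use \<eta> \<eta>2 in \<open>auto simp: E'_def\<close>)
    define \<gamma> where "\<gamma> = (\<lambda>p. (\<lambda>V. {x \<in> topspace X. \<phi> (snd p) x \<in> V}) ` \<beta> (fst p))"
    have cG: "snd p \<in> carrier G" if "p \<in> I" for p using Ip(2)[OF that] E'(2) by blast
    have "orbit_D \<alpha> E \<le> ereal ((\<Sum>p\<in>I. t * real (card (F (fst p)))) + real (card R) * real (card \<alpha>))"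
    proof (rule orbit_D_le_tiles[OF \<alpha> finI E(1), where \<beta> = \<gamma> and C = C])
      show "finite R" "R \<subseteq> carrier G" using E by (auto simp: R_def)
      show "E \<subseteq> R \<union> (\<Union>p\<in>I. C p)" by (auto simp: R_def)
    next
      fix p assume p: "p \<in> I"
      have \<beta>p: "finite_open_cover X (\<beta> (fst p))" "resolves X \<pi> \<phi> \<alpha> (F (fst p)) (\<beta> (fst p))"
        and \<beta>m: "\<And>x. x \<in> topspace X \<Longrightarrow> real (multiplicity_at (\<beta> (fst p)) x) - 1 \<le> t * real (card (F (fst p)))"
        using \<beta> Ip(1)[OF p] by auto
      note pre = preimage_finite_open_cover[OF act_continuous[OF cG[OF p]] \<beta>p(1)]
      show "finite_open_cover X (\<gamma> p)" unfolding \<gamma>_def by (rule pre(1))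
      show "resolves X \<pi> \<phi> \<alpha> (C p) (\<gamma> p)"
        unfolding \<gamma>_def
      proof (rule resolves_preimage[OF \<beta>p(2) _ cover_nonempty[OF \<alpha>]])
        show "\<phi> (snd p) ` topspace X \<subseteq> topspace X" using act_closed[OF cG[OF p]] by blast
        show "\<pi> (\<phi> (snd p) x) = \<pi> (\<phi> (snd p) x')"
          if "x \<in> topspace X" "x' \<in> topspace X" "\<pi> x = \<pi> x'" for x x'
          by (rule act_fibre[OF cG[OF p] that])
        fix i assume "i \<in> C p"
        then obtain s where s: "s \<in> T p" "i = s \<otimes> snd p" by (auto simp: C_def)
        have sF: "s \<in> F (fst p)" using s Ip(3)[OF p] by blast
        hence "s \<in> carrier G" using finite_subsetsD(1)[OF F[OF Ip(1)[OF p]]] by blast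
        hence "\<phi> i x = \<phi> s (\<phi> (snd p) x)" if "x \<in> topspace X" for x
          unfolding s(2) using that cG[OF p] by (intro composition_rule)
        thus "\<exists>j\<in>F (fst p). \<forall>x\<in>topspace X. \<phi> i x = \<phi> j (\<phi> (snd p) x)" using sF by blast
      qed
      fix x assume x: "x \<in> topspace X"
      have "real (multiplicity_at (\<gamma> p) x) \<le> real (multiplicity_at (\<beta> (fst p)) (\<phi> (snd p) x))"
        using pre(2)[OF x] by (simp add: \<gamma>_def)
      thus "real (multiplicity_at (\<gamma> p) x) - 1 \<le> t * real (card (F (fst p)))"
        using \<beta>m[OF act_closed[OF cG[OF p] x]] by linarith
    qed
    also have "(\<Sum>p\<in>I. t * real (card (F (fst p)))) = t * (\<Sum>k<l. real (n k) * real (card (F k)))"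
      using sum_over_centres[of E' I 0 l n "\<lambda>k. real (card (F k))"] E'(1) IT(2,3)
      by (simp add: atLeast0LessThan flip: sum_distrib_left)
    also have "ereal (t * (\<Sum>k<l. real (n k) * real (card (F k))) + real (card R) * real (card \<alpha>))
        \<le> ereal ((t + \<epsilon>) * real (card E))"
    proof -
      have "t * (\<Sum>k<l. real (n k) * real (card (F k))) \<le> t * real (card E)"
        using n t by (intro mult_left_mono) (simp_all add: tile_counts_def)
      moreover have "real (card R) * real (card \<alpha>) \<le> \<epsilon> * real (card E)"
      proof -
        have "real (card R) * real (card \<alpha>) \<le> (5 * \<eta> * real (card E)) * real (card \<alpha>)"
          by (rule mult_right_mono[OF cardR]) simp
        also have "\<dots> = (5 * \<eta> * real (card \<alpha>)) * real (card E)" by simp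
        also have "\<dots> \<le> \<epsilon> * real (card E)" by (rule mult_right_mono[OF \<eta>\<alpha>]) simp
        finally show ?thesis .
      qed
      ultimately show ?thesis by (simp add: algebra_simps)
    qed
    finally show ?case .
  qed
qed

text \<open>
  The ratio is frequently close to its lower limit, hence by \<open>orbit_D_eventually_le\<close> it is eventually
  not much larger.
\<close>

lemma orbit_D_limit_exists:
  assumes \<alpha>: "finite_open_cover X \<alpha>"
  obtains L where "0 \<le> L" "((\<lambda>F. orbit_D \<alpha> F / ereal (real (card F))) \<longlongrightarrow> ereal L) (invariance_filter G)"
proof -
  let ?q = "\<lambda>F. orbit_D \<alpha> F / ereal (real (card F))"
  let ?\<F> = "invariance_filter G"
  have fs: "eventually (\<lambda>F. F \<in> finite_subsets G) ?\<F>"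
    using eventually_almost_invariant[of "{}" 1] by (auto simp: almost_invariant_def elim: eventually_mono)
  have ge0: "0 \<le> Liminf ?\<F> ?q"
  proof (rule Liminf_bounded)
    show "eventually (\<lambda>F. 0 \<le> ?q F) ?\<F>"
      by (intro always_eventually allI zero_le_divide_ereal orbit_D_nonneg) simp
  qed
  have "Liminf ?\<F> ?q \<le> ereal (real (card \<alpha>))"
  proof (rule Liminf_le[OF filter_nontrivial])
    show "eventually (\<lambda>F. ?q F \<le> ereal (real (card \<alpha>))) ?\<F>"
      using fs
    proof eventually_elim
      case (elim F)
      show ?case using orbit_D_le_card[OF \<alpha> elim] finite_subsetsD(4)[OF elim] by (simp add: ereal_div_less_iff)
    qed
  qed
  with ge0 obtain L where L: "Liminf ?\<F> ?q = ereal L" "0 \<le> L" by (cases "Liminf ?\<F> ?q") auto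
  have below: "eventually (\<lambda>F. ?q F < ereal s) ?\<F>" if s: "L < s" for s
  proof -
    define \<epsilon> where "\<epsilon> = (s - L) / 3"
    have \<epsilon>: "0 < \<epsilon>" using s by (simp add: \<epsilon>_def)
    have "frequently (\<lambda>F. ?q F < ereal (L + \<epsilon>)) ?\<F>"
    proof (rule ccontr)
      assume "\<not> ?thesis"
      hence "eventually (\<lambda>F. ereal (L + \<epsilon>) \<le> ?q F) ?\<F>" by (simp add: frequently_def not_less)
      hence "ereal (L + \<epsilon>) \<le> ereal L" using Liminf_bounded L(1) by metis
      thus False using \<epsilon> by simp
    qed
    hence "frequently (\<lambda>F. F \<in> finite_subsets G \<and> ?q F < ereal (L + \<epsilon>)) ?\<F>"
      using fs by (rule frequently_eventually_conj)
    hence "frequently (\<lambda>F. orbit_D \<alpha> F < ereal ((L + \<epsilon>) * real (card F))) ?\<F>"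
    proof (rule frequently_elim1)
      fix F assume F: "F \<in> finite_subsets G \<and> ?q F < ereal (L + \<epsilon>)"
      have "0 < real (card F)" using finite_subsetsD(4)[of F G] F by simp
      from ereal_div_less_iff(1)[OF this, of "orbit_D \<alpha> F" "L + \<epsilon>"] F
      show "orbit_D \<alpha> F < ereal ((L + \<epsilon>) * real (card F))" by blast
    qed
    from orbit_D_eventually_le[OF \<alpha> \<epsilon> this] L(2) \<epsilon>
    have "eventually (\<lambda>E. orbit_D \<alpha> E \<le> ereal ((L + \<epsilon> + \<epsilon>) * real (card E))) ?\<F>" by simp
    with fs show ?thesis
    proof eventually_elim
      case (elim F)
      hence "?q F \<le> ereal (L + \<epsilon> + \<epsilon>)" using finite_subsetsD(4)[OF elim(1)] by (simp add: ereal_div_less_iff)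
      also have "\<dots> < ereal s" using s by (simp add: \<epsilon>_def field_simps)
      finally show ?case .
    qed
  qed
  have "(?q \<longlongrightarrow> ereal L) ?\<F>"
  proof (rule order_tendstoI)
    fix a assume "a < ereal L"
    thus "eventually (\<lambda>F. a < ?q F) ?\<F>" using L(1) less_LiminfD by metis
  next
    fix a assume "ereal L < a"
    then obtain s where s: "L < s" "ereal s < a" using ereal_dense2 by (metis less_ereal.simps(1))
    show "eventually (\<lambda>F. ?q F < a) ?\<F>" using below[OF s(1)] s(2) by (auto elim: eventually_mono)
  qed
  thus ?thesis using that L(2) by blast
qed

section \<open>The sofic dimension is at least the amenable one\<close>

lemma \<rho>_bounded: "\<exists>B>0. \<forall>x\<in>topspace X. \<forall>y\<in>topspace X. \<rho> x y \<le> B"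
proof -
  have "compactin mtopology (topspace X)"
    using system by (simp add: G_system_def compact_space_def mtopology_eq)
  thus ?thesis using compactin_imp_mbounded mbounded_alt_pos by blast
qed

lemma continuous_\<rho>:
  assumes "continuous_map T X f" "continuous_map T X g"
  shows "continuous_map T euclideanreal (\<lambda>x. \<rho> (f x) (g x))"
proof -
  have "mtopology_of Self = X" by (simp add: mtopology_of_def mtopology_eq)
  thus ?thesis using continuous_map_mdist[of T Self f g] assms by simp
qed

lemma metrizable_power: "metrizable_space (power_topology n X)"
  unfolding metrizable_space_product_topology
  by (intro disjI2 conjI ballI metrizable_X countable_finite) simp

lemma sofic_Map_subset: "sofic_Map X \<phi> \<rho> F \<delta> n s \<subseteq> topspace (power_topology n X)"
  unfolding sofic_Map_def by (rule Collect_restrict)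

lemma power_cover_nonempty:
  assumes "\<alpha> \<noteq> {}"
  shows "restrict_family (power_cover n \<alpha>) M \<noteq> {}"
proof -
  obtain U where "U \<in> \<alpha>" using assms by blast
  hence "PiE {1..n} (\<lambda>_. U) \<in> power_cover n \<alpha>" unfolding power_cover_def by blast
  thus ?thesis unfolding restrict_family_def by blast
qed

text \<open>
  At a point where \<open>\<tau>\<close> is equivariant the two elements of \<open>X\<close> to be compared coincide, elsewhere
  their distance is at most the diameter \<open>B\<close>.
\<close>

lemma orbit_in_sofic_Map:
  assumes perm: "\<And>g. g \<in> F \<Longrightarrow> s g permutes {1..n}" and F: "F \<subseteq> carrier G"
    and \<tau>: "\<And>a. \<tau> a \<in> carrier G"
    and bad: "\<And>g. g \<in> F \<Longrightarrow> real (card {a \<in> {1..n}. \<tau> (s g a) \<noteq> g \<otimes> \<tau> a}) \<le> \<epsilon> * real n"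
    and B: "\<And>x y. x \<in> topspace X \<Longrightarrow> y \<in> topspace X \<Longrightarrow> \<rho> x y \<le> B" and \<delta>: "\<epsilon> * B\<^sup>2 \<le> \<delta>\<^sup>2" "0 < \<delta>"
    and n: "0 < n" and x: "x \<in> topspace X"
  shows "(\<lambda>a\<in>{1..n}. \<phi> (\<tau> a) x) \<in> sofic_Map X \<phi> \<rho> F \<delta> n s"
proof -
  let ?\<xi> = "\<lambda>a\<in>{1..n}. \<phi> (\<tau> a) x"
  have top: "?\<xi> \<in> topspace (power_topology n X)" using act_closed[OF \<tau> x] by simp
  have "sqrt (1 / real n * (\<Sum>a\<in>{1..n}. (\<rho> (?\<xi> (s g a)) (\<phi> g (?\<xi> a)))\<^sup>2)) \<le> \<delta>" if g: "g \<in> F" for g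
  proof -
    let ?A = "{a \<in> {1..n}. \<tau> (s g a) \<noteq> g \<otimes> \<tau> a}"
    have gG: "g \<in> carrier G" using g F by blast
    have bound: "(\<rho> (?\<xi> (s g a)) (\<phi> g (?\<xi> a)))\<^sup>2 \<le> (if a \<in> ?A then B\<^sup>2 else 0)" if a: "a \<in> {1..n}" for a
    proof -
      have sa: "s g a \<in> {1..n}" using permutes_in_image[OF perm[OF g]] a by blast
      have eq: "?\<xi> (s g a) = \<phi> (\<tau> (s g a)) x" "\<phi> g (?\<xi> a) = \<phi> (g \<otimes> \<tau> a) x"
        using a sa composition_rule[OF x gG \<tau>] by auto
      have mem: "\<phi> (\<tau> (s g a)) x \<in> topspace X" "\<phi> (g \<otimes> \<tau> a) x \<in> topspace X"
        using act_closed x \<tau> gG by auto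
      show ?thesis
      proof (cases "a \<in> ?A")
        case True
        have "(\<rho> (\<phi> (\<tau> (s g a)) x) (\<phi> (g \<otimes> \<tau> a) x))\<^sup>2 \<le> B\<^sup>2"
          by (rule power_mono[OF B[OF mem]]) simp
        thus ?thesis unfolding eq using True by simp
      next
        case False
        hence "\<tau> (s g a) = g \<otimes> \<tau> a" using a by blast
        thus ?thesis unfolding eq using False mem by simp
      qed
    qed
    have "(\<Sum>a\<in>{1..n}. (\<rho> (?\<xi> (s g a)) (\<phi> g (?\<xi> a)))\<^sup>2) \<le> (\<Sum>a\<in>{1..n}. if a \<in> ?A then B\<^sup>2 else 0)"
      by (rule sum_mono[OF bound])
    also have "\<dots> = (\<Sum>a\<in>{1..n} \<inter> ?A. B\<^sup>2)" by (rule sum.inter_restrict[symmetric]) simp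
    also have "{1..n} \<inter> ?A = ?A" by blast
    also have "(\<Sum>a\<in>?A. B\<^sup>2) = real (card ?A) * B\<^sup>2" by simp
    also have "\<dots> \<le> (\<epsilon> * real n) * B\<^sup>2" by (rule mult_right_mono[OF bad[OF g]]) simp
    also have "\<dots> = (\<epsilon> * B\<^sup>2) * real n" by simp
    also have "\<dots> \<le> \<delta>\<^sup>2 * real n" by (rule mult_right_mono[OF \<delta>(1)]) simp
    finally have "1 / real n * (\<Sum>a\<in>{1..n}. (\<rho> (?\<xi> (s g a)) (\<phi> g (?\<xi> a)))\<^sup>2) \<le> \<delta>\<^sup>2"
      using n by (simp add: field_simps)
    thus ?thesis using \<delta>(2) by (intro real_le_lsqrt) auto
  qed
  thus ?thesis using top unfolding sofic_Map_def by blast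
qed

text \<open>
  A resolving cover of the microstates is pulled back along \<open>x \<mapsto> (\<tau>(a)x)\<^sub>a\<close>; it resolves all
  coordinates in the image of \<open>\<tau>\<close>.
\<close>

lemma orbit_D_le_sofic_D:
  assumes \<alpha>: "finite_open_cover X \<alpha>" and E: "E \<in> finite_subsets G" and \<tau>: "\<And>a. \<tau> a \<in> carrier G"
    and M: "\<And>x. x \<in> topspace X \<Longrightarrow> (\<lambda>a\<in>{1..n}. \<phi> (\<tau> a) x) \<in> sofic_Map X \<phi> \<rho> F \<delta> n s"
    and less: "sofic_D X \<phi> \<alpha> \<pi> \<rho> F \<delta> n s < ereal r"
  shows "orbit_D \<alpha> E \<le> ereal (r + real (card (E - \<tau> ` {1..n})) * real (card \<alpha>))"
proof -
  define M where "M = sofic_Map X \<phi> \<rho> F \<delta> n s"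
  define T where "T = subtopology (power_topology n X) M"
  define \<Phi> where "\<Phi> = (\<lambda>x. \<lambda>a\<in>{1..n}. \<phi> (\<tau> a) x)"
  have Msub: "M \<subseteq> topspace (power_topology n X)" unfolding M_def by (rule sofic_Map_subset)
  hence top: "topspace T = M" unfolding T_def by auto
  have less': "cond_D T (power_map n \<pi>) (power_map n \<pi> ` M) (restrict_family (power_cover n \<alpha>) M) < ereal r"
    using less by (simp add: sofic_D_def Let_def M_def T_def)
  have \<alpha>0: "\<alpha> \<noteq> {}" by (rule cover_nonempty[OF \<alpha>])
  obtain \<beta> where \<beta>: "finite_open_cover T \<beta>"
      "fibrewise_refines (topspace T) (power_map n \<pi>) \<beta> (restrict_family (power_cover n \<alpha>) M)"
      "\<And>\<xi>. \<xi> \<in> topspace T \<Longrightarrow> real (multiplicity_at \<beta> \<xi>) - 1 \<le> r"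
    using cond_D_less_imp_cover[OF less' _ power_cover_nonempty[OF \<alpha>0]] top by blast
  have res: "resolves T (power_map n \<pi>) (\<lambda>a \<xi>. \<xi> a) \<alpha> {1..n} \<beta>"
    using \<beta>(2) resolves_iff_power[OF Msub] unfolding top unfolding T_def by blast
  have \<Phi>M: "\<Phi> x \<in> M" if "x \<in> topspace X" for x using M[OF that] by (simp add: \<Phi>_def M_def)
  have cont: "continuous_map X T \<Phi>"
    unfolding T_def
  proof (rule continuous_map_into_subtopology)
    show "\<Phi> \<in> topspace X \<rightarrow> M" using \<Phi>M by blast
    show "continuous_map X (power_topology n X) \<Phi>"
      unfolding continuous_map_componentwise
    proof (intro conjI ballI)
      show "\<Phi> ` topspace X \<subseteq> extensional {1..n}" by (auto simp: \<Phi>_def)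
      fix a assume "a \<in> {1..n}"
      thus "continuous_map X X (\<lambda>x. \<Phi> x a)" using act_continuous[OF \<tau>] by (simp add: \<Phi>_def)
    qed
  qed
  define \<gamma> where "\<gamma> = (\<lambda>V. {x \<in> topspace X. \<Phi> x \<in> V}) ` \<beta>"
  note pre = preimage_finite_open_cover[OF cont \<beta>(1)]
  have fib: "power_map n \<pi> (\<Phi> x) = power_map n \<pi> (\<Phi> x')"
    if "x \<in> topspace X" "x' \<in> topspace X" "\<pi> x = \<pi> x'" for x x'
    unfolding power_map_def \<Phi>_def using act_fibre[OF \<tau> that] by (intro restrict_ext) simp
  have \<gamma>: "resolves X \<pi> \<phi> \<alpha> (\<tau> ` {1..n}) \<gamma>"
    unfolding \<gamma>_def
  proof (rule resolves_preimage[OF res _ \<alpha>0])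
    show "power_map n \<pi> (\<Phi> x) = power_map n \<pi> (\<Phi> x')"
      if "x \<in> topspace X" "x' \<in> topspace X" "\<pi> x = \<pi> x'" for x x'
      by (rule fib[OF that])
    show "\<Phi> ` topspace X \<subseteq> topspace T" using \<Phi>M top by auto
    fix g assume "g \<in> \<tau> ` {1..n}"
    then obtain a where "a \<in> {1..n}" "g = \<tau> a" by blast
    thus "\<exists>j\<in>{1..n}. \<forall>x\<in>topspace X. \<phi> g x = \<Phi> x j" by (intro bexI[of _ a]) (auto simp: \<Phi>_def)
  qed
  note EF = finite_subsetsD[OF E]
  have "orbit_D \<alpha> E \<le> ereal ((\<Sum>p\<in>{()}. r) + real (card (E - \<tau> ` {1..n})) * real (card \<alpha>))"
  proof (rule orbit_D_le_tiles[OF \<alpha> _ EF(1), where \<beta> = "\<lambda>_. \<gamma>" and C = "\<lambda>_. \<tau> ` {1..n}"])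
    show "finite_open_cover X \<gamma>" unfolding \<gamma>_def by (rule pre(1))
    fix x assume x: "x \<in> topspace X"
    have "real (multiplicity_at \<gamma> x) \<le> real (multiplicity_at \<beta> (\<Phi> x))"
      using pre(2)[OF x] by (simp add: \<gamma>_def)
    thus "real (multiplicity_at \<gamma> x) - 1 \<le> r" using \<beta>(3)[of "\<Phi> x"] \<Phi>M[OF x] top by simp
  qed (use EF \<gamma> in auto)
  thus ?thesis by simp
qed

lemma sofic_D_eventually_ge:
  assumes sofic: "sofic_approximation G d \<sigma>" and \<alpha>: "finite_open_cover X \<alpha>"
    and t: "0 \<le> t" and \<epsilon>: "0 < \<epsilon>"
    and ev: "eventually (\<lambda>E. ereal (t * real (card E)) \<le> orbit_D \<alpha> E) (invariance_filter G)"
    and F: "F \<in> finite_subsets G" and \<delta>: "0 < \<delta>"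
  shows "eventually (\<lambda>i. ereal ((t - \<epsilon>) * real (d i)) \<le> sofic_D X \<phi> \<alpha> \<pi> \<rho> F \<delta> (d i) (\<sigma> i)) sequentially"
proof -
  obtain B where B: "0 < B" "\<And>x y. x \<in> topspace X \<Longrightarrow> y \<in> topspace X \<Longrightarrow> \<rho> x y \<le> B"
    using \<rho>_bounded by blast
  \<comment> \<open>The first bound puts the orbits into the space of microstates; the second one pays for the
     elements of \<open>E\<close> that are missed and for the difference between \<open>card E\<close> and \<open>d i\<close>.\<close>
  define \<theta> where "\<theta> = min (\<delta>\<^sup>2 / B\<^sup>2) (\<epsilon> / (t + real (card \<alpha>) + 1))"
  have \<theta>: "0 < \<theta>" using \<delta> B(1) \<epsilon> t by (simp add: \<theta>_def add_nonneg_pos)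
  have "\<theta> \<le> \<delta>\<^sup>2 / B\<^sup>2" unfolding \<theta>_def by (rule min.cobounded1)
  hence \<theta>B: "\<theta> * B\<^sup>2 \<le> \<delta>\<^sup>2" using B(1) by (simp add: field_simps)
  have "\<theta> \<le> \<epsilon> / (t + real (card \<alpha>) + 1)" unfolding \<theta>_def by (rule min.cobounded2)
  hence "\<theta> * (t + real (card \<alpha>) + 1) \<le> \<epsilon>" using t by (simp add: pos_le_divide_eq add_nonneg_pos)
  hence \<theta>\<epsilon>: "\<theta> * (t + real (card \<alpha>)) < \<epsilon>" using \<theta> by (simp add: algebra_simps)
  from sofic_eventually_large[OF sofic, of 1] sofic_models_folner_set[OF amenable_G infinite_G sofic finite_subsetsD(1,2)[OF F] \<theta> ev]
  show ?thesis
  proof eventually_elim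
    case (elim i)
    then obtain E \<tau> where E: "E \<in> finite_subsets G" "ereal (t * real (card E)) \<le> orbit_D \<alpha> E"
      and mod: "models_subset G F \<theta> (d i) (\<sigma> i) E \<tau>" by blast
    have \<tau>: "\<And>a. \<tau> a \<in> carrier G" and cardE: "(1 - \<theta>) * real (d i) \<le> real (card E)"
      and rest: "real (card (E - \<tau> ` {1..d i})) \<le> \<theta> * real (d i)"
      and bad: "\<And>g. g \<in> F \<Longrightarrow> real (card {a \<in> {1..d i}. \<tau> (\<sigma> i g a) \<noteq> g \<otimes> \<tau> a}) \<le> \<theta> * real (d i)"
      using mod by (simp_all add: models_subset_def)
    have perm: "\<sigma> i g permutes {1..d i}" if "g \<in> F" for g
    proof -
      have "g \<in> carrier G" using that finite_subsetsD(1)[OF F] by blast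
      thus ?thesis using sofic by (simp add: sofic_approximation_def)
    qed
    have di: "0 < d i" using elim by simp
    show ?case
    proof (rule ccontr)
      assume "\<not> ?case"
      hence less: "sofic_D X \<phi> \<alpha> \<pi> \<rho> F \<delta> (d i) (\<sigma> i) < ereal ((t - \<epsilon>) * real (d i))" by simp
      have "orbit_D \<alpha> E \<le> ereal ((t - \<epsilon>) * real (d i) + real (card (E - \<tau> ` {1..d i})) * real (card \<alpha>))"
        by (rule orbit_D_le_sofic_D[OF \<alpha> E(1) \<tau>
              orbit_in_sofic_Map[OF perm finite_subsetsD(1)[OF F] \<tau> bad B(2) \<theta>B \<delta> di] less])
      with E(2) have "t * real (card E) \<le> (t - \<epsilon>) * real (d i) + real (card (E - \<tau> ` {1..d i})) * real (card \<alpha>)"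
        by (metis ereal_less_eq(3) order_trans)
      also have "\<dots> \<le> (t - \<epsilon>) * real (d i) + (\<theta> * real (d i)) * real (card \<alpha>)"
        by (intro add_left_mono mult_right_mono rest) simp
      finally have "t * real (card E) \<le> (t - \<epsilon>) * real (d i) + (\<theta> * real (d i)) * real (card \<alpha>)" .
      moreover have "t * ((1 - \<theta>) * real (d i)) \<le> t * real (card E)" by (rule mult_left_mono[OF cardE t])
      ultimately have "\<epsilon> * real (d i) \<le> (\<theta> * (t + real (card \<alpha>))) * real (d i)"
        by (simp add: algebra_simps)
      hence "\<epsilon> \<le> \<theta> * (t + real (card \<alpha>))" using di by simp
      thus False using \<theta>\<epsilon> by simp
    qed
  qed
qed

section \<open>The sofic dimension is at most the amenable one\<close>

text \<open>
  A Lebesgue number argument: balls of half the radius of balls inside members of \<open>\<alpha>\<close>.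
\<close>

lemma shrunk_cover_exists:
  assumes \<alpha>: "finite_open_cover X \<alpha>"
  shows "\<exists>\<alpha>' \<kappa>. finite_open_cover X \<alpha>' \<and> 0 < \<kappa> \<and>
    (\<forall>A\<in>\<alpha>'. \<exists>U\<in>\<alpha>. \<forall>x\<in>A. \<forall>y\<in>topspace X. \<rho> x y < \<kappa> \<longrightarrow> y \<in> U)"
proof -
  have "\<forall>x\<in>topspace X. \<exists>r. 0 < r \<and> (\<exists>U\<in>\<alpha>. mball x (2 * r) \<subseteq> U)"
  proof
    fix x assume "x \<in> topspace X"
    then obtain U where U: "U \<in> \<alpha>" "x \<in> U" "openin mtopology U"
      using \<alpha> unfolding finite_open_cover_def mtopology_eq by blast
    then obtain r where "0 < r" "mball x r \<subseteq> U" unfolding openin_mtopology by blast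
    thus "\<exists>r. 0 < r \<and> (\<exists>U\<in>\<alpha>. mball x (2 * r) \<subseteq> U)"
      using U(1) by (intro exI[of _ "r / 2"]) auto
  qed
  from bchoice[OF this] obtain r
    where r: "\<forall>x\<in>topspace X. 0 < r x \<and> (\<exists>U\<in>\<alpha>. mball x (2 * r x) \<subseteq> U)" ..
  have "compactin X (topspace X)" using system by (simp add: G_system_def compact_space_def)
  moreover have "\<And>V. V \<in> (\<lambda>x. mball x (r x)) ` topspace X \<Longrightarrow> openin X V"
    using openin_mball mtopology_eq by auto
  moreover have "topspace X \<subseteq> \<Union>((\<lambda>x. mball x (r x)) ` topspace X)" using r by auto
  ultimately have "\<exists>\<F>. finite \<F> \<and> \<F> \<subseteq> (\<lambda>x. mball x (r x)) ` topspace X \<and> topspace X \<subseteq> \<Union>\<F>"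
    by (rule compactinD)
  then obtain \<F> where \<F>: "finite \<F>" "\<F> \<subseteq> (\<lambda>x. mball x (r x)) ` topspace X" "topspace X \<subseteq> \<Union>\<F>"
    by blast
  obtain C where C: "C \<subseteq> topspace X" "finite C" "\<F> = (\<lambda>x. mball x (r x)) ` C"
    using finite_subset_image[OF \<F>(1,2)] by blast
  have "C \<noteq> {}" using \<F>(3) nonempty unfolding C(3) by (metis UN_empty image_empty subset_empty)
  define \<kappa> where "\<kappa> = Min (r ` C)"
  have \<kappa>: "0 < \<kappa>" "\<And>x. x \<in> C \<Longrightarrow> \<kappa> \<le> r x"
    using C r \<open>C \<noteq> {}\<close> by (auto simp: \<kappa>_def subset_iff)
  have "finite_open_cover X \<F>"
    unfolding finite_open_cover_def
  proof (intro conjI \<F>(1) ballI)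
    fix V assume "V \<in> \<F>" thus "openin X V" using \<F>(2) openin_mball mtopology_eq by auto
  next
    show "\<Union>\<F> = topspace X" using \<F>(2,3) mball_subset_mspace by blast
  qed
  moreover have "\<exists>U\<in>\<alpha>. \<forall>x\<in>A. \<forall>y\<in>topspace X. \<rho> x y < \<kappa> \<longrightarrow> y \<in> U" if "A \<in> \<F>" for A
  proof -
    obtain z where z: "z \<in> C" "A = mball z (r z)" using \<open>A \<in> \<F>\<close> C(3) by blast
    hence zX: "z \<in> topspace X" using C(1) by blast
    then obtain U where U: "U \<in> \<alpha>" "mball z (2 * r z) \<subseteq> U" using r by blast
    have "y \<in> U" if "x \<in> A" "y \<in> topspace X" "\<rho> x y < \<kappa>" for x y
    proof -
      have "\<rho> z y \<le> \<rho> z x + \<rho> x y" using that z zX by (intro triangle) auto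
      also have "\<dots> < r z + r z" using that z \<kappa>(2)[OF z(1)] by auto
      finally have "y \<in> mball z (2 * r z)" using zX that by auto
      thus ?thesis using U(2) by blast
    qed
    thus ?thesis using U(1) by blast
  qed
  ultimately show ?thesis using \<kappa>(1) by blast
qed

text \<open>
  The microstates that follow the orbit of \<open>\<xi>(c)\<close> within \<open>\<kappa>\<close> and those that leave it by more than
  \<open>\<kappa>/2\<close> form an open cover. The former are covered by preimages of \<open>\<beta>\<close>, the latter by all products
  of members of \<open>\<alpha>\<close>, which explains the additional multiplicity \<open>card \<alpha> ^ card S\<close>. Fixing the image
  under \<open>\<pi>\<close> in every coordinate fixes in particular \<open>\<pi> (\<xi> c)\<close>, so the fibrewise resolution on \<open>X\<close>
  transfers.
\<close>

lemma sofic_tile_cover: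
  fixes v :: "'g \<Rightarrow> nat"
  assumes \<alpha>: "finite_open_cover X \<alpha>" and \<kappa>: "0 < \<kappa>"
    and shrink: "\<And>A. A \<in> \<alpha>' \<Longrightarrow> \<exists>U\<in>\<alpha>. \<forall>x\<in>A. \<forall>y\<in>topspace X. \<rho> x y < \<kappa> \<longrightarrow> y \<in> U"
    and M: "M \<subseteq> topspace (power_topology n X)" and T: "T = subtopology (power_topology n X) M"
    and S: "finite S" "S \<subseteq> carrier G" and v: "\<And>s. s \<in> S \<Longrightarrow> v s \<in> {1..n}" and c: "c \<in> {1..n}"
    and \<beta>: "finite_open_cover X \<beta>" and res: "resolves X \<pi> \<phi> \<alpha>' S \<beta>"
  shows "\<exists>\<gamma>. finite_open_cover T \<gamma> \<and> resolves T (power_map n \<pi>) (\<lambda>a \<xi>. \<xi> a) \<alpha> (v ` S) \<gamma> \<and>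
    (\<forall>\<xi>\<in>M. multiplicity_at \<gamma> \<xi> \<le> multiplicity_at \<beta> (\<xi> c) +
       (if \<exists>s\<in>S. \<kappa> / 2 < \<rho> (\<xi> (v s)) (\<phi> s (\<xi> c)) then card \<alpha> ^ card S else 0))"
proof -
  have top: "topspace T = M" using M T by auto
  have coord: "continuous_map T X (\<lambda>\<xi>. \<xi> a)" if "a \<in> {1..n}" for a
    unfolding T using that by (intro continuous_map_from_subtopology continuous_map_product_projection)
  have inX: "\<xi> a \<in> topspace X" if "\<xi> \<in> M" "a \<in> {1..n}" for \<xi> a
    using M that by (auto simp: PiE_iff)
  have dist: "continuous_map T euclideanreal (\<lambda>\<xi>. \<rho> (\<xi> (v s)) (\<phi> s (\<xi> c)))" if s: "s \<in> S" for s
  proof (rule continuous_\<rho>[OF coord[OF v[OF s]]])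
    have "continuous_map T X (\<phi> s \<circ> (\<lambda>\<xi>. \<xi> c))"
      by (rule continuous_map_compose[OF coord[OF c] act_continuous]) (use s S in blast)
    thus "continuous_map T X (\<lambda>\<xi>. \<phi> s (\<xi> c))" by (simp add: o_def)
  qed
  define good where "good = {\<xi> \<in> topspace T. \<forall>s\<in>S. \<rho> (\<xi> (v s)) (\<phi> s (\<xi> c)) < \<kappa>}"
  define bad where "bad = {\<xi> \<in> topspace T. \<exists>s\<in>S. \<kappa> / 2 < \<rho> (\<xi> (v s)) (\<phi> s (\<xi> c))}"
  have open_good: "openin T good"
    unfolding good_def
  proof (rule openin_finite_ball[OF S(1)])
    fix s assume "s \<in> S"
    from openin_continuous_map_preimage[OF dist[OF this], of "{..<\<kappa>}"]
    show "openin T {\<xi> \<in> topspace T. \<rho> (\<xi> (v s)) (\<phi> s (\<xi> c)) < \<kappa>}" by simp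
  qed
  have open_bad: "openin T bad"
    unfolding bad_def
  proof (rule openin_bex)
    fix s assume "s \<in> S"
    from openin_continuous_map_preimage[OF dist[OF this], of "{\<kappa> / 2<..}"]
    show "openin T {\<xi> \<in> topspace T. \<kappa> / 2 < \<rho> (\<xi> (v s)) (\<phi> s (\<xi> c))}" by simp
  qed
  define g where "g = (\<lambda>V. good \<inter> {\<xi> \<in> topspace T. \<xi> c \<in> V})"
  define h where "h = (\<lambda>w. bad \<inter> {\<xi> \<in> topspace T. \<forall>s\<in>S. \<xi> (v s) \<in> w s})"
  let ?W = "PiE S (\<lambda>_. \<alpha>)"
  define \<gamma> where "\<gamma> = g ` \<beta> \<union> h ` ?W"
  have fin: "finite \<alpha>" "finite \<beta>" "finite ?W"
    using \<alpha> \<beta> S(1) by (auto simp: finite_open_cover_def intro: finite_PiE)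
  have "finite_open_cover T \<gamma>"
    unfolding finite_open_cover_def
  proof (intro conjI ballI)
    show "finite \<gamma>" using fin by (simp add: \<gamma>_def)
    have open_g: "openin T (g V)" if "V \<in> \<beta>" for V
      unfolding g_def using \<beta> that
      by (intro openin_Int open_good openin_continuous_map_preimage[OF coord[OF c]])
        (simp add: finite_open_cover_def)
    have open_h: "openin T (h w)" if w: "w \<in> ?W" for w
      unfolding h_def
    proof (intro openin_Int open_bad openin_finite_ball S(1))
      fix s assume s: "s \<in> S"
      hence "openin X (w s)" using w \<alpha> by (auto simp: finite_open_cover_def PiE_iff)
      thus "openin T {\<xi> \<in> topspace T. \<xi> (v s) \<in> w s}"
        by (rule openin_continuous_map_preimage[OF coord[OF v[OF s]]])
    qed
    show op: "openin T W" if "W \<in> \<gamma>" for W using that open_g open_h by (auto simp: \<gamma>_def)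
    have "\<xi> \<in> \<Union>\<gamma>" if \<xi>: "\<xi> \<in> M" for \<xi>
    proof (cases "\<xi> \<in> good")
      case True
      obtain V where "V \<in> \<beta>" "\<xi> c \<in> V" using \<beta> inX[OF \<xi> c] by (auto simp: finite_open_cover_def)
      thus ?thesis using True \<xi> top by (auto simp: \<gamma>_def g_def)
    next
      case False
      then obtain s where s: "s \<in> S" "\<kappa> \<le> \<rho> (\<xi> (v s)) (\<phi> s (\<xi> c))"
        using \<xi> top by (auto simp: good_def not_less)
      hence "\<kappa> / 2 < \<rho> (\<xi> (v s)) (\<phi> s (\<xi> c))" using \<kappa> by linarith
      hence \<xi>bad: "\<xi> \<in> bad" using s(1) \<xi> top by (auto simp: bad_def)
      have "\<forall>s\<in>S. \<exists>U. U \<in> \<alpha> \<and> \<xi> (v s) \<in> U"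
      proof
        fix s assume "s \<in> S"
        hence "\<xi> (v s) \<in> \<Union>\<alpha>" using inX[OF \<xi> v] \<alpha> by (simp add: finite_open_cover_def)
        thus "\<exists>U. U \<in> \<alpha> \<and> \<xi> (v s) \<in> U" by blast
      qed
      from bchoice[OF this] obtain w where w: "\<forall>s\<in>S. w s \<in> \<alpha> \<and> \<xi> (v s) \<in> w s" ..
      hence "restrict w S \<in> ?W" "\<xi> \<in> h (restrict w S)" using \<xi>bad \<xi> top by (auto simp: h_def)
      thus ?thesis by (auto simp: \<gamma>_def)
    qed
    thus "\<Union>\<gamma> = topspace T" using op openin_subset top by blast
  qed
  moreover have "resolves T (power_map n \<pi>) (\<lambda>a \<xi>. \<xi> a) \<alpha> (v ` S) \<gamma>"
    unfolding resolves_def top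
  proof (intro ballI allI)
    fix W y a assume W: "W \<in> \<gamma>" and "a \<in> v ` S"
    then obtain s where s: "s \<in> S" "a = v s" by blast
    from W consider V where "V \<in> \<beta>" "W = g V" | w where "w \<in> ?W" "W = h w" by (auto simp: \<gamma>_def)
    thus "\<exists>U\<in>\<alpha>. \<forall>\<xi>\<in>M. \<xi> \<in> W \<longrightarrow> power_map n \<pi> \<xi> = y \<longrightarrow> \<xi> a \<in> U"
    proof cases
      case 1
      obtain A where A: "A \<in> \<alpha>'" "\<forall>x\<in>topspace X. x \<in> V \<longrightarrow> \<pi> x = y c \<longrightarrow> \<phi> s x \<in> A"
        using res 1(1) s(1) unfolding resolves_def by blast
      obtain U where U: "U \<in> \<alpha>" "\<forall>x\<in>A. \<forall>z\<in>topspace X. \<rho> x z < \<kappa> \<longrightarrow> z \<in> U" using shrink[OF A(1)] by blast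
      have "\<xi> a \<in> U" if \<xi>: "\<xi> \<in> M" "\<xi> \<in> W" "power_map n \<pi> \<xi> = y" for \<xi>
      proof -
        have "y c = \<pi> (\<xi> c)" using \<xi>(3) c by (auto simp: power_map_def)
        moreover have "\<xi> c \<in> V" "\<rho> (\<xi> a) (\<phi> s (\<xi> c)) < \<kappa>" using \<xi>(2) s unfolding 1(2) by (auto simp: g_def good_def)
        ultimately have "\<phi> s (\<xi> c) \<in> A" "\<rho> (\<phi> s (\<xi> c)) (\<xi> a) < \<kappa>" using A(2) inX[OF \<xi>(1) c] commute by auto
        thus ?thesis using U(2) inX[OF \<xi>(1) v[OF s(1)]] s(2) by blast
      qed
      thus ?thesis using U(1) by blast
    next
      case 2
      hence "w s \<in> \<alpha>" using s(1) by auto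
      moreover have "\<xi> a \<in> w s" if "\<xi> \<in> W" for \<xi> using that s unfolding 2(2) h_def by blast
      ultimately show ?thesis by blast
    qed
  qed
  moreover have "multiplicity_at \<gamma> \<xi> \<le> multiplicity_at \<beta> (\<xi> c) +
       (if \<exists>s\<in>S. \<kappa> / 2 < \<rho> (\<xi> (v s)) (\<phi> s (\<xi> c)) then card \<alpha> ^ card S else 0)" if \<xi>: "\<xi> \<in> M" for \<xi>
  proof -
    let ?H = "if \<xi> \<in> bad then h ` ?W else {}"
    have finV: "finite {V \<in> \<beta>. \<xi> c \<in> V}" using fin by simp
    have "{W \<in> \<gamma>. \<xi> \<in> W} \<subseteq> g ` {V \<in> \<beta>. \<xi> c \<in> V} \<union> ?H"
      by (auto simp: \<gamma>_def g_def h_def)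
    hence "multiplicity_at \<gamma> \<xi> \<le> card (g ` {V \<in> \<beta>. \<xi> c \<in> V} \<union> ?H)"
      unfolding multiplicity_at_def by (rule card_mono[rotated]) (use fin in auto)
    also have "\<dots> \<le> card (g ` {V \<in> \<beta>. \<xi> c \<in> V}) + card ?H" by (rule card_Un_le)
    also have "card (g ` {V \<in> \<beta>. \<xi> c \<in> V}) \<le> multiplicity_at \<beta> (\<xi> c)"
      unfolding multiplicity_at_def by (rule card_image_le[OF finV])
    also have "card ?H \<le> (if \<xi> \<in> bad then card \<alpha> ^ card S else 0)"
    proof -
      have "card (h ` ?W) \<le> card ?W" by (rule card_image_le[OF fin(3)])
      also have "card ?W = card \<alpha> ^ card S" by (simp add: card_PiE[OF S(1)])
      finally show ?thesis by simp
    qed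
    finally show ?thesis using \<xi> top by (simp add: bad_def)
  qed
  ultimately show ?thesis by blast
qed

text \<open>
  Chebyshev's inequality for the quadratic mean in the definition of the space of microstates.
\<close>

lemma card_far_le:
  assumes \<xi>: "\<xi> \<in> sofic_Map X \<phi> \<rho> F \<delta> n s" and g: "g \<in> F" and n: "0 < n" and \<kappa>: "0 < \<kappa>"
    and \<delta>: "\<delta>\<^sup>2 = (\<kappa> / 2)\<^sup>2 * \<theta>"
  shows "real (card {a \<in> {1..n}. \<kappa> / 2 < \<rho> (\<xi> (s g a)) (\<phi> g (\<xi> a))}) \<le> \<theta> * real n"
proof -
  let ?f = "\<lambda>a. (\<rho> (\<xi> (s g a)) (\<phi> g (\<xi> a)))\<^sup>2"
  let ?A = "{a \<in> {1..n}. \<kappa> / 2 < \<rho> (\<xi> (s g a)) (\<phi> g (\<xi> a))}"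
  have "sqrt (1 / real n * (\<Sum>a\<in>{1..n}. ?f a)) \<le> \<delta>" using \<xi> g unfolding sofic_Map_def by blast
  hence "1 / real n * (\<Sum>a\<in>{1..n}. ?f a) \<le> \<delta>\<^sup>2" by (rule sqrt_le_D)
  hence "(\<Sum>a\<in>{1..n}. ?f a) \<le> \<delta>\<^sup>2 * real n" using n by (simp add: field_simps)
  moreover have "real (card ?A) * (\<kappa> / 2)\<^sup>2 \<le> (\<Sum>a\<in>?A. ?f a)"
  proof (rule sum_bounded_below)
    fix a assume "a \<in> ?A"
    thus "(\<kappa> / 2)\<^sup>2 \<le> ?f a" using \<kappa> by (intro power_mono) auto
  qed
  moreover have "(\<Sum>a\<in>?A. ?f a) \<le> (\<Sum>a\<in>{1..n}. ?f a)" by (rule sum_mono2) auto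
  ultimately have "(\<kappa> / 2)\<^sup>2 * real (card ?A) \<le> (\<kappa> / 2)\<^sup>2 * (\<theta> * real n)"
    unfolding \<delta> by (simp only: mult_ac)
  thus ?thesis using \<kappa> by (subst (asm) mult_le_cancel_left_pos) auto
qed

text \<open>
  Merging the covers of all tiles. At a microstate the bad tiles number at most
  \<open>l * card K * \<theta> * n\<close>, the points off the tiles at most \<open>5 * \<eta> * n\<close>.
\<close>

lemma sofic_D_le_tiles:
  assumes \<alpha>: "finite_open_cover X \<alpha>" and \<kappa>: "0 < \<kappa>"
    and shrink: "\<And>A. A \<in> \<alpha>' \<Longrightarrow> \<exists>U\<in>\<alpha>. \<forall>x\<in>A. \<forall>y\<in>topspace X. \<rho> x y < \<kappa> \<longrightarrow> y \<in> U"
    and F: "\<And>j. j < l \<Longrightarrow> F j \<in> finite_subsets G" "\<And>j. j < l \<Longrightarrow> F j \<subseteq> K" and K: "finite K" "K \<subseteq> S"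
    and \<beta>: "\<And>j. j < l \<Longrightarrow> finite_open_cover X (\<beta> j)" "\<And>j. j < l \<Longrightarrow> resolves X \<pi> \<phi> \<alpha>' (F j) (\<beta> j)"
      "\<And>j x. j < l \<Longrightarrow> x \<in> topspace X \<Longrightarrow> real (multiplicity_at (\<beta> j) x) - 1 \<le> t * real (card (F j))"
    and m: "\<And>j. j < l \<Longrightarrow> card \<alpha> ^ card (F j) \<le> m"
    and t: "0 \<le> t" and \<theta>: "\<delta>\<^sup>2 = (\<kappa> / 2)\<^sup>2 * \<theta>" and \<eta>: "0 \<le> \<eta>" "\<eta> \<le> 1" and n: "0 < n"
    and q: "tile_counts G \<eta> l F (real n) q" and V: "acts_freely_at G s K {1..n} V"
    and IT: "quasi_tiling s V F \<eta> I T" "I \<subseteq> {..<l} \<times> V" "\<And>k. k < l \<Longrightarrow> card {c. (k, c) \<in> I} = q k"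
  shows "sofic_D X \<phi> \<alpha> \<pi> \<rho> S \<delta> n s \<le>
    ereal ((t + real m * real l * real (card K) * \<theta> + 5 * \<eta> * real (card \<alpha>)) * real n)"
proof -
  define M where "M = sofic_Map X \<phi> \<rho> S \<delta> n s"
  define Q where "Q = subtopology (power_topology n X) M"
  have Msub: "M \<subseteq> topspace (power_topology n X)" unfolding M_def by (rule sofic_Map_subset)
  hence top: "topspace Q = M" unfolding Q_def by auto
  have Vn: "V \<subseteq> {1..n}" using V by (simp add: acts_freely_at_def)
  hence finV: "finite V" by (rule finite_subset) simp
  have finI: "finite I" using IT(2) finV by (meson finite_SigmaI finite_lessThan finite_subset)
  note Ip = quasi_tilingD[OF IT(1,2)]
  have move: "s g c \<in> {1..n}" if "g \<in> K" "c \<in> V" for g c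
    using V that unfolding acts_freely_at_def by blast
  define C where "C = (\<lambda>p. (\<lambda>g. s g (snd p)) ` F (fst p))"
  define R where "R = {1..n} - (\<Union>p\<in>I. (\<lambda>g. s g (snd p)) ` T p)"
  have cardR: "real (card R) \<le> 5 * \<eta> * real n"
    using card_uncovered_le[OF finV IT _ \<eta> finite_subsetsD(2)[OF F(1)] F(2) V, where E = "{1..n}"] q move
    by (simp add: R_def)
  define far where "far = (\<lambda>p \<xi>. \<exists>g\<in>F (fst p). \<kappa> / 2 < \<rho> (\<xi> (s g (snd p))) (\<phi> g (\<xi> (snd p))))"
  have "\<forall>p\<in>I. \<exists>\<gamma>. finite_open_cover Q \<gamma> \<and> resolves Q (power_map n \<pi>) (\<lambda>a \<xi>. \<xi> a) \<alpha> (C p) \<gamma> \<and>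
    (\<forall>\<xi>\<in>M. multiplicity_at \<gamma> \<xi> \<le> multiplicity_at (\<beta> (fst p)) (\<xi> (snd p)) +
       (if far p \<xi> then card \<alpha> ^ card (F (fst p)) else 0))"
  proof
    fix p assume p: "p \<in> I"
    note Fp = finite_subsetsD[OF F(1)[OF Ip(1)[OF p]]]
    have vmem: "s g (snd p) \<in> {1..n}" if "g \<in> F (fst p)" for g
      using move Ip(2)[OF p] F(2)[OF Ip(1)[OF p]] that by blast
    have cmem: "snd p \<in> {1..n}" using Ip(2)[OF p] Vn by blast
    show "\<exists>\<gamma>. finite_open_cover Q \<gamma> \<and> resolves Q (power_map n \<pi>) (\<lambda>a \<xi>. \<xi> a) \<alpha> (C p) \<gamma> \<and>
      (\<forall>\<xi>\<in>M. multiplicity_at \<gamma> \<xi> \<le> multiplicity_at (\<beta> (fst p)) (\<xi> (snd p)) +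
         (if far p \<xi> then card \<alpha> ^ card (F (fst p)) else 0))"
      unfolding C_def far_def
      by (rule sofic_tile_cover[OF \<alpha> \<kappa> shrink Msub Q_def Fp(2,1) vmem cmem \<beta>(1,2)[OF Ip(1)[OF p]]])
  qed
  from bchoice[OF this] obtain \<gamma> where
    \<gamma>: "\<forall>p\<in>I. finite_open_cover Q (\<gamma> p) \<and> resolves Q (power_map n \<pi>) (\<lambda>a \<xi>. \<xi> a) \<alpha> (C p) (\<gamma> p) \<and>
    (\<forall>\<xi>\<in>M. multiplicity_at (\<gamma> p) \<xi> \<le> multiplicity_at (\<beta> (fst p)) (\<xi> (snd p)) +
       (if far p \<xi> then card \<alpha> ^ card (F (fst p)) else 0))" ..
  have "\<exists>\<omega>. finite_open_cover Q \<omega> \<and> resolves Q (power_map n \<pi>) (\<lambda>a \<xi>. \<xi> a) \<alpha> {1..n} \<omega> \<and>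
    (\<forall>\<xi>\<in>topspace Q. real (multiplicity_at \<omega> \<xi>) - 1 \<le>
       (\<Sum>p\<in>I. real (multiplicity_at (\<gamma> p) \<xi>) - 1) + real (card R) * real (card \<alpha>))"
  proof (rule resolving_covers_combine[OF _ finI _ \<alpha>])
    show "metrizable_space Q" unfolding Q_def by (rule metrizable_space_subtopology[OF metrizable_power])
    show "finite R" by (simp add: R_def)
    show "continuous_map Q X (\<lambda>\<xi>. \<xi> i)" if "i \<in> R" for i
      unfolding Q_def using that
      by (intro continuous_map_from_subtopology continuous_map_product_projection) (simp add: R_def)
    show "{1..n} \<subseteq> R \<union> (\<Union>p\<in>I. C p)"
    proof
      fix a assume a: "a \<in> {1..n}"
      show "a \<in> R \<union> (\<Union>p\<in>I. C p)"
      proof (cases "a \<in> R")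
        case False
        then obtain p g where p: "p \<in> I" "g \<in> T p" "a = s g (snd p)" using a by (auto simp: R_def)
        hence "g \<in> F (fst p)" using Ip(3)[OF p(1)] by blast
        thus ?thesis using p by (auto simp: C_def)
      qed simp
    qed
  qed (use \<gamma> in auto)
  then obtain \<omega> where \<omega>: "finite_open_cover Q \<omega>" "resolves Q (power_map n \<pi>) (\<lambda>a \<xi>. \<xi> a) \<alpha> {1..n} \<omega>"
    "\<forall>\<xi>\<in>topspace Q. real (multiplicity_at \<omega> \<xi>) - 1 \<le>
       (\<Sum>p\<in>I. real (multiplicity_at (\<gamma> p) \<xi>) - 1) + real (card R) * real (card \<alpha>)"
    by (elim exE conjE)
  have far_count: "real (card {p \<in> I. far p \<xi>}) \<le> real l * (real (card K) * (\<theta> * real n))" if \<xi>: "\<xi> \<in> M" for \<xi>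
  proof -
    define A where "A = (\<lambda>g. {a \<in> {1..n}. \<kappa> / 2 < \<rho> (\<xi> (s g a)) (\<phi> g (\<xi> a))})"
    have "{p \<in> I. far p \<xi>} \<subseteq> {..<l} \<times> (\<Union>g\<in>K. A g)"
    proof
      fix p assume p: "p \<in> {p \<in> I. far p \<xi>}"
      hence "p \<in> I" by simp
      note pI = Ip[OF this]
      obtain g where g: "g \<in> F (fst p)" "\<kappa> / 2 < \<rho> (\<xi> (s g (snd p))) (\<phi> g (\<xi> (snd p)))"
        using p unfolding far_def by blast
      have "g \<in> K" "snd p \<in> {1..n}" using g(1) F(2)[OF pI(1)] pI(2) Vn by blast+
      hence "snd p \<in> (\<Union>g\<in>K. A g)" using g(2) unfolding A_def by blast
      thus "p \<in> {..<l} \<times> (\<Union>g\<in>K. A g)" using pI(1) by (simp add: mem_Times_iff)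
    qed
    hence "card {p \<in> I. far p \<xi>} \<le> card ({..<l} \<times> (\<Union>g\<in>K. A g))"
      by (rule card_mono[rotated]) (use K in \<open>auto simp: A_def\<close>)
    also have "\<dots> = l * card (\<Union>g\<in>K. A g)" by (simp add: card_cartesian_product)
    also have "\<dots> \<le> l * (\<Sum>g\<in>K. card (A g))" by (intro mult_left_mono card_UN_le K) simp
    finally have "real (card {p \<in> I. far p \<xi>}) \<le> real (l * (\<Sum>g\<in>K. card (A g)))" by (simp only: of_nat_le_iff)
    also have "\<dots> = real l * (\<Sum>g\<in>K. real (card (A g)))" by simp
    also have "\<dots> \<le> real l * (\<Sum>g\<in>K. \<theta> * real n)"
    proof (intro mult_left_mono sum_mono)
      fix g assume "g \<in> K"
      hence "g \<in> S" using K by blast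
      thus "real (card (A g)) \<le> \<theta> * real n"
        unfolding A_def using \<xi> by (intro card_far_le[OF _ _ n \<kappa> \<theta>]) (auto simp: M_def)
    qed simp
    finally show ?thesis by simp
  qed
  let ?r = "(t + real m * real l * real (card K) * \<theta> + 5 * \<eta> * real (card \<alpha>)) * real n"
  have bound: "real (multiplicity_at \<omega> \<xi>) - 1 \<le> ?r" if \<xi>: "\<xi> \<in> M" for \<xi>
  proof -
    have "(\<Sum>p\<in>I. real (multiplicity_at (\<gamma> p) \<xi>) - 1) \<le>
        (\<Sum>p\<in>I. t * real (card (F (fst p))) + (if far p \<xi> then real m else 0))"
    proof (rule sum_mono)
      fix p assume p: "p \<in> I"
      have "\<xi> (snd p) \<in> topspace X" using \<xi> Msub Ip(2)[OF p] Vn by (auto simp: PiE_iff)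
      hence 1: "real (multiplicity_at (\<beta> (fst p)) (\<xi> (snd p))) - 1 \<le> t * real (card (F (fst p)))"
        by (rule \<beta>(3)[OF Ip(1)[OF p]])
      have "multiplicity_at (\<gamma> p) \<xi> \<le> multiplicity_at (\<beta> (fst p)) (\<xi> (snd p)) +
         (if far p \<xi> then card \<alpha> ^ card (F (fst p)) else 0)"
        using \<gamma> p \<xi> by blast
      also have "\<dots> \<le> multiplicity_at (\<beta> (fst p)) (\<xi> (snd p)) + (if far p \<xi> then m else 0)"
        using m[OF Ip(1)[OF p]] by simp
      finally have "real (multiplicity_at (\<gamma> p) \<xi>) \<le>
          real (multiplicity_at (\<beta> (fst p)) (\<xi> (snd p)) + (if far p \<xi> then m else 0))"
        by (simp only: of_nat_le_iff)
      thus "real (multiplicity_at (\<gamma> p) \<xi>) - 1 \<le> t * real (card (F (fst p))) + (if far p \<xi> then real m else 0)"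
        using 1 by (auto split: if_splits)
    qed
    also have "\<dots> = t * (\<Sum>k<l. real (q k) * real (card (F k))) + (\<Sum>p\<in>I. if far p \<xi> then real m else 0)"
      using sum_over_centres[of V I 0 l q "\<lambda>k. real (card (F k))"] finV IT(2,3)
      by (simp add: atLeast0LessThan sum.distrib flip: sum_distrib_left)
    also have "(\<Sum>p\<in>I. if far p \<xi> then real m else 0) = (\<Sum>p\<in>{p \<in> I. far p \<xi>}. real m)"
      by (rule sum.inter_filter[OF finI, symmetric])
    also have "\<dots> = real m * real (card {p \<in> I. far p \<xi>})" by simp
    also have "\<dots> \<le> real m * (real l * (real (card K) * (\<theta> * real n)))"
      by (intro mult_left_mono far_count \<xi>) simp
    also have "t * (\<Sum>k<l. real (q k) * real (card (F k))) \<le> t * real n"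
      using q t by (intro mult_left_mono) (simp_all add: tile_counts_def)
    finally have "(\<Sum>p\<in>I. real (multiplicity_at (\<gamma> p) \<xi>) - 1)
        \<le> t * real n + real m * (real l * (real (card K) * (\<theta> * real n)))" by simp
    moreover have "real (card R) * real (card \<alpha>) \<le> (5 * \<eta> * real n) * real (card \<alpha>)"
      by (rule mult_right_mono[OF cardR]) simp
    moreover have "real (multiplicity_at \<omega> \<xi>) - 1 \<le>
       (\<Sum>p\<in>I. real (multiplicity_at (\<gamma> p) \<xi>) - 1) + real (card R) * real (card \<alpha>)"
      using \<omega>(3) \<xi> top by blast
    ultimately have "real (multiplicity_at \<omega> \<xi>) - 1 \<le>
        t * real n + real m * (real l * (real (card K) * (\<theta> * real n))) + (5 * \<eta> * real n) * real (card \<alpha>)"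
      by linarith
    also have "\<dots> = ?r" by (simp add: algebra_simps)
    finally show ?thesis .
  qed
  have fib: "fibrewise_refines (topspace Q) (power_map n \<pi>) \<omega> (restrict_family (power_cover n \<alpha>) M)"
    using \<omega>(2) resolves_iff_power[OF Msub] unfolding top unfolding Q_def by blast
  have "cond_D Q (power_map n \<pi>) (power_map n \<pi> ` M) (restrict_family (power_cover n \<alpha>) M) \<le> ereal ?r"
    by (rule cond_D_le[OF \<omega>(1) fib]) (use bound top in auto)
  thus ?thesis by (simp add: sofic_D_def Let_def M_def Q_def)
qed

text \<open>
  The constants \<open>m\<close>, \<open>l\<close> and \<open>card K\<close> depend only on the shapes, so \<open>\<delta>\<close> can be chosen after them.
\<close>

lemma sofic_D_eventually_le:
  assumes sofic: "sofic_approximation G d \<sigma>" and \<alpha>: "finite_open_cover X \<alpha>" and \<alpha>': "finite_open_cover X \<alpha>'"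
    and \<kappa>: "0 < \<kappa>"
    and shrink: "\<And>A. A \<in> \<alpha>' \<Longrightarrow> \<exists>U\<in>\<alpha>. \<forall>x\<in>A. \<forall>y\<in>topspace X. \<rho> x y < \<kappa> \<longrightarrow> y \<in> U"
    and freq: "frequently (\<lambda>F. orbit_D \<alpha>' F < ereal (t * real (card F))) (invariance_filter G)"
    and t: "0 \<le> t" and \<epsilon>: "0 < \<epsilon>"
  shows "\<exists>S\<in>finite_subsets G. \<exists>\<delta>>0.
    eventually (\<lambda>i. sofic_D X \<phi> \<alpha> \<pi> \<rho> S \<delta> (d i) (\<sigma> i) \<le> ereal ((t + \<epsilon>) * real (d i))) sequentially"
proof -
  define \<eta> where "\<eta> = min (1 / 2) (\<epsilon> / (10 * (real (card \<alpha>) + 1)))"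
  have \<eta>: "0 < \<eta>" using \<epsilon> by (simp add: \<eta>_def)
  have \<eta>2: "\<eta> \<le> 1 / 2" unfolding \<eta>_def by (rule min.cobounded1)
  have "\<eta> \<le> \<epsilon> / (10 * (real (card \<alpha>) + 1))" unfolding \<eta>_def by (rule min.cobounded2)
  hence \<eta>\<alpha>: "5 * \<eta> * real (card \<alpha>) \<le> \<epsilon> / 2" using \<eta> by (simp add: field_simps)
  obtain l F K N\<^sub>0 where F: "\<And>j. j < l \<Longrightarrow> F j \<in> finite_subsets G"
    and FD: "\<And>j. j < l \<Longrightarrow> orbit_D \<alpha>' (F j) < ereal (t * real (card (F j)))"
    and K: "K \<subseteq> carrier G" "finite K" and FK: "\<And>j. j < l \<Longrightarrow> F j \<subseteq> K"
    and invFK: "\<And>i j. i < l \<Longrightarrow> j < l \<Longrightarrow> (m_inv G ` F i) <#> F j \<subseteq> K"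
    and counts: "\<And>N. N\<^sub>0 \<le> N \<Longrightarrow> \<exists>n. tile_counts G \<eta> l F (real N) n"
    using tile_system_exists[OF freq \<eta> \<eta>2] by metis
  have "\<forall>j\<in>{..<l}. \<exists>\<beta>. finite_open_cover X \<beta> \<and> resolves X \<pi> \<phi> \<alpha>' (F j) \<beta> \<and>
      (\<forall>x\<in>topspace X. real (multiplicity_at \<beta> x) - 1 \<le> t * real (card (F j)))"
    using orbit_D_less[OF FD \<alpha>'] by blast
  from bchoice[OF this] obtain \<beta> where \<beta>: "\<forall>j\<in>{..<l}. finite_open_cover X (\<beta> j) \<and>
      resolves X \<pi> \<phi> \<alpha>' (F j) (\<beta> j) \<and>
      (\<forall>x\<in>topspace X. real (multiplicity_at (\<beta> j) x) - 1 \<le> t * real (card (F j)))" ..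
  hence \<beta>': "\<And>j. j < l \<Longrightarrow> finite_open_cover X (\<beta> j)"
      "\<And>j. j < l \<Longrightarrow> resolves X \<pi> \<phi> \<alpha>' (F j) (\<beta> j)"
      "\<And>j x. j < l \<Longrightarrow> x \<in> topspace X \<Longrightarrow> real (multiplicity_at (\<beta> j) x) - 1 \<le> t * real (card (F j))"
    by simp_all
  define m where "m = (\<Sum>j<l. card \<alpha> ^ card (F j))"
  have m: "card \<alpha> ^ card (F j) \<le> m" if "j < l" for j
    unfolding m_def by (rule member_le_sum) (use that in auto)
  define z where "z = real m * real l * real (card K)"
  have z: "0 \<le> z" by (simp add: z_def)
  define \<theta> where "\<theta> = \<epsilon> / (2 * (z + 1))"
  have \<theta>: "0 < \<theta>" "z * \<theta> \<le> \<epsilon> / 2" using \<epsilon> z by (auto simp: \<theta>_def field_simps add_nonneg_pos)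
  define \<delta> where "\<delta> = \<kappa> / 2 * sqrt \<theta>"
  have \<delta>: "0 < \<delta>" "\<delta>\<^sup>2 = (\<kappa> / 2)\<^sup>2 * \<theta>"
    using \<kappa> \<theta>(1) unfolding \<delta>_def power_mult_distrib by simp_all
  \<comment> \<open>The unit element is inserted only to make the set nonempty in case there are no shapes.\<close>
  define S where "S = insert \<one> K"
  have S: "S \<in> finite_subsets G" "K \<subseteq> S" using K by (auto simp: S_def finite_subsets_def)
  from sofic_eventually_free[OF sofic K \<eta>] sofic_eventually_large[OF sofic, of "max 1 N\<^sub>0"]
  have "eventually (\<lambda>i. sofic_D X \<phi> \<alpha> \<pi> \<rho> S \<delta> (d i) (\<sigma> i) \<le> ereal ((t + \<epsilon>) * real (d i))) sequentially"
  proof eventually_elim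
    case (elim i)
    then obtain V where V: "acts_freely_at G (\<sigma> i) K {1..d i} V" "(1 - \<eta>) * real (d i) \<le> real (card V)"
      by blast
    have di: "0 < d i" "N\<^sub>0 \<le> d i" using elim(2) by simp_all
    have "V \<subseteq> {1..d i}" using V(1) by (simp add: acts_freely_at_def)
    hence finV: "finite V" by (rule finite_subset) simp
    obtain q where q: "tile_counts G \<eta> l F (real (d i)) q" using counts[OF di(2)] by blast
    obtain I T where IT: "quasi_tiling (\<sigma> i) V F \<eta> I T" "I \<subseteq> {..<l} \<times> V"
        "\<And>k. k < l \<Longrightarrow> card {c. (k, c) \<in> I} = q k"
      using quasi_tiling_of_size[OF F FK invFK q \<eta> \<eta>2 finV V] by blast
    have "sofic_D X \<phi> \<alpha> \<pi> \<rho> S \<delta> (d i) (\<sigma> i) \<le>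
        ereal ((t + real m * real l * real (card K) * \<theta> + 5 * \<eta> * real (card \<alpha>)) * real (d i))"
      by (rule sofic_D_le_tiles[OF \<alpha> \<kappa> shrink F FK K(2) S(2) \<beta>' m t \<delta>(2) _ _ di(1) q V(1) IT])
        (use \<eta> \<eta>2 in auto)
    also have "\<dots> \<le> ereal ((t + \<epsilon>) * real (d i))"
    proof -
      have "t + real m * real l * real (card K) * \<theta> + 5 * \<eta> * real (card \<alpha>) \<le> t + \<epsilon>"
        using \<theta>(2) \<eta>\<alpha> by (simp add: z_def)
      thus ?thesis by (simp add: mult_right_mono)
    qed
    finally show ?case .
  qed
  thus ?thesis using S(1) \<delta>(1) by blast
qed

section \<open>Comparison\<close>

text \<open>
  For each cover the sofic term \<open>S \<alpha>\<close> lies between the limit \<open>L \<alpha>\<close> and the limit \<open>L \<alpha>'\<close> for a shrunk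
  cover \<open>\<alpha>'\<close>, so equality is reached after taking suprema.
\<close>

lemma sofic_cond_mdim_eq:
  assumes sofic: "sofic_approximation G d \<sigma>"
  shows "sofic_cond_mdim G d \<sigma> X \<phi> \<rho> \<pi> = cond_mdim G X \<phi> Y \<pi>"
proof -
  let ?q = "\<lambda>\<alpha> F. orbit_D \<alpha> F / ereal (real (card F))"
  let ?\<F> = "invariance_filter G"
  let ?s = "\<lambda>\<alpha> F \<delta> i. sofic_D X \<phi> \<alpha> \<pi> \<rho> F \<delta> (d i) (\<sigma> i) / ereal (real (d i))"
  define S where "S = (\<lambda>\<alpha>. INF F\<in>finite_subsets G. INF \<delta>\<in>{0<..}. limsup (?s \<alpha> F \<delta>))"
  define L where "L = (\<lambda>\<alpha>. Lim ?\<F> (?q \<alpha>))"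
  have fs: "eventually (\<lambda>F. F \<in> finite_subsets G) ?\<F>"
    using eventually_almost_invariant[of "{}" 1] by (auto simp: almost_invariant_def elim: eventually_mono)
  have d: "eventually (\<lambda>i. 1 \<le> d i) sequentially" by (rule sofic_eventually_large[OF sofic])
  have L: "\<exists>r. 0 \<le> r \<and> L \<alpha> = ereal r \<and> (?q \<alpha> \<longlongrightarrow> ereal r) ?\<F>"
    if \<alpha>: "finite_open_cover X \<alpha>" for \<alpha>
  proof -
    obtain r where r: "0 \<le> r" "(?q \<alpha> \<longlongrightarrow> ereal r) ?\<F>" using orbit_D_limit_exists[OF \<alpha>] by blast
    hence "L \<alpha> = ereal r" unfolding L_def by (intro tendsto_Lim filter_nontrivial)
    thus ?thesis using r by blast
  qed
  have lower: "L \<alpha> \<le> S \<alpha>" if \<alpha>: "finite_open_cover X \<alpha>" for \<alpha>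
  proof -
    obtain r where r: "0 \<le> r" "L \<alpha> = ereal r" "(?q \<alpha> \<longlongrightarrow> ereal r) ?\<F>" using L[OF \<alpha>] by blast
    have "ereal r \<le> limsup (?s \<alpha> F \<delta>)" if F: "F \<in> finite_subsets G" and \<delta>: "0 < \<delta>" for F \<delta>
    proof (rule ereal_le_epsilon2)
      fix e :: real assume e: "0 < e"
      \<comment> \<open>The maximum keeps \<open>t\<close> nonnegative if the limit is \<open>0\<close>.\<close>
      define t where "t = max 0 (r - e / 2)"
      have t: "0 \<le> t" by (simp add: t_def)
      have "ereal (r - e / 2) < ereal r" using e by simp
      from order_tendstoD(1)[OF r(3) this] fs
      have "eventually (\<lambda>E. ereal (t * real (card E)) \<le> orbit_D \<alpha> E) ?\<F>"
      proof eventually_elim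
        case (elim E)
        have "0 < real (card E)" using finite_subsetsD(4)[OF elim(2)] by simp
        hence "ereal ((r - e / 2) * real (card E)) \<le> orbit_D \<alpha> E"
          using elim(1) ereal_div_less_iff(4) less_imp_le by blast
        thus ?case using orbit_D_nonneg[of \<alpha> E] by (simp add: t_def max_def zero_ereal_def)
      qed
      from sofic_D_eventually_ge[OF sofic \<alpha> t _ this F \<delta>, of "e / 2"] e
      have "eventually (\<lambda>i. ereal ((t - e / 2) * real (d i)) \<le> sofic_D X \<phi> \<alpha> \<pi> \<rho> F \<delta> (d i) (\<sigma> i)) sequentially"
        by simp
      with d have "eventually (\<lambda>i. ereal (t - e / 2) \<le> ?s \<alpha> F \<delta> i) sequentially"
      proof eventually_elim
        case (elim i)
        have "0 < real (d i)" using elim(1) by simp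
        thus ?case using elim(2) ereal_div_less_iff(3) by blast
      qed
      hence "ereal (t - e / 2) \<le> limsup (?s \<alpha> F \<delta>)" by (rule le_Limsup[OF sequentially_bot])
      hence "ereal (t - e / 2) + ereal e \<le> limsup (?s \<alpha> F \<delta>) + ereal e" by (rule add_right_mono)
      moreover have "ereal r \<le> ereal (t - e / 2) + ereal e" by (simp add: t_def)
      ultimately show "ereal r \<le> limsup (?s \<alpha> F \<delta>) + ereal e" by (rule order_trans[rotated])
    qed
    thus ?thesis unfolding S_def r(2) by (intro INF_greatest) auto
  qed
  have upper: "\<exists>\<alpha>'. finite_open_cover X \<alpha>' \<and> S \<alpha> \<le> L \<alpha>'" if \<alpha>: "finite_open_cover X \<alpha>" for \<alpha>
  proof -
    obtain \<alpha>' \<kappa> where \<alpha>': "finite_open_cover X \<alpha>'" and \<kappa>: "0 < \<kappa>"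
      and shrink: "\<And>A. A \<in> \<alpha>' \<Longrightarrow> \<exists>U\<in>\<alpha>. \<forall>x\<in>A. \<forall>y\<in>topspace X. \<rho> x y < \<kappa> \<longrightarrow> y \<in> U"
      using shrunk_cover_exists[OF \<alpha>] by blast
    obtain r where r: "0 \<le> r" "L \<alpha>' = ereal r" "(?q \<alpha>' \<longlongrightarrow> ereal r) ?\<F>" using L[OF \<alpha>'] by blast
    have "S \<alpha> \<le> ereal r"
    proof (rule ereal_le_epsilon2)
      fix e :: real assume e: "0 < e"
      define t where "t = r + e / 2"
      have t: "0 \<le> t" using r(1) e by (simp add: t_def)
      have "ereal r < ereal t" using e by (simp add: t_def)
      from order_tendstoD(2)[OF r(3) this] fs
      have "eventually (\<lambda>E. orbit_D \<alpha>' E < ereal (t * real (card E))) ?\<F>"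
      proof eventually_elim
        case (elim E)
        have "0 < real (card E)" using finite_subsetsD(4)[OF elim(2)] by simp
        thus ?case using elim(1) ereal_div_less_iff(1) by blast
      qed
      hence freq: "frequently (\<lambda>E. orbit_D \<alpha>' E < ereal (t * real (card E))) ?\<F>"
        by (rule eventually_frequently[OF filter_nontrivial])
      have e2: "0 < e / 2" using e by simp
      obtain F \<delta> where F: "F \<in> finite_subsets G" "0 < \<delta>"
        and ev: "eventually (\<lambda>i. sofic_D X \<phi> \<alpha> \<pi> \<rho> F \<delta> (d i) (\<sigma> i) \<le> ereal ((t + e / 2) * real (d i))) sequentially"
        using sofic_D_eventually_le[OF sofic \<alpha> \<alpha>' \<kappa> shrink freq t e2] by blast
      from d ev have "eventually (\<lambda>i. ?s \<alpha> F \<delta> i \<le> ereal (t + e / 2)) sequentially"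
      proof eventually_elim
        case (elim i)
        have "0 < real (d i)" using elim(1) by simp
        thus ?case using elim(2) ereal_div_less_iff(2) by blast
      qed
      hence "limsup (?s \<alpha> F \<delta>) \<le> ereal (t + e / 2)" by (rule Limsup_bounded)
      moreover have "S \<alpha> \<le> limsup (?s \<alpha> F \<delta>)"
        unfolding S_def by (rule INF_lower2[OF F(1)], rule INF_lower) (use F(2) in simp)
      ultimately have "S \<alpha> \<le> ereal (t + e / 2)" by (rule order_trans[rotated])
      also have "t + e / 2 = r + e" by (simp add: t_def)
      finally show "S \<alpha> \<le> ereal r + ereal e" by simp
    qed
    thus ?thesis using \<alpha>' r(2) by auto
  qed
  have "(SUP \<alpha>\<in>{\<alpha>. finite_open_cover X \<alpha>}. S \<alpha>) = (SUP \<alpha>\<in>{\<alpha>. finite_open_cover X \<alpha>}. L \<alpha>)"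
  proof (rule antisym)
    show "(SUP \<alpha>\<in>{\<alpha>. finite_open_cover X \<alpha>}. S \<alpha>) \<le> (SUP \<alpha>\<in>{\<alpha>. finite_open_cover X \<alpha>}. L \<alpha>)"
      by (rule SUP_mono) (use upper in blast)
    show "(SUP \<alpha>\<in>{\<alpha>. finite_open_cover X \<alpha>}. L \<alpha>) \<le> (SUP \<alpha>\<in>{\<alpha>. finite_open_cover X \<alpha>}. S \<alpha>)"
      by (rule SUP_mono) (use lower in blast)
  qed
  thus ?thesis unfolding sofic_cond_mdim_def cond_mdim_def S_def L_def orbit_D_def .
qed

end

lemma sofic_cond_mdim_empty:
  assumes "group G" and sofic: "sofic_approximation G d \<sigma>" and X: "topspace X = {}"
  shows "sofic_cond_mdim G d \<sigma> X \<phi> \<rho> \<pi> = -\<infinity>"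
proof -
  interpret group G by fact
  have d: "eventually (\<lambda>i. 1 \<le> d i) sequentially" by (rule sofic_eventually_large[OF sofic])
  have D: "sofic_D X \<phi> \<alpha> \<pi> \<rho> F \<delta> n s = -\<infinity>" if "1 \<le> n" for \<alpha> F \<delta> n s
  proof -
    have "(1::nat) \<in> {1..n}" using that by simp
    hence "topspace (power_topology n X) = {}" using X by (auto simp: PiE_eq_empty_iff)
    thus ?thesis unfolding sofic_D_def Let_def by (intro cond_D_empty) simp
  qed
  have one: "{\<one>\<^bsub>G\<^esub>} \<in> finite_subsets G" by (simp add: finite_subsets_def)
  have "(INF F\<in>finite_subsets G. INF \<delta>\<in>{0<..}.
      limsup (\<lambda>i. sofic_D X \<phi> \<alpha> \<pi> \<rho> F \<delta> (d i) (\<sigma> i) / ereal (real (d i)))) \<le> -\<infinity>" for \<alpha>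
  proof (rule INF_lower2[OF one], rule INF_lower2[of 1])
    show "limsup (\<lambda>i. sofic_D X \<phi> \<alpha> \<pi> \<rho> {\<one>\<^bsub>G\<^esub>} 1 (d i) (\<sigma> i) / ereal (real (d i))) \<le> -\<infinity>"
    proof (rule Limsup_bounded)
      show "eventually (\<lambda>i. sofic_D X \<phi> \<alpha> \<pi> \<rho> {\<one>\<^bsub>G\<^esub>} 1 (d i) (\<sigma> i) / ereal (real (d i)) \<le> -\<infinity>) sequentially"
        using d by eventually_elim (simp add: D)
    qed
  qed simp
  hence "sofic_cond_mdim G d \<sigma> X \<phi> \<rho> \<pi> \<le> -\<infinity>"
    unfolding sofic_cond_mdim_def by (intro SUP_least)
  thus ?thesis by simp
qed

lemma cond_mdim_empty:
  assumes "group G" "amenable G" and X: "topspace X = {}"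
  shows "cond_mdim G X \<phi> Y \<pi> = -\<infinity>"
proof -
  interpret group G by fact
  have nb: "invariance_filter G \<noteq> bot" by (rule amenable_imp_invariance_filter_nontrivial[OF assms(2)])
  have "Lim (invariance_filter G)
      (\<lambda>F. cond_D X \<pi> (topspace Y) (cover_iterate X \<phi> F \<alpha>) / ereal (real (card F))) = -\<infinity>" for \<alpha>
  proof (rule tendsto_Lim[OF nb], rule tendsto_eventually)
    have "eventually (almost_invariant G {} 1) (invariance_filter G)"
      by (rule eventually_almost_invariant) auto
    thus "eventually (\<lambda>F. cond_D X \<pi> (topspace Y) (cover_iterate X \<phi> F \<alpha>) / ereal (real (card F)) = -\<infinity>)
        (invariance_filter G)"
    proof eventually_elim
      case (elim F)
      hence "0 < card F" by (simp add: almost_invariant_def finite_subsetsD(4))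
      thus ?case by (simp add: cond_D_empty[OF X])
    qed
  qed
  hence "cond_mdim G X \<phi> Y \<pi> \<le> -\<infinity>" unfolding cond_mdim_def by (intro SUP_least) simp
  thus ?thesis by simp
qed

theorem theorem8p5:
  fixes G :: "('g, 'm) monoid_scheme"
    and d :: "nat \<Rightarrow> nat" and \<sigma> :: "nat \<Rightarrow> 'g \<Rightarrow> nat \<Rightarrow> nat"
    and X :: "'x topology" and \<phi> :: "'g \<Rightarrow> 'x \<Rightarrow> 'x" and \<rho> :: "'x \<Rightarrow> 'x \<Rightarrow> real"
    and Y :: "'y topology" and \<psi> :: "'g \<Rightarrow> 'y \<Rightarrow> 'y" and \<pi> :: "'x \<Rightarrow> 'y"
  assumes "group G" and "countable (carrier G)" and "infinite (carrier G)" and "amenable G"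
    and "sofic_approximation G d \<sigma>"
    and "G_system G X \<phi>" and "G_system G Y \<psi>" and "factor_map G X \<phi> Y \<psi> \<pi>"
    and "compatible_metric X \<rho>"
  shows "sofic_cond_mdim G d \<sigma> X \<phi> \<rho> \<pi> = cond_mdim G X \<phi> Y \<pi>"
proof (cases "topspace X = {}")
  case True
  show ?thesis
    unfolding sofic_cond_mdim_empty[OF assms(1,5) True] cond_mdim_empty[OF assms(1,4) True] ..
next
  case False
  interpret factor_system G X \<phi> \<rho> Y \<psi> \<pi>
    by (intro factor_system.intro assms False)
  show ?thesis by (rule sofic_cond_mdim_eq[OF assms(5)])
qed

end
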